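(* Let $p(\cdot)\in C^{\log}(\mathbb{R}^n)$ and $\underline{p}:=\min\{p_-,1\}$. Then, for any $G\in T_A^{p(\cdot)}(\mathbb{R}^n\times\mathbb{Z})$, there exist $\{\lambda_j\}_{j\in\mathbb{N}}\subset[0,\infty)$, $\{B^{(j)}\}_{j\in\mathbb{N}}\subset\mathfrak{B}$, and a sequence $\{A_j\}_{j\in\mathbb{N}}$ of anisotropic $(p(\cdot),\infty)$-atoms supported, respectively, in $\{\widehat{B^{(j)}}\}_{j\in\mathbb{N}}$ such that, for almost every $(x,k)\in\mathbb{R}^n\times\mathbb{Z}$, $$G(x,k)=\sum_{j\in\mathbb{N}}\lambda_jA_j(x,k)\quad\text{and}\quad|G(x,k)|=\sum_{j\in\mathbb{N}}\lambda_j|A_j(x,k)|$$ pointwisely, and $$\left\|\left\{\sum_{j\in\mathbb{N}}\left[\frac{\lambda_j}{\|\mathbf{1}_{B^{(j)}}\|_{L^{p(\cdot)}(\mathbb{R}^n)}}\right]^{\underline{p}}\mathbf{1}_{B^{(j)}}\right\}^{1/\underline{p}}\right\|_{L^{p(\cdot)}(\mathbb{R}^n)}\le C\|G\|_{T_A^{p(\cdot)}(\mathbb{R}^n\times\mathbb{Z})},$$ where the positive constant $C$ is independent of $G$.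
   Context: Dilations. $A$ is a fixed real $n\times n$ expansive matrix (dilation), i.e. all eigenvalues $\lambda$ of $A$ satisfy $|\lambda|>1$; $b:=|\det A|\in(1,\infty)$. Fix an open ellipsoid $\Delta$ centred at the origin with $|\Delta|=1$ and a number $r_0\in(1,\infty)$ with $\Delta\subset r_0\Delta\subset A\Delta$ (these exist). For $k\in\mathbb{Z}$ put $B_k:=A^k\Delta$, so $|B_k|=b^k$. The family of dilated balls is $\mathfrak{B}:=\{x+B_k:\ x\in\mathbb{R}^n,\ k\in\mathbb{Z}\}$. The step homogeneous quasi-norm is $\rho(x):=\sum_{k\in\mathbb{Z}}b^k\mathbf{1}_{B_{k+1}\setminus B_k}(x)$ for $x\ne\mathbf{0}$, $\rho(\mathbf{0}):=0$. Variable exponents. $\mathcal{P}(\mathbb{R}^n)$ is the set of measurable $p(\cdot):\mathbb{R}^n\to(0,\infty]$ with $0<p_-:=\operatorname{ess\,inf}p\le\operatorname{ess\,sup}p=:p_+<\infty$. $L^{p(\cdot)}(\mathbb{R}^n)$ is the variable Lebesgue space with quasi-norm $\|f\|_{L^{p(\cdot)}(\mathbb{R}^n)}:=\inf\{\lambda\in(0,\infty):\int_{\mathbb{R}^n}(|f(x)|/\lambda)^{p(x)}\,dx\le1\}$. $C^{\log}(\mathbb{R}^n)$ is the set of $p(\cdot)\in\mathcal{P}(\mathbb{R}^n)$ for which there exist $C_{\log}(p),C_\infty\in(0,\infty)$ and $p_\infty\in\mathbb{R}$ with $|p(x)-p(y)|\le C_{\log}(p)/\log(e+1/\rho(x-y))$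 and $|p(x)-p_\infty|\le C_\infty/\log(e+\rho(x))$ for all $x,y\in\mathbb{R}^n$. Tent spaces. $\mathbb{R}^n\times\mathbb{Z}$ carries the product of Lebesgue measure and counting measure. For $x\in\mathbb{R}^n$, $\Gamma(x):=\{(y,k)\in\mathbb{R}^n\times\mathbb{Z}:\ y\in x+B_k\}$. For measurable $G$ on $\mathbb{R}^n\times\mathbb{Z}$ the anisotropic discrete Lusin area function is $$\mathcal{A}(G)(x):=\left[\sum_{\ell\in\mathbb{Z}}b^{-\ell}\int_{\{y\in\mathbb{R}^n:(y,\ell)\in\Gamma(x)\}}|G(y,\ell)|^2\,dy\right]^{1/2}.$$ The anisotropic variable tent space $T_A^{p(\cdot)}(\mathbb{R}^n\times\mathbb{Z})$ is the set of measurable $G$ on $\mathbb{R}^n\times\mathbb{Z}$ with $\|G\|_{T_A^{p(\cdot)}(\mathbb{R}^n\times\mathbb{Z})}:=\|\mathcal{A}(G)\|_{L^{p(\cdot)}(\mathbb{R}^n)}<\infty$. The tent over $B\in\mathfrak{B}$ is $\widehat{B}:=\{(y,k)\in\mathbb{R}^n\times\mathbb{Z}:\ y+B_k\subset B\}$. Atoms. For $q\in(1,\infty)$, a measurable function $a$ on $\mathbb{R}^n\times\mathbb{Z}$ is an anisotropic $(p(\cdot),q)$-atom, supported in $\widehat{B}$, if $B\in\mathfrak{B}$ is such that (i) $\{(x,k):a(x,k)\ne0\}\subset\widehat{B}$ and (ii) $\|a\|_{T_2^q(\mathbb{R}^n\times\mathbb{Z})}:=\|\mathcal{A}(a)\|_{L^q(\mathbb{R}^n)}\le|B|^{1/q}/\|\mathbf{1}_B\|_{L^{p(\cdot)}(\mathbb{R}^n)}$.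 If $a$ is an anisotropic $(p(\cdot),q)$-atom (supported in $\widehat{B}$) for every $q\in(1,\infty)$, it is called an anisotropic $(p(\cdot),\infty)$-atom (supported in $\widehat{B}$). *)

theory Defs
  imports "HOL-Analysis.Analysis" "HOL-Probability.Essential_Supremum"
begin

section \<open>Powers and essential infimum\<close>

text \<open>The power \<open>x\<^sup>r\<close> of \<open>x \<in> [0,\<infinity>]\<close> for a real exponent \<open>r > 0\<close>, with \<open>0\<^sup>r = 0\<close> and
  \<open>\<infinity>\<^sup>r = \<infinity>\<close>.  It is only used for \<open>r > 0\<close>.\<close>

definition ennpowr :: "ennreal \<Rightarrow> real \<Rightarrow> ennreal" where
  "ennpowr x r = (if x = \<infinity> then \<infinity> else ennreal (enn2real x powr r))"

definition essinf :: "'a measure \<Rightarrow> ('a \<Rightarrow> ereal) \<Rightarrow> ereal" where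
  "essinf M f = - esssup M (\<lambda>x. - f x)"

section \<open>Expansive dilations and dilated balls\<close>

text \<open>The eigenvalues of a real matrix are its complex eigenvalues.\<close>

definition expansive :: "real^'n^'n \<Rightarrow> bool" where
  "expansive A \<longleftrightarrow>
     (\<forall>(c::complex) (v::complex^'n). v \<noteq> 0 \<and> map_matrix complex_of_real A *v v = c *s v \<longrightarrow> cmod c > 1)"

text \<open>Open ellipsoids centred at the origin.\<close>

definition open_ellipsoid0 :: "(real^'n) set \<Rightarrow> bool" where
  "open_ellipsoid0 \<Delta> \<longleftrightarrow> (\<exists>P::real^'n^'n. invertible P \<and> \<Delta> = {x. norm (P *v x) < 1})"

definition mat_powi :: "real^'n^'n \<Rightarrow> int \<Rightarrow> real^'n^'n" where
  "mat_powi A k = (if k \<ge> 0 then ((\<lambda>X. A ** X) ^^ nat k) (mat 1)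
                   else ((\<lambda>X. matrix_inv A ** X) ^^ nat (- k)) (mat 1))"

definition dil :: "real^'n^'n \<Rightarrow> real" where
  "dil A = \<bar>det A\<bar>"

definition Bk :: "real^'n^'n \<Rightarrow> (real^'n) set \<Rightarrow> int \<Rightarrow> (real^'n) set" where
  "Bk A \<Delta> k = (\<lambda>x. mat_powi A k *v x) ` \<Delta>"

definition dballs :: "real^'n^'n \<Rightarrow> (real^'n) set \<Rightarrow> (real^'n) set set" where
  "dballs A \<Delta> = {(\<lambda>z. x + z) ` Bk A \<Delta> k | x k. True}"

definition qnorm :: "real^'n^'n \<Rightarrow> (real^'n) set \<Rightarrow> real^'n \<Rightarrow> real" where
  "qnorm A \<Delta> x = (if x = 0 then 0
     else (\<Sum>\<^sub>\<infinity>k\<in>(UNIV::int set). dil A powi k * indicator (Bk A \<Delta> (k + 1) - Bk A \<Delta> k) x))"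

section \<open>Variable exponents\<close>

definition var_exponents :: "(real^'n \<Rightarrow> ereal) set" where
  "var_exponents = {p. p \<in> borel_measurable lebesgue \<and> (\<forall>x. 0 < p x) \<and>
                       0 < essinf lebesgue p \<and> esssup lebesgue p < \<infinity>}"

text \<open>At \<open>x = y\<close> the quotient \<open>1 / \<rho>(x - y)\<close> is \<open>0\<close> here rather than \<open>\<infinity>\<close>.  This is harmless: for
  \<open>p x < \<infinity>\<close> the left-hand side of the first inequality is then \<open>0\<close>, and the second inequality
  forces \<open>p x < \<infinity>\<close> for every \<open>x\<close>.\<close>

definition C_log :: "real^'n^'n \<Rightarrow> (real^'n) set \<Rightarrow> (real^'n \<Rightarrow> ereal) set" where
  "C_log A \<Delta> = {p \<in> var_exponents. \<exists>(c_log::real) (c_inf::real) (p_inf::real). c_log > 0 \<and> c_inf > 0 \<and>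
     (\<forall>x y. \<bar>p x - p y\<bar> \<le> ereal (c_log / ln (exp 1 + 1 / qnorm A \<Delta> (x - y)))) \<and>
     (\<forall>x. \<bar>p x - ereal p_inf\<bar> \<le> ereal (c_inf / ln (exp 1 + qnorm A \<Delta> x)))}"

definition p_under :: "(real^'n \<Rightarrow> ereal) \<Rightarrow> real" where
  "p_under p = min (real_of_ereal (essinf lebesgue p)) 1"

text \<open>The Luxemburg quasi-norm, as a functional of \<open>f = |g| : \<real>\<^sup>n \<rightarrow> [0,\<infinity>]\<close>.  An exponent in
  \<^const>\<open>var_exponents\<close> is finite almost everywhere, so the value of \<^const>\<open>real_of_ereal\<close> at
  \<open>\<infinity>\<close> does not matter.  The infimum of the empty set is \<open>\<infinity>\<close>.\<close>

definition Lp_var_norm :: "(real^'n \<Rightarrow> ereal) \<Rightarrow> (real^'n \<Rightarrow> ennreal) \<Rightarrow> ennreal" where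
  "Lp_var_norm p f = Inf {ennreal t | t. t > 0 \<and>
     (\<integral>\<^sup>+x. ennpowr (f x / ennreal t) (real_of_ereal (p x)) \<partial>lebesgue) \<le> 1}"

definition Lq_norm :: "real \<Rightarrow> (real^'n \<Rightarrow> ennreal) \<Rightarrow> ennreal" where
  "Lq_norm q f = ennpowr (\<integral>\<^sup>+x. ennpowr (f x) q \<partial>lebesgue) (1 / q)"

section \<open>Tent spaces and atoms\<close>

definition RnZ :: "((real^'n) \<times> int) measure" where
  "RnZ = lebesgue \<Otimes>\<^sub>M count_space UNIV"

definition Gamma_cone :: "real^'n^'n \<Rightarrow> (real^'n) set \<Rightarrow> real^'n \<Rightarrow> ((real^'n) \<times> int) set" where
  "Gamma_cone A \<Delta> x = {(y, k). y \<in> (\<lambda>z. x + z) ` Bk A \<Delta> k}"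

definition area :: "real^'n^'n \<Rightarrow> (real^'n) set \<Rightarrow> ((real^'n) \<times> int \<Rightarrow> complex) \<Rightarrow> real^'n \<Rightarrow> ennreal" where
  "area A \<Delta> G x = ennpowr
     (\<Sum>\<^sub>\<infinity>l\<in>(UNIV::int set). ennreal (dil A powi (- l)) *
        (\<integral>\<^sup>+y\<in>{y. (y, l) \<in> Gamma_cone A \<Delta> x}. ennreal ((cmod (G (y, l)))\<^sup>2) \<partial>lebesgue))
     (1 / 2)"

definition tent_norm ::
  "real^'n^'n \<Rightarrow> (real^'n) set \<Rightarrow> (real^'n \<Rightarrow> ereal) \<Rightarrow> ((real^'n) \<times> int \<Rightarrow> complex) \<Rightarrow> ennreal" where
  "tent_norm A \<Delta> p G = Lp_var_norm p (area A \<Delta> G)"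

definition tent_space ::
  "real^'n^'n \<Rightarrow> (real^'n) set \<Rightarrow> (real^'n \<Rightarrow> ereal) \<Rightarrow> ((real^'n) \<times> int \<Rightarrow> complex) set" where
  "tent_space A \<Delta> p = {G \<in> borel_measurable RnZ. tent_norm A \<Delta> p G < \<infinity>}"

definition tent :: "real^'n^'n \<Rightarrow> (real^'n) set \<Rightarrow> (real^'n) set \<Rightarrow> ((real^'n) \<times> int) set" where
  "tent A \<Delta> B = {(y, k). (\<lambda>z. y + z) ` Bk A \<Delta> k \<subseteq> B}"

definition atom :: "real^'n^'n \<Rightarrow> (real^'n) set \<Rightarrow> (real^'n \<Rightarrow> ereal) \<Rightarrow> real \<Rightarrow> (real^'n) set \<Rightarrow>
    ((real^'n) \<times> int \<Rightarrow> complex) \<Rightarrow> bool" where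
  "atom A \<Delta> p q B a \<longleftrightarrow> a \<in> borel_measurable RnZ \<and> B \<in> dballs A \<Delta> \<and>
     {z. a z \<noteq> 0} \<subseteq> tent A \<Delta> B \<and>
     Lq_norm q (area A \<Delta> a) \<le> ennpowr (emeasure lebesgue B) (1 / q) / Lp_var_norm p (indicator B)"

definition atom_inf :: "real^'n^'n \<Rightarrow> (real^'n) set \<Rightarrow> (real^'n \<Rightarrow> ereal) \<Rightarrow> (real^'n) set \<Rightarrow>
    ((real^'n) \<times> int \<Rightarrow> complex) \<Rightarrow> bool" where
  "atom_inf A \<Delta> p B a \<longleftrightarrow> (\<forall>q>1. atom A \<Delta> p q B a)"

end

theory Submission
  imports Defs
begin

text \<open>
  Being an atom for every exponent \<open>q\<close> with constant one amounts to the pointwise bound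
  \<open>\<A>(a) \<le> 1 / \<parallel>1\<^sub>B\<parallel>\<close> (lemma \<open>bounded_area_atom\<close>).  Cutting \<open>G\<close> along the level sets of \<open>\<A>(G)\<close> alone
  gives pieces that are only Carleson measures: their square functions lie in every \<open>L\<^sup>q\<close>, but need
  not be bounded.  The decomposition therefore stops twice.

  Normalise \<open>G\<close> so that \<open>\<integral> \<A>(G)(x)\<^bsup>p(x)\<^esup> dx \<le> 1\<close> and let \<open>\<Omega>\<^sub>i = {\<A>(G) > 2\<^sup>i}\<close>.  The \<open>i\<close>-th band of
  \<open>G\<close> lives at those \<open>(y, k)\<close> for which \<open>\<Omega>\<^sub>i\<close>, but not \<open>\<Omega>\<^sub>i\<^sub>+\<^sub>1\<close>, fills more than half of \<open>y + B\<^sub>k\<close>.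
  At least half of that ball avoids \<open>\<Omega>\<^sub>i\<^sub>+\<^sub>1\<close>, and Tonelli turns this into a Carleson estimate
  (\<open>carleson_estimate\<close>).  The second stopping rule cuts the band where its square function,
  summed over the levels \<open>\<ge> k\<close> only, exceeds \<open>m L 4\<^sup>i\<^sup>+\<^sup>1\<close> somewhere on \<open>y + B\<^sub>k\<close>.  Two things follow.
  Between consecutive stopping sets the square function is bounded by \<open>(m + 1) L 4\<^sup>i\<^sup>+\<^sup>1\<close> at every
  point, because a point only sees levels above the lowest one that has not been stopped
  (\<open>areasq_stopped\<close>).  And the open sets \<open>U\<^sub>i\<^sub>,\<^sub>m\<close> that carry the \<open>m\<close>-th remainder shrink
  geometrically in \<open>m\<close>, by a John--Nirenberg argument: on a Whitney ball of \<open>U\<^sub>i\<^sub>,\<^sub>m\<close> the additional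
  area that is needed to enter \<open>U\<^sub>i\<^sub>,\<^sub>m\<^sub>+\<^sub>1\<close> comes from levels below the size of the ball, whose average
  the Carleson estimate controls (\<open>weight_stopset_decay\<close>).  The decay holds not only for volume but
  for any weight that is nearly constant on the balls that occur.

  Each remainder is distributed over the Whitney balls of \<open>U\<^sub>i\<^sub>,\<^sub>m\<close>, which overlap boundedly; this gives
  the atoms.  The coefficient of such a piece, divided by the norm of the indicator of its ball, is
  \<open>\<mu>\<^sub>i\<^sub>,\<^sub>m = 2\<^sup>i\<^sup>+\<^sup>1 ((m + 1) L)\<^bsup>1/2\<^esup>\<close>, so the function to be estimated is at most a multiple of
  \<open>(\<Sum>\<^sub>i\<^sub>,\<^sub>m \<mu>\<^sub>i\<^sub>,\<^sub>m\<^bsup>r\<^esup> 1\<^bsub>U\<^sub>i\<^sub>,\<^sub>m\<^esub>)\<^bsup>1/r\<^esup>\<close> with \<open>r = min {p\<^sub>-, 1}\<close>.  For fixed \<open>m\<close> the sum over \<open>i\<close> is geometric, hence as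
  large as its largest term, and everything reduces to the modular bound
  \<open>\<Sum>\<^sub>i \<integral>\<^bsub>U\<^sub>i\<^sub>,\<^sub>m\<^esub> 2\<^bsup>i p(x)\<^esup> dx \<le> K q\<^sup>m\<close> with \<open>q\<close> as small as desired (\<open>stop_weight_sum\<close>).  For \<open>i \<ge> 0\<close> the
  normalisation forces all balls in play to have volume at most a multiple of \<open>2\<^bsup>- i p\<^sub>-\<^esup>\<close>, and on
  these the local log-Hoelder condition makes \<open>2\<^bsup>i p(x)\<^esup>\<close> nearly constant.  For \<open>i < 0\<close> the decay
  condition compares \<open>2\<^bsup>i p(x)\<^esup>\<close> with \<open>2\<^bsup>i p\<^sub>\<infinity>\<^esup>\<close> outside a ball about the origin that is small enough to be
  treated by interpolation.  Because only level sets and modulars are compared, no maximal operator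
  on variable Lebesgue spaces enters.
\<close>

section \<open>Volumes of linear images\<close>

text \<open>
  Elementary linear maps over an arbitrary finite index type, so that volumes of matrix images
  follow by induction over elementary maps without an order on the index type.
\<close>

lemma measure_shear_image:
  fixes S :: "(real^'n) set"
  assumes mn: "m \<noteq> n" and S: "S \<in> lmeasurable"
  defines "h \<equiv> \<lambda>x::real^'n. \<chi> i. if i = m then x $ m + x $ n else x $ i"
  shows "h ` S \<in> lmeasurable \<and> measure lebesgue (h ` S) = measure lebesgue S"
proof -
  have lin: "linear h"
    unfolding h_def by (rule linearI) (auto simp: algebra_simps vec_eq_iff)
  have "measure lebesgue (h ` cbox a b) = 1 * measure lebesgue (cbox a b)" for a b
  proof (cases "cbox a b = {}")
    case False
    have cb: "cbox a b = (+) a ` cbox 0 (b - a)"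
      using cbox_translation[of a 0 "b - a"] by simp
    have "h ` cbox a b = (+) (h a) ` h ` cbox 0 (b - a)"
      unfolding cb image_image by (simp add: linear_add[OF lin])
    then have "measure lebesgue (h ` cbox a b) = measure lebesgue (h ` cbox 0 (b - a))"
      by (simp only: measure_translation)
    also have "\<dots> = measure lebesgue (cbox 0 (b - a))"
      unfolding h_def using False cb by (intro measure_shear_interval mn) auto
    also have "\<dots> = measure lebesgue (cbox a b)"
      unfolding cb by (simp only: measure_translation)
    finally show ?thesis by simp
  qed auto
  from measure_linear_sufficient[OF lin S this] show ?thesis by auto
qed

lemma measure_swap_image:
  fixes S :: "(real^'n) set" and m n :: 'n
  assumes mn: "m \<noteq> n" and S: "S \<in> lmeasurable"
  defines "h \<equiv> \<lambda>x::real^'n. \<chi> i. x $ Transposition.transpose m n i"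
  shows "h ` S \<in> lmeasurable \<and> measure lebesgue (h ` S) = measure lebesgue S"
proof -
  let ?t = "Transposition.transpose m n"
  have lin: "linear h"
    unfolding h_def by (rule linearI) (auto simp: vec_eq_iff)
  have hh: "h (h x) = x" for x by (simp add: h_def vec_eq_iff)
  have bt: "bij ?t" by simp
  have "measure lebesgue (h ` cbox a b) = 1 * measure lebesgue (cbox a b)" for a b
  proof -
    have mem: "h x \<in> cbox (h a) (h b) \<longleftrightarrow> x \<in> cbox a b" for x a b
      unfolding mem_box_cart h_def vec_lambda_beta by (metis transpose_involutory)
    have eq: "h ` cbox a b = cbox (h a) (h b)"
      using mem[of "h _" "h a" "h b"] mem hh by (auto simp: image_iff) (metis hh mem)
    have ne: "cbox (h a) (h b) = {} \<longleftrightarrow> cbox a b = {}"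
      using eq by blast
    have "(\<Prod>i\<in>UNIV. h b $ i - h a $ i) = (\<Prod>i\<in>UNIV. b $ i - a $ i)"
      unfolding h_def vec_lambda_beta
      using prod.reindex_bij_betw[OF bt, of "\<lambda>i. b $ i - a $ i"] by simp
    then show ?thesis unfolding eq using ne
      by (cases "cbox a b = {}") (auto simp: content_cbox_cart)
  qed
  from measure_linear_sufficient[OF lin S this] show ?thesis by auto
qed

lemma measure_matrix_image:
  fixes f :: "real^'n \<Rightarrow> real^'n"
  assumes "linear f" and "S \<in> lmeasurable"
  shows "f ` S \<in> lmeasurable \<and> measure lebesgue (f ` S) = \<bar>det (matrix f)\<bar> * measure lebesgue S"
proof -
  define P where "P f \<longleftrightarrow> (\<forall>S\<in>lmeasurable. f ` S \<in> lmeasurable \<and>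
     measure lebesgue (f ` S) = \<bar>det (matrix f)\<bar> * measure lebesgue S)" for f :: "real^'n \<Rightarrow> real^'n"
  have "P f"
  proof (rule induct_linear_elementary[OF \<open>linear f\<close>])
    fix f g :: "real^'n \<Rightarrow> real^'n" assume "linear f" "linear g" "P f" "P g"
    then show "P (f \<circ> g)"
      unfolding P_def image_comp[symmetric]
      by (simp add: matrix_compose det_mul abs_mult)
  next
    fix f :: "real^'n \<Rightarrow> real^'n" and i assume f: "linear f" "\<And>x. f x $ i = 0"
    then have ninj: "\<not> inj f"
      by (metis linear_injective_imp_surjective one_neq_zero surjE vec_component)
    then have "negligible (f ` S)" "det (matrix f) = 0" for S
      using negligible_linear_singular_image[OF f(1)] det_nz_iff_inj[OF f(1)] by auto
    then show "P f" unfolding P_def by (simp add: negligible_iff_measure)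
  next
    fix c :: "'n \<Rightarrow> real"
    show "P (\<lambda>x. \<chi> i. c i * x $ i)"
      unfolding P_def by (simp add: measurable_stretch measure_stretch axis_def matrix_def det_diagonal)
  next
    fix m n :: 'n assume mn: "m \<noteq> n"
    have eq: "matrix (\<lambda>x::real^'n. \<chi> i. x $ Transposition.transpose m n i)
        = (\<chi> i. (mat 1 :: real^'n^'n) $ Transposition.transpose m n i)"
      by (auto simp: matrix_def mat_def vec_eq_iff axis_def)
    have "\<bar>det (matrix (\<lambda>x::real^'n. \<chi> i. x $ Transposition.transpose m n i))\<bar> = 1"
      unfolding eq using mn by (simp add: det_permute_rows permutes_swap_id sign_swap_id)
    then show "P (\<lambda>x. \<chi> i. x $ Transposition.transpose m n i)"
      unfolding P_def using measure_swap_image[OF mn] by simp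
  next
    fix m n :: 'n assume mn: "m \<noteq> n"
    have eq: "matrix (\<lambda>x::real^'n. \<chi> i. if i = m then x $ m + x $ n else x $ i)
        = (\<chi> k. if k = m then row m (mat 1 :: real^'n^'n) + 1 *s row n (mat 1) else row k (mat 1))"
      by (auto simp: matrix_def mat_def vec_eq_iff axis_def row_def)
    have "det (matrix (\<lambda>x::real^'n. \<chi> i. if i = m then x $ m + x $ n else x $ i)) = 1"
      unfolding eq det_row_operation[OF mn] by simp
    then show "P (\<lambda>x. \<chi> i. if i = m then x $ m + x $ n else x $ i)"
      unfolding P_def using measure_shear_image[OF mn] by simp
  qed
  then show ?thesis using assms(2) by (simp add: P_def)
qed

section \<open>Dilated balls and a covering estimate\<close>

text \<open>
  What is used of the sets \<open>B\<^sub>k = A\<^sup>k \<Delta>\<close>: they form a nested family of open symmetric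
  neighbourhoods of \<open>0\<close> with volumes \<open>b\<^sup>k\<close>, and adding two of the same level costs \<open>\<tau>\<close> levels.
\<close>

locale dilated_balls =
  fixes B :: "int \<Rightarrow> (real^'n) set" and b :: real and \<tau> :: int
  assumes b_gt_1: "1 < b"
    and tau_nonneg: "0 \<le> \<tau>"
    and B_open: "open (B k)"
    and B_zero: "0 \<in> B k"
    and B_sym: "x \<in> B k \<Longrightarrow> - x \<in> B k"
    and B_mono: "k \<le> l \<Longrightarrow> B k \<subseteq> B l"
    and B_add: "x \<in> B k \<Longrightarrow> y \<in> B k \<Longrightarrow> x + y \<in> B (k + \<tau>)"
    and B_emeasure: "emeasure lebesgue (B k) = ennreal (b powi k)"
    and B_small: "open V \<Longrightarrow> 0 \<in> V \<Longrightarrow> \<exists>k. B k \<subseteq> V"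
    and B_exhaust: "\<exists>k. x \<in> B k"
begin

definition dball :: "real^'n \<Rightarrow> int \<Rightarrow> (real^'n) set" where
  "dball x k = (\<lambda>z. x + z) ` B k"

lemma mem_dball: "y \<in> dball x k \<longleftrightarrow> y - x \<in> B k"
  unfolding dball_def by (auto simp: image_iff) (metis add_diff_cancel_left' add.commute diff_add_cancel)

lemma B_minus_commute: "x - y \<in> B k \<longleftrightarrow> y - x \<in> B k"
  using B_sym[of "x - y" k] B_sym[of "y - x" k] by auto

lemma mem_dball_commute: "y \<in> dball x k \<longleftrightarrow> x \<in> dball y k"
  by (simp add: mem_dball B_minus_commute)

lemma B_triangle:
  assumes "x - y \<in> B k" "y - z \<in> B l" "k \<le> m" "l \<le> m" "m + \<tau> \<le> m'"
  shows "x - z \<in> B m'"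
proof -
  have "(x - y) + (y - z) \<in> B (m + \<tau>)"
    using assms B_mono[of k m] B_mono[of l m] by (intro B_add) auto
  then show ?thesis using B_mono[OF assms(5)] by auto
qed

lemma dball_subset_dball:
  assumes "x - y \<in> B k" "k \<le> m" "l \<le> m" "m + \<tau> \<le> m'"
  shows "dball x l \<subseteq> dball y m'"
  using B_triangle[of _ x l y k m m'] assms by (auto simp: mem_dball)

lemma dball_mono: "k \<le> l \<Longrightarrow> dball x k \<subseteq> dball x l"
  using B_mono[of k l] by (auto simp: mem_dball)

lemma centre_in_dball: "x \<in> dball x k"
  by (simp add: mem_dball B_zero)

lemma open_dball: "open (dball x k)"
  unfolding dball_def by (intro open_translation B_open)

lemma sets_dball [measurable]: "dball x k \<in> sets lebesgue"
  using open_dball borel_open by (metis sets_completionI_sets sets_lborel)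

lemma emeasure_dball: "emeasure lebesgue (dball x k) = ennreal (b powi k)"
  using emeasure_lebesgue_affine[of 1 x "B k"] by (simp add: dball_def B_emeasure add.commute)

lemma b_powi_pos [simp]: "0 < b powi k"
  using b_gt_1 by simp

lemma b_powi_nonneg [simp]: "0 \<le> b powi k"
  using b_gt_1 by simp

lemma ennreal_b_powi_ne_0: "ennreal (b powi k) \<noteq> 0"
  using b_gt_1 by simp

lemma b_powi_add: "b powi (k + l) = b powi k * b powi l"
  using b_gt_1 by (simp add: power_int_add)

lemma b_powi_mono: "k \<le> l \<Longrightarrow> b powi k \<le> b powi l"
  using b_gt_1 by (intro power_int_increasing) auto

lemma open_subset_dball: "open V \<Longrightarrow> x \<in> V \<Longrightarrow> \<exists>k. dball x k \<subseteq> V"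
  using B_small[of "(\<lambda>z. - x + z) ` V"] open_translation[of V "- x"]
  by (force simp: dball_def image_iff)

text \<open>
  Select a ball of largest scale, discard what it meets, and repeat.  A discarded ball has at
  most the scale of the ball that it meets, so two triangle inequalities put it into the ball
  enlarged by \<open>2 \<tau>\<close> levels.
\<close>

lemma finite_vitali:
  assumes "finite I"
  shows "\<exists>J\<subseteq>I. disjoint_family_on (\<lambda>(y, k). dball y k) J \<and>
           (\<Union>(y, k)\<in>I. dball y k) \<subseteq> (\<Union>(y, k)\<in>J. dball y (k + 2 * \<tau>))"
  using assms
proof (induction "card I" arbitrary: I rule: less_induct)
  case less
  show ?case
  proof (cases "I = {}")
    case True
    then show ?thesis by (simp add: disjoint_family_on_def)
  next
    case False
    define k0 where "k0 = Max (snd ` I)"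
    have "k0 \<in> snd ` I" unfolding k0_def using less.prems False by (intro Max_in) auto
    then obtain y0 where y0: "(y0, k0) \<in> I" by auto
    have k0_max: "k \<le> k0" if "(y, k) \<in> I" for y k
      unfolding k0_def using less.prems that by (intro Max_ge) force+
    define I' where "I' = {(y, k) \<in> I. dball y k \<inter> dball y0 k0 = {}}"
    have "(y0, k0) \<notin> I'" using centre_in_dball by (auto simp: I'_def)
    then have "I' \<subset> I" using y0 by (auto simp: I'_def)
    then obtain J where J: "J \<subseteq> I'" "disjoint_family_on (\<lambda>(y, k). dball y k) J"
      "(\<Union>(y, k)\<in>I'. dball y k) \<subseteq> (\<Union>(y, k)\<in>J. dball y (k + 2 * \<tau>))"
      using less.hyps[of I'] less.prems by (metis psubset_card_mono finite_subset psubset_imp_subset)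
    have sub: "dball y k \<subseteq> dball y0 (k0 + 2 * \<tau>)" if I: "(y, k) \<in> I" and nI: "(y, k) \<notin> I'" for y k
    proof -
      obtain z where z: "z \<in> dball y k" "z \<in> dball y0 k0" using I nI by (auto simp: I'_def)
      have "y - y0 \<in> B (k0 + \<tau>)"
        using z k0_max[OF I] by - (rule B_triangle[of y z k y0 k0 k0], auto simp: mem_dball B_minus_commute)
      then show ?thesis using k0_max[OF I] tau_nonneg
        by - (rule dball_subset_dball[of _ _ "k0 + \<tau>" "k0 + \<tau>"], auto)
    qed
    have "disjoint_family_on (\<lambda>(y, k). dball y k) (insert (y0, k0) J)"
    proof -
      have "dball (fst i) (snd i) \<inter> dball (fst j) (snd j) = {}"
        if "i \<in> insert (y0, k0) J" "j \<in> insert (y0, k0) J" "i \<noteq> j" for i j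
        using that J(1,2) unfolding disjoint_family_on_def I'_def case_prod_unfold by fastforce
      then show ?thesis unfolding disjoint_family_on_def case_prod_unfold by blast
    qed
    moreover have "(\<Union>(y, k)\<in>I. dball y k) \<subseteq> (\<Union>(y, k)\<in>insert (y0, k0) J. dball y (k + 2 * \<tau>))"
    proof -
      have "dball y k \<subseteq> (\<Union>(y, k)\<in>insert (y0, k0) J. dball y (k + 2 * \<tau>))" if "(y, k) \<in> I" for y k
      proof (cases "(y, k) \<in> I'")
        case True
        then have "dball y k \<subseteq> (\<Union>(y, k)\<in>I'. dball y k)" by blast
        with J(3) show ?thesis by (simp add: le_supI2)
      next
        case False
        from sub[OF that False] show ?thesis by (simp add: le_supI1)
      qed
      then show ?thesis by (auto simp: subset_eq)
    qed
    moreover have "insert (y0, k0) J \<subseteq> I" using J(1) y0 by (auto simp: I'_def)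
    ultimately show ?thesis by (intro exI[of _ "insert (y0, k0) J"]) auto
  qed
qed

text \<open>
  A local inequality between \<open>V\<close> and \<open>E\<close> on the balls of a cover becomes a global one: disjoint
  balls collect the right-hand sides without overlap, and their enlargements still cover.  It serves
  both as the weak-type bound for sets of large density and as the step from one stopping set to the
  next.
\<close>

lemma covering_estimate:
  fixes \<nu> :: "(real^'n) measure"
  assumes [measurable_cong]: "sets \<nu> = sets lebesgue"
    and V [measurable]: "V \<in> sets lebesgue" and E [measurable]: "E \<in> sets lebesgue"
    and cover: "V \<subseteq> (\<Union>(y, k)\<in>I. dball y k)"
    and dens: "\<And>y k. (y, k) \<in> I \<Longrightarrow>
                 emeasure \<nu> (V \<inter> dball y (k + 2 * \<tau>)) \<le> c * emeasure \<nu> (E \<inter> dball y k)"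
  shows "emeasure \<nu> V \<le> c * emeasure \<nu> E"
proof (cases "I = {}")
  case True
  then have "V = {}" using cover by blast
  then show ?thesis by simp
next
  case False
  have fin: "emeasure \<nu> (V \<inter> (\<Union>(y, k)\<in>F. dball y k)) \<le> c * emeasure \<nu> E"
    if F: "finite F" "F \<subseteq> I" for F
  proof -
    obtain J where J: "J \<subseteq> F" "disjoint_family_on (\<lambda>(y, k). dball y k) J"
      "(\<Union>(y, k)\<in>F. dball y k) \<subseteq> (\<Union>(y, k)\<in>J. dball y (k + 2 * \<tau>))"
      using finite_vitali[OF F(1)] by auto
    have fJ: "finite J" using J(1) F(1) finite_subset by auto
    have "emeasure \<nu> (V \<inter> (\<Union>(y, k)\<in>F. dball y k))
        \<le> emeasure \<nu> (\<Union>j\<in>J. V \<inter> dball (fst j) (snd j + 2 * \<tau>))"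
    proof (intro emeasure_mono)
      show "V \<inter> (\<Union>(y, k)\<in>F. dball y k) \<subseteq> (\<Union>j\<in>J. V \<inter> dball (fst j) (snd j + 2 * \<tau>))"
        using J(3) unfolding case_prod_unfold by blast
      show "(\<Union>j\<in>J. V \<inter> dball (fst j) (snd j + 2 * \<tau>)) \<in> sets \<nu>"
        unfolding assms(1) using fJ V by (intro sets.finite_UN sets.Int sets_dball) auto
    qed
    also have "\<dots> \<le> (\<Sum>j\<in>J. emeasure \<nu> (V \<inter> dball (fst j) (snd j + 2 * \<tau>)))"
      using fJ by (intro emeasure_subadditive_finite) auto
    also have "\<dots> \<le> (\<Sum>j\<in>J. c * emeasure \<nu> (E \<inter> dball (fst j) (snd j)))"
      using J(1) F(2) by (intro sum_mono dens) auto
    also have "\<dots> = c * emeasure \<nu> (\<Union>j\<in>J. E \<inter> dball (fst j) (snd j))"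
    proof -
      have "disjoint_family_on (\<lambda>j. E \<inter> dball (fst j) (snd j)) J"
        using J(2) unfolding disjoint_family_on_def case_prod_unfold by blast
      moreover have "(\<lambda>j. E \<inter> dball (fst j) (snd j)) ` J \<subseteq> sets \<nu>"
        unfolding assms(1) using E by auto
      ultimately show ?thesis
        unfolding sum_distrib_left[symmetric] using fJ by (simp add: sum_emeasure)
    qed
    also have "\<dots> \<le> c * emeasure \<nu> E"
      by (intro mult_left_mono emeasure_mono) auto
    finally show ?thesis .
  qed
  have "\<exists>\<F>'\<subseteq>(\<lambda>(y, k). dball y k) ` I. countable \<F>' \<and> \<Union>\<F>' = \<Union>((\<lambda>(y, k). dball y k) ` I)"
  proof -
    have "open X" if "X \<in> (\<lambda>(y, k). dball y k) ` I" for X using that open_dball by auto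
    from Lindelof[OF this] show ?thesis by metis
  qed
  then obtain \<F>' where F': "\<F>' \<subseteq> (\<lambda>(y, k). dball y k) ` I" "countable \<F>'"
    "\<Union>\<F>' = (\<Union>(y, k)\<in>I. dball y k)" by auto
  then obtain I' where I': "I' \<subseteq> I" "countable I'" "\<F>' = (\<lambda>(y, k). dball y k) ` I'"
    using countable_subset_image[of \<F>' "\<lambda>(y, k). dball y k" I] by auto
  have ne: "I' \<noteq> {}"
  proof -
    from False obtain y k where "(y, k) \<in> I" by auto
    then have "y \<in> \<Union>\<F>'" unfolding F'(3) using centre_in_dball by blast
    then show ?thesis unfolding I'(3) by blast
  qed
  define g where "g = from_nat_into I'"
  have rg: "range g = I'" unfolding g_def using range_from_nat_into[OF ne I'(2)] .
  define X where "X n = V \<inter> (\<Union>(y, k)\<in>g ` {..<n}. dball y k)" for n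
  have Xm: "range X \<subseteq> sets \<nu>"
    unfolding X_def case_prod_unfold by (auto intro!: sets.Int sets.finite_UN sets_dball simp: assms(1) V)
  have "incseq X" unfolding X_def incseq_def by (intro allI impI Int_mono UN_mono image_mono) auto
  moreover have "(\<Union>n. X n) = V"
  proof -
    have "(\<Union>n. X n) = V \<inter> (\<Union>(y, k)\<in>range g. dball y k)"
    proof -
      have "(\<Union>n. g ` {..<n}) = range g" by auto
      then have "(\<Union>j\<in>range g. dball (fst j) (snd j)) = (\<Union>n. \<Union>j\<in>g ` {..<n}. dball (fst j) (snd j))"
        by (metis UN_UN_flatten)
      then show ?thesis unfolding X_def case_prod_unfold by blast
    qed
    also have "\<dots> = V" using cover unfolding rg I'(3)[symmetric] F'(3)[symmetric] by blast
    finally show ?thesis .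
  qed
  ultimately have "emeasure \<nu> V = (SUP n. emeasure \<nu> (X n))"
    using SUP_emeasure_incseq[OF Xm] by simp
  also have "\<dots> \<le> c * emeasure \<nu> E"
    unfolding X_def using I'(1) rg by (intro SUP_least fin) auto
  finally show ?thesis .
qed

end

section \<open>Square functions and the Carleson estimate\<close>

context dilated_balls
begin

text \<open>
  The square of the area function is handled level by level; \<open>h\<close> stands for \<open>|G|\<^sup>2\<close>.
\<close>

definition area_at :: "((real^'n) \<times> int \<Rightarrow> ennreal) \<Rightarrow> int \<Rightarrow> real^'n \<Rightarrow> ennreal" where
  "area_at h l x = ennreal (b powi (- l)) * (\<integral>\<^sup>+y\<in>dball x l. h (y, l) \<partial>lebesgue)"

definition areasq :: "((real^'n) \<times> int \<Rightarrow> ennreal) \<Rightarrow> real^'n \<Rightarrow> ennreal" where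
  "areasq h x = (\<integral>\<^sup>+l. area_at h l x \<partial>count_space UNIV)"

definition areasq_above :: "((real^'n) \<times> int \<Rightarrow> ennreal) \<Rightarrow> int \<Rightarrow> real^'n \<Rightarrow> ennreal" where
  "areasq_above h k x = (\<integral>\<^sup>+l. area_at h l x * indicator {k..} l \<partial>count_space UNIV)"

text \<open>
  The part of the squared area function below level \<open>K\<close>, with the cone widened by \<open>e\<close> levels.
\<close>

definition wide_areasq :: "((real^'n) \<times> int \<Rightarrow> ennreal) \<Rightarrow> int \<Rightarrow> int \<Rightarrow> real^'n \<Rightarrow> ennreal" where
  "wide_areasq h e K v = (\<integral>\<^sup>+l. ennreal (b powi (- l)) * (\<integral>\<^sup>+z\<in>dball v (l + e). h (z, l) \<partial>lebesgue)
     * indicator {..K} l \<partial>count_space UNIV)"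

definition slices_measurable :: "((real^'n) \<times> int \<Rightarrow> ennreal) \<Rightarrow> bool" where
  "slices_measurable h \<longleftrightarrow> (\<forall>l. (\<lambda>y. h (y, l)) \<in> borel_measurable lebesgue)"

lemma sigma_finite_lebesgue: "sigma_finite_measure (lebesgue :: (real^'n) measure)"
proof
  have "\<Union>(range (\<lambda>k. dball 0 k)) = UNIV"
    using B_exhaust by (auto simp: mem_dball)
  moreover have "countable (range (\<lambda>k::int. dball 0 k))" by simp
  ultimately show "\<exists>A. countable A \<and> A \<subseteq> sets (lebesgue :: (real^'n) measure) \<and>
      \<Union>A = space lebesgue \<and> (\<forall>a\<in>A. emeasure lebesgue a \<noteq> \<infinity>)"
    by (intro exI[of _ "range (\<lambda>k. dball 0 k)"]) (auto simp: emeasure_dball)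
qed

sublocale leb: pair_sigma_finite "lebesgue :: (real^'n) measure" "lebesgue :: (real^'n) measure"
  using sigma_finite_lebesgue by (simp add: pair_sigma_finite_def)

lemma id_lebesgue_borel [measurable]: "(\<lambda>x. x) \<in> lebesgue \<rightarrow>\<^sub>M (borel :: (real^'n) measure)"
  by (intro measurableI) auto

lemma dball_indicator_measurable [measurable]:
  "(\<lambda>z. indicator (dball (fst z) k) (snd z) :: ennreal) \<in> borel_measurable (lebesgue \<Otimes>\<^sub>M lebesgue)"
proof -
  have [measurable]: "B k \<in> sets borel" using B_open by auto
  have 1: "(\<lambda>z. snd z - fst z) \<in> (lebesgue \<Otimes>\<^sub>M lebesgue) \<rightarrow>\<^sub>M (borel :: (real^'n) measure)"
    using measurable_compose[OF measurable_fst id_lebesgue_borel]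
      measurable_compose[OF measurable_snd id_lebesgue_borel] by measurable
  have "(\<lambda>z. indicator (B k) (snd z - fst z) :: ennreal) \<in> borel_measurable (lebesgue \<Otimes>\<^sub>M lebesgue)"
    using measurable_compose[OF 1, of "\<lambda>u. indicator (B k) u :: ennreal" borel] by measurable
  then show ?thesis by (simp add: indicator_def mem_dball)
qed

lemma ball_integral_measurable:
  assumes g [measurable]: "g \<in> borel_measurable (lebesgue :: (real^'n) measure)"
  shows "(\<lambda>x. \<integral>\<^sup>+y\<in>dball x k. g y \<partial>lebesgue) \<in> borel_measurable (lebesgue :: (real^'n) measure)"
proof -
  have "(\<lambda>z. g (snd z) * indicator (dball (fst z) k) (snd z)) \<in> borel_measurable (lebesgue \<Otimes>\<^sub>M lebesgue)"
    by measurable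
  then show ?thesis
    using sigma_finite_measure.borel_measurable_nn_integral[OF sigma_finite_lebesgue, of "\<lambda>x y. g y * indicator (dball x k) y" lebesgue]
    by (simp add: case_prod_unfold)
qed

lemma area_at_measurable [measurable]: "slices_measurable h \<Longrightarrow> area_at h l \<in> borel_measurable lebesgue"
  unfolding area_at_def slices_measurable_def
  by (intro borel_measurable_times_ennreal borel_measurable_const ball_integral_measurable) auto

lemma nn_integral_countable_measurable:
  fixes f :: "'i::countable \<Rightarrow> 'a \<Rightarrow> ennreal"
  assumes "\<And>l. f l \<in> borel_measurable M"
  shows "(\<lambda>x. \<integral>\<^sup>+l. f l x \<partial>count_space UNIV) \<in> borel_measurable M"
proof -
  have "(\<lambda>z. f (snd z) (fst z)) \<in> borel_measurable (M \<Otimes>\<^sub>M count_space UNIV)"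
    by (rule measurable_compose_countable'[where f="\<lambda>l z. f l (fst z)" and g=snd and I=UNIV])
      (auto intro: measurable_compose[OF measurable_fst assms])
  then show ?thesis
    by (intro sigma_finite_measure.borel_measurable_nn_integral sigma_finite_measure_count_space)
      (simp add: case_prod_unfold)
qed

lemma areasq_measurable: "slices_measurable h \<Longrightarrow> areasq h \<in> borel_measurable lebesgue"
  unfolding areasq_def[abs_def]
  by (intro nn_integral_countable_measurable area_at_measurable)

text \<open>
  Tonelli together with the symmetry of the relation \<open>y \<in> x + B\<^sub>k\<close>.
\<close>

lemma swap_ball_integral:
  fixes g :: "real^'n \<Rightarrow> ennreal"
  assumes g [measurable]: "g \<in> borel_measurable lebesgue" and E [measurable]: "E \<in> sets lebesgue"
  shows "(\<integral>\<^sup>+x\<in>E. (\<integral>\<^sup>+y\<in>dball x k. g y \<partial>lebesgue) \<partial>lebesgue)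
       = (\<integral>\<^sup>+y. g y * emeasure lebesgue (dball y k \<inter> E) \<partial>lebesgue)"
proof -
  have "(\<integral>\<^sup>+x\<in>E. (\<integral>\<^sup>+y\<in>dball x k. g y \<partial>lebesgue) \<partial>lebesgue)
      = (\<integral>\<^sup>+x. \<integral>\<^sup>+y. g y * indicator (dball x k) y * indicator E x \<partial>lebesgue \<partial>lebesgue)"
  proof (intro nn_integral_cong)
    fix x :: "real^'n"
    have [measurable]: "(\<lambda>y. g y * indicator (dball x k) y) \<in> borel_measurable lebesgue" by measurable
    show "(\<integral>\<^sup>+y\<in>dball x k. g y \<partial>lebesgue) * indicator E x
        = (\<integral>\<^sup>+y. g y * indicator (dball x k) y * indicator E x \<partial>lebesgue)"
      by (rule nn_integral_multc[symmetric]) measurable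
  qed
  also have "\<dots> = (\<integral>\<^sup>+y. \<integral>\<^sup>+x. g y * indicator (dball x k) y * indicator E x \<partial>lebesgue \<partial>lebesgue)"
    by (rule leb.Fubini'[symmetric]) (simp add: case_prod_unfold)
  also have "\<dots> = (\<integral>\<^sup>+y. g y * emeasure lebesgue (dball y k \<inter> E) \<partial>lebesgue)"
  proof (intro nn_integral_cong)
    fix y :: "real^'n"
    have "(\<integral>\<^sup>+x. g y * indicator (dball x k) y * indicator E x \<partial>lebesgue)
        = (\<integral>\<^sup>+x. g y * indicator (dball y k \<inter> E) x \<partial>lebesgue)"
      by (intro nn_integral_cong) (auto simp: indicator_def mem_dball_commute)
    also have "\<dots> = g y * emeasure lebesgue (dball y k \<inter> E)"
      by (intro nn_integral_cmult_indicator) auto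
    finally show "(\<integral>\<^sup>+x. g y * indicator (dball x k) y * indicator E x \<partial>lebesgue)
      = g y * emeasure lebesgue (dball y k \<inter> E)" .
  qed
  finally show ?thesis .
qed

lemma ennreal_b_powi_mult:
  "ennreal (b powi k) * ennreal (b powi l) = ennreal (b powi (k + l))"
  by (simp add: b_powi_add ennreal_mult' less_imp_le)

lemma area_at_le_areasq: "area_at h l x \<le> areasq h x"
proof -
  have "area_at h l x = (\<integral>\<^sup>+k. area_at h k x * indicator {l} k \<partial>count_space UNIV)"
    by (subst nn_integral_count_space_indicator[symmetric]) (auto simp: nn_integral_count_space_finite)
  also have "\<dots> \<le> areasq h x" unfolding areasq_def
    by (intro nn_integral_mono) (auto simp: indicator_def)
  finally show ?thesis .
qed

text \<open>
  A point \<open>(z, l)\<close> of the support is seen by at least half of the ball \<open>z + B\<^sub>l\<close> through \<open>E\<close>, so a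
  cone of any aperture may be replaced, on average, by the given cone with vertex in \<open>E\<close>, where the
  area function is bounded.
\<close>

lemma carleson_estimate:
  fixes h :: "(real^'n) \<times> int \<Rightarrow> ennreal"
  assumes h: "slices_measurable h" and E [measurable]: "E \<in> sets lebesgue"
    and dens: "\<And>z l. h (z, l) \<noteq> 0 \<Longrightarrow> ennreal (b powi l) \<le> 2 * emeasure lebesgue (dball z l \<inter> E)"
    and bound: "\<And>w. w \<in> E \<Longrightarrow> areasq h w \<le> t"
    and e: "0 \<le> e"
  shows "(\<integral>\<^sup>+v\<in>dball x K. wide_areasq h e K v \<partial>lebesgue)
       \<le> 2 * ennreal (b powi (2 * e + 2 * \<tau> + K)) * t"
proof -
  let ?W = "dball x (K + e + 2 * \<tau>)"
  have hm [measurable]: "(\<lambda>y. h (y, l)) \<in> borel_measurable lebesgue" for l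
    using h by (simp add: slices_measurable_def)
  have level: "(\<integral>\<^sup>+v\<in>dball x K. ennreal (b powi (- l)) * (\<integral>\<^sup>+z\<in>dball v (l + e). h (z, l) \<partial>lebesgue) \<partial>lebesgue)
      \<le> 2 * ennreal (b powi e) * (\<integral>\<^sup>+w\<in>?W \<inter> E. area_at h l w \<partial>lebesgue)" if l: "l \<le> K" for l
  proof -
    have "(\<integral>\<^sup>+v\<in>dball x K. ennreal (b powi (- l)) * (\<integral>\<^sup>+z\<in>dball v (l + e). h (z, l) \<partial>lebesgue) \<partial>lebesgue)
      = ennreal (b powi (- l)) * (\<integral>\<^sup>+v\<in>dball x K. (\<integral>\<^sup>+z\<in>dball v (l + e). h (z, l) \<partial>lebesgue) \<partial>lebesgue)"
    proof -
      have "(\<lambda>v. (\<integral>\<^sup>+z\<in>dball v (l + e). h (z, l) \<partial>lebesgue) * indicator (dball x K) v) \<in> borel_measurable lebesgue"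
        by (intro borel_measurable_times_ennreal ball_integral_measurable hm borel_measurable_indicator sets_dball)
      from nn_integral_cmult[OF this, of "ennreal (b powi (- l))"] show ?thesis
        by (simp only: mult.assoc)
    qed
    also have "\<dots> = ennreal (b powi (- l)) *
        (\<integral>\<^sup>+z. h (z, l) * emeasure lebesgue (dball z (l + e) \<inter> dball x K) \<partial>lebesgue)"
      by (subst swap_ball_integral) auto
    also have "\<dots> \<le> ennreal (b powi (- l)) *
        (\<integral>\<^sup>+z. 2 * ennreal (b powi e) * (h (z, l) * emeasure lebesgue (dball z l \<inter> (?W \<inter> E))) \<partial>lebesgue)"
    proof (intro mult_left_mono nn_integral_mono)
      fix z :: "real^'n"
      show "h (z, l) * emeasure lebesgue (dball z (l + e) \<inter> dball x K)
          \<le> 2 * ennreal (b powi e) * (h (z, l) * emeasure lebesgue (dball z l \<inter> (?W \<inter> E)))"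
      proof (cases "h (z, l) = 0 \<or> dball z (l + e) \<inter> dball x K = {}")
        case True then show ?thesis by auto
      next
        case False
        then obtain v where v: "v \<in> dball z (l + e)" "v \<in> dball x K" by auto
        have "z - x \<in> B (K + e + \<tau>)"
          using v l e by - (rule B_triangle[of z v "l + e" x K "K + e"], auto simp: mem_dball B_minus_commute)
        then have "dball z l \<subseteq> ?W"
          using l e tau_nonneg by - (rule dball_subset_dball[of _ _ "K + e + \<tau>" "K + e + \<tau>"], auto)
        then have eq: "dball z l \<inter> (?W \<inter> E) = dball z l \<inter> E" by auto
        have "emeasure lebesgue (dball z (l + e) \<inter> dball x K) \<le> emeasure lebesgue (dball z (l + e))"
          by (intro emeasure_mono) auto
        also have "\<dots> = ennreal (b powi e) * ennreal (b powi l)"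
          by (simp add: emeasure_dball ennreal_b_powi_mult add.commute)
        also have "\<dots> \<le> ennreal (b powi e) * (2 * emeasure lebesgue (dball z l \<inter> E))"
          using False by (intro mult_left_mono dens) auto
        finally have "h (z, l) * emeasure lebesgue (dball z (l + e) \<inter> dball x K)
            \<le> h (z, l) * (ennreal (b powi e) * (2 * emeasure lebesgue (dball z l \<inter> E)))"
          by (rule mult_left_mono) simp
        also have "\<dots> = 2 * ennreal (b powi e) * (h (z, l) * emeasure lebesgue (dball z l \<inter> E))"
          by (simp only: mult_ac)
        finally show ?thesis unfolding eq .
      qed
    qed auto
    also have "\<dots> = ennreal (b powi (- l)) * (2 * ennreal (b powi e) *
        (\<integral>\<^sup>+w\<in>?W \<inter> E. (\<integral>\<^sup>+z\<in>dball w l. h (z, l) \<partial>lebesgue) \<partial>lebesgue))"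
    proof -
      have "(\<lambda>z. emeasure lebesgue (dball z l \<inter> (?W \<inter> E)))
          = (\<lambda>z. \<integral>\<^sup>+y\<in>dball z l. indicator (?W \<inter> E) y \<partial>lebesgue)"
      proof
        fix z
        have "(\<integral>\<^sup>+y\<in>dball z l. indicator (?W \<inter> E) y \<partial>lebesgue)
          = (\<integral>\<^sup>+y. indicator (dball z l \<inter> (?W \<inter> E)) y \<partial>lebesgue)"
          by (intro nn_integral_cong) (auto simp: indicator_def)
        then show "emeasure lebesgue (dball z l \<inter> (?W \<inter> E)) = (\<integral>\<^sup>+y\<in>dball z l. indicator (?W \<inter> E) y \<partial>lebesgue)"
          by (simp add: nn_integral_indicator)
      qed
      then have "(\<lambda>z. emeasure lebesgue (dball z l \<inter> (?W \<inter> E))) \<in> borel_measurable lebesgue"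
        using ball_integral_measurable[of "indicator (?W \<inter> E)" l] by simp
      then have m: "(\<lambda>z. h (z, l) * emeasure lebesgue (dball z l \<inter> (?W \<inter> E))) \<in> borel_measurable lebesgue"
        by (intro borel_measurable_times_ennreal hm)
      have WE: "?W \<inter> E \<in> sets lebesgue" by auto
      show ?thesis
        by (simp only: nn_integral_cmult[OF m] swap_ball_integral[OF hm WE])
    qed
    also have "\<dots> = 2 * ennreal (b powi e) * (\<integral>\<^sup>+w\<in>?W \<inter> E. area_at h l w \<partial>lebesgue)"
    proof -
      have "(\<integral>\<^sup>+w\<in>?W \<inter> E. area_at h l w \<partial>lebesgue) = ennreal (b powi (- l)) *
        (\<integral>\<^sup>+w\<in>?W \<inter> E. (\<integral>\<^sup>+z\<in>dball w l. h (z, l) \<partial>lebesgue) \<partial>lebesgue)"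
      proof -
        have "(\<lambda>w. (\<integral>\<^sup>+z\<in>dball w l. h (z, l) \<partial>lebesgue) * indicator (?W \<inter> E) w) \<in> borel_measurable lebesgue"
          by (intro borel_measurable_times_ennreal ball_integral_measurable hm borel_measurable_indicator
              sets.Int sets_dball E)
        from nn_integral_cmult[OF this, of "ennreal (b powi (- l))"] show ?thesis
          unfolding area_at_def by (simp only: mult.assoc)
      qed
      then show ?thesis by (simp add: mult_ac)
    qed
    finally show ?thesis .
  qed
  have "(\<integral>\<^sup>+v\<in>dball x K. (\<integral>\<^sup>+l. ennreal (b powi (- l)) * (\<integral>\<^sup>+z\<in>dball v (l + e). h (z, l) \<partial>lebesgue)
            * indicator {..K} l \<partial>count_space UNIV) \<partial>lebesgue)
      = (\<integral>\<^sup>+v. (\<integral>\<^sup>+l. ennreal (b powi (- l)) * (\<integral>\<^sup>+z\<in>dball v (l + e). h (z, l) \<partial>lebesgue)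
            * indicator {..K} l * indicator (dball x K) v \<partial>count_space UNIV) \<partial>lebesgue)"
    by (intro nn_integral_cong nn_integral_multc[symmetric]) auto
  also have "\<dots> = (\<integral>\<^sup>+l. (\<integral>\<^sup>+v. ennreal (b powi (- l)) * (\<integral>\<^sup>+z\<in>dball v (l + e). h (z, l) \<partial>lebesgue)
            * indicator {..K} l * indicator (dball x K) v \<partial>lebesgue) \<partial>count_space UNIV)"
    using ball_integral_measurable[OF hm]
    by (intro nn_integral_count_space_nn_integral) auto
  also have "\<dots> \<le> (\<integral>\<^sup>+l. 2 * ennreal (b powi e) * (\<integral>\<^sup>+w\<in>?W \<inter> E. area_at h l w \<partial>lebesgue) \<partial>count_space UNIV)"
  proof (intro nn_integral_mono)
    fix l :: int
    show "(\<integral>\<^sup>+v. ennreal (b powi (- l)) * (\<integral>\<^sup>+z\<in>dball v (l + e). h (z, l) \<partial>lebesgue)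
            * indicator {..K} l * indicator (dball x K) v \<partial>lebesgue)
        \<le> 2 * ennreal (b powi e) * (\<integral>\<^sup>+w\<in>?W \<inter> E. area_at h l w \<partial>lebesgue)"
      using level[of l] by (cases "l \<le> K") auto
  qed
  also have "\<dots> = 2 * ennreal (b powi e) * (\<integral>\<^sup>+l. (\<integral>\<^sup>+w\<in>?W \<inter> E. area_at h l w \<partial>lebesgue) \<partial>count_space UNIV)"
    by (intro nn_integral_cmult) auto
  also have "(\<integral>\<^sup>+l. (\<integral>\<^sup>+w\<in>?W \<inter> E. area_at h l w \<partial>lebesgue) \<partial>count_space UNIV)
      = (\<integral>\<^sup>+w. (\<integral>\<^sup>+l. area_at h l w * indicator (?W \<inter> E) w \<partial>count_space UNIV) \<partial>lebesgue)"
    using h by (intro nn_integral_count_space_nn_integral[symmetric]) auto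
  also have "\<dots> = (\<integral>\<^sup>+w\<in>?W \<inter> E. areasq h w \<partial>lebesgue)"
    unfolding areasq_def by (intro nn_integral_cong nn_integral_multc) auto
  also have "\<dots> \<le> (\<integral>\<^sup>+w. t * indicator ?W w \<partial>lebesgue)"
    using bound by (intro nn_integral_mono) (auto simp: indicator_def)
  also have "\<dots> = t * ennreal (b powi (K + e + 2 * \<tau>))"
    by (simp add: nn_integral_cmult_indicator emeasure_dball)
  also have "2 * ennreal (b powi e) * (t * ennreal (b powi (K + e + 2 * \<tau>)))
      = 2 * (ennreal (b powi e) * ennreal (b powi (K + e + 2 * \<tau>))) * t"
    by (simp add: mult_ac)
  also have "ennreal (b powi e) * ennreal (b powi (K + e + 2 * \<tau>)) = ennreal (b powi (2 * e + 2 * \<tau> + K))"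
    unfolding ennreal_b_powi_mult by (simp add: algebra_simps)
  finally show ?thesis unfolding wide_areasq_def by (simp add: mult_left_mono)
qed

end

section \<open>Stopping sets\<close>

context dilated_balls
begin

lemma areasq_above_split:
  assumes "k \<le> k'"
  shows "areasq_above h k x = (\<integral>\<^sup>+l. area_at h l x * indicator {k..<k'} l \<partial>count_space UNIV) + areasq_above h k' x"
  unfolding areasq_above_def
  by (subst nn_integral_add[symmetric]) (use assms in \<open>auto intro!: nn_integral_cong simp: indicator_def\<close>)

lemma area_at_mono: "(\<And>z. h z \<le> h' z) \<Longrightarrow> area_at h l x \<le> area_at h' l x"
  unfolding area_at_def by (intro mult_left_mono nn_integral_mono mult_right_mono) auto

lemma area_at_eq_0: "(\<And>y. y \<in> dball x l \<Longrightarrow> h (y, l) = 0) \<Longrightarrow> area_at h l x = 0"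
proof -
  assume *: "\<And>y. y \<in> dball x l \<Longrightarrow> h (y, l) = 0"
  have "(\<integral>\<^sup>+y\<in>dball x l. h (y, l) \<partial>lebesgue) = (\<integral>\<^sup>+y. 0 \<partial>(lebesgue :: (real^'n) measure))"
    using * by (intro nn_integral_cong) (auto simp: indicator_def)
  then show ?thesis by (simp add: area_at_def)
qed

text \<open>
  There is a lowest level above \<open>k\<close> at which \<open>h\<close> is visible from \<open>x\<close>; the levels between \<open>k\<close>
  and this one contribute nothing.
\<close>

lemma areasq_above_lowest:
  assumes "areasq_above h k x \<noteq> 0"
  shows "\<exists>l\<ge>k. \<exists>y\<in>dball x l. h (y, l) \<noteq> 0 \<and> areasq_above h l x = areasq_above h k x"
proof -
  define X where "X n \<longleftrightarrow> (\<exists>y\<in>dball x (k + int n). h (y, k + int n) \<noteq> 0)" for n :: nat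
  have "\<exists>n. X n"
  proof (rule ccontr)
    assume "\<not> ?thesis"
    then have no: "h (y, l) = 0" if "l \<ge> k" "y \<in> dball x l" for l y
      using that unfolding X_def by (metis add_diff_cancel_left' diff_ge_0_iff_ge int_nat_eq diff_add_cancel add.commute)
    have "areasq_above h k x = (\<integral>\<^sup>+l. 0 \<partial>count_space (UNIV :: int set))"
      unfolding areasq_above_def
      using area_at_eq_0[of x _ h] no by (intro nn_integral_cong) (auto simp: indicator_def)
    with assms show False by simp
  qed
  then obtain n where n: "X n" "\<And>j. j < n \<Longrightarrow> \<not> X j" using exists_least_iff[of X] by auto
  have zero: "area_at h l x = 0" if "l \<in> {k..<k + int n}" for l
  proof (rule area_at_eq_0)
    fix y assume "y \<in> dball x l"
    then show "h (y, l) = 0"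
      using n(2)[of "nat (l - k)"] that by (auto simp: X_def)
  qed
  have "(\<integral>\<^sup>+l. area_at h l x * indicator {k..<k + int n} l \<partial>count_space UNIV)
      = (\<integral>\<^sup>+l. 0 \<partial>count_space (UNIV :: int set))"
    using zero by (intro nn_integral_cong) (auto simp: indicator_def)
  then have "areasq_above h (k + int n) x = areasq_above h k x"
    using areasq_above_split[of k "k + int n" h x] by simp
  then show ?thesis using n(1) by (intro exI[of _ "k + int n"]) (auto simp: X_def)
qed

lemma areasq_eq_SUP: "areasq h x = (SUP n. areasq_above h (- int n) x)"
proof -
  have "areasq h x = (\<integral>\<^sup>+l. (SUP n. area_at h l x * indicator {- int n..} l) \<partial>count_space UNIV)"
    unfolding areasq_def
  proof (intro nn_integral_cong antisym)
    fix l :: int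
    have "area_at h l x = area_at h l x * indicator {- int (nat (- l))..} l" by (auto simp: indicator_def)
    also have "\<dots> \<le> (SUP n. area_at h l x * indicator {- int n..} l)" by (rule SUP_upper) simp
    finally show "area_at h l x \<le> (SUP n. area_at h l x * indicator {- int n..} l)" .
    show "(SUP n. area_at h l x * indicator {- int n..} l) \<le> area_at h l x"
      by (intro SUP_least) (auto simp: indicator_def)
  qed
  also have "\<dots> = (SUP n. areasq_above h (- int n) x)"
    unfolding areasq_above_def
    by (intro nn_integral_monotone_convergence_SUP) (auto simp: incseq_def le_fun_def indicator_def)
  finally show ?thesis .
qed

definition dense_in :: "(real^'n) set \<Rightarrow> ((real^'n) \<times> int) set" where
  "dense_in \<Omega> = {(y, k). ennreal (b powi k) < 2 * emeasure lebesgue (dball y k \<inter> \<Omega>)}"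

text \<open>
  The condition \<open>(y, k) \<in> dense_in \<Omega>\<close> is kept for every \<open>m\<close>, so that all stopping sets lie in the first
  one, whose size is controlled by \<open>\<Omega>\<close>.
\<close>

definition stop :: "(real^'n) set \<Rightarrow> ((real^'n) \<times> int \<Rightarrow> ennreal) \<Rightarrow> real \<Rightarrow> nat \<Rightarrow> ((real^'n) \<times> int) set" where
  "stop \<Omega> h c m = {(y, k) \<in> dense_in \<Omega>. m = 0 \<or> (\<exists>x\<in>dball y k. ennreal (real m * c) < areasq_above h k x)}"

text \<open>
  The enlargement by \<open>3 \<tau>\<close> levels leaves room for Whitney balls: a ball \<open>y + B\<^sub>k\<close> with
  \<open>(y, k)\<close> in the stopping region is at most as large as the Whitney ball at \<open>y\<close>.
\<close>

definition stopset :: "(real^'n) set \<Rightarrow> ((real^'n) \<times> int \<Rightarrow> ennreal) \<Rightarrow> real \<Rightarrow> nat \<Rightarrow> (real^'n) set" where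
  "stopset \<Omega> h c m = (\<Union>(y, k)\<in>stop \<Omega> h c m. dball y (k + 3 * \<tau>))"

lemma open_stopset: "open (stopset \<Omega> h c m)"
  unfolding stopset_def using open_dball by (intro open_UN) auto

lemma sets_stopset [measurable]: "stopset \<Omega> h c m \<in> sets lebesgue"
  using open_stopset borel_open by (metis sets_completionI_sets sets_lborel)

lemma stop_antimono:
  assumes "0 \<le> c" "m \<le> m'"
  shows "stop \<Omega> h c m' \<subseteq> stop \<Omega> h c m"
proof -
  have "ennreal (real m * c) \<le> ennreal (real m' * c)"
    using assms by (intro ennreal_leI mult_right_mono) auto
  then have "ennreal (real m * c) < a" if "ennreal (real m' * c) < a" for a
    using that by (rule le_less_trans)
  then show ?thesis using assms(2) unfolding stop_def by auto
qed

lemma stopset_antimono: "0 \<le> c \<Longrightarrow> m \<le> m' \<Longrightarrow> stopset \<Omega> h c m' \<subseteq> stopset \<Omega> h c m"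
  unfolding stopset_def using stop_antimono by blast

text \<open>
  From \<open>x\<close>, every visible level \<open>l\<close> carries a point \<open>(y, l)\<close> that has not been stopped, and \<open>x\<close>
  lies in its ball; hence the area above the lowest visible level is at most the threshold.
\<close>

lemma areasq_stopped:
  assumes le: "\<And>z. h' z \<le> h z"
    and supp: "\<And>y l. h' (y, l) \<noteq> 0 \<Longrightarrow> (y, l) \<in> dense_in \<Omega> \<and> (y, l) \<notin> stop \<Omega> h c (Suc m)"
  shows "areasq h' x \<le> ennreal (real (Suc m) * c)"
  unfolding areasq_eq_SUP
proof (intro SUP_least)
  fix n
  show "areasq_above h' (- int n) x \<le> ennreal (real (Suc m) * c)"
  proof (cases "areasq_above h' (- int n) x = 0")
    case False
    then obtain l y where l: "y \<in> dball x l" "h' (y, l) \<noteq> 0" "areasq_above h' l x = areasq_above h' (- int n) x"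
      using areasq_above_lowest by blast
    have "areasq_above h' l x \<le> areasq_above h l x"
      unfolding areasq_above_def using area_at_mono[of h' h] le
      by (intro nn_integral_mono mult_right_mono) auto
    also have "\<dots> \<le> ennreal (real (Suc m) * c)"
      using supp[OF l(2)] l(1) mem_dball_commute[of y x l] unfolding stop_def by (auto simp: not_less)
    finally show ?thesis using l(3) by simp
  qed simp
qed

lemma whitney_scale:
  assumes fin: "emeasure lebesgue U < \<infinity>" and [measurable]: "U \<in> sets lebesgue" and l: "dball x (l + 3 * \<tau>) \<subseteq> U"
  shows "\<exists>\<kappa>\<ge>l. dball x (\<kappa> + 3 * \<tau>) \<subseteq> U \<and> \<not> dball x (\<kappa> + 1 + 3 * \<tau>) \<subseteq> U"
proof -
  have "\<exists>n. \<not> dball x (l + int n + 3 * \<tau>) \<subseteq> U"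
  proof (rule ccontr)
    assume "\<not> ?thesis"
    then have sub: "dball x (l + int n + 3 * \<tau>) \<subseteq> U" for n by auto
    obtain r where r: "emeasure lebesgue U = ennreal r" "0 \<le> r"
      using fin by (cases "emeasure lebesgue U") auto
    obtain n where n: "r / b powi (l + 3 * \<tau>) < b ^ n"
      using real_arch_pow[OF b_gt_1] by auto
    have "ennreal (b powi (l + int n + 3 * \<tau>)) \<le> ennreal r"
      using emeasure_mono[OF sub[of n], of lebesgue] r by (simp only: emeasure_dball) simp
    then have "b powi (l + 3 * \<tau> + int n) \<le> r"
      using r by (simp add: algebra_simps)
    with n show False
      by (simp add: b_powi_add[of _ "int n"] pos_divide_less_eq mult.commute)
  qed
  then obtain n where n: "\<not> dball x (l + int n + 3 * \<tau>) \<subseteq> U" "\<And>j. j < n \<Longrightarrow> dball x (l + int j + 3 * \<tau>) \<subseteq> U"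
    using exists_least_iff[of "\<lambda>n. \<not> dball x (l + int n + 3 * \<tau>) \<subseteq> U"] by auto
  have "n \<noteq> 0" using n(1) l by (intro notI) simp
  then have "dball x (l + int (n - 1) + 3 * \<tau>) \<subseteq> U" "l + int (n - 1) + 1 = l + int n"
    using n(2)[of "n - 1"] by auto
  with n(1) show ?thesis by (intro exI[of _ "l + int (n - 1)"]) auto
qed

lemma whitney_scale_ex:
  assumes fin: "emeasure lebesgue U < \<infinity>" and U: "open U" "x \<in> U"
  shows "\<exists>\<kappa>. dball x (\<kappa> + 3 * \<tau>) \<subseteq> U \<and> \<not> dball x (\<kappa> + 1 + 3 * \<tau>) \<subseteq> U"
proof -
  obtain k where "dball x k \<subseteq> U" using open_subset_dball[OF U] by auto
  then have "dball x ((k - 3 * \<tau>) + 3 * \<tau>) \<subseteq> U" by simp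
  moreover have "U \<in> sets lebesgue" using U by (metis borel_open sets_completionI_sets sets_lborel)
  ultimately show ?thesis using whitney_scale[OF fin] by metis
qed

text \<open>
  A comparison of volumes carries over to a weight that varies by a bounded factor between the
  two sets: integrate \<open>w v \<le> Cw w u\<close> over \<open>V \<times> F\<close>.
\<close>

lemma weighted_compare:
  fixes w :: "real^'n \<Rightarrow> ennreal"
  assumes w [measurable]: "w \<in> borel_measurable lebesgue"
    and V [measurable]: "V \<in> sets lebesgue" and F [measurable]: "F \<in> sets lebesgue"
    and le: "emeasure lebesgue V \<le> a * emeasure lebesgue F"
    and F0: "emeasure lebesgue F \<noteq> 0" "emeasure lebesgue F \<noteq> \<infinity>"
    and comp: "\<And>u v. v \<in> V \<Longrightarrow> u \<in> F \<Longrightarrow> w v \<le> Cw * w u"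
  shows "emeasure (density lebesgue w) V \<le> a * Cw * emeasure (density lebesgue w) F"
proof -
  have dF: "emeasure (density lebesgue w) F = (\<integral>\<^sup>+u\<in>F. w u \<partial>lebesgue)"
    and dV: "emeasure (density lebesgue w) V = (\<integral>\<^sup>+u\<in>V. w u \<partial>lebesgue)"
    by (simp_all add: emeasure_density)
  have 1: "w v * emeasure lebesgue F \<le> Cw * (\<integral>\<^sup>+u\<in>F. w u \<partial>lebesgue)" if v: "v \<in> V" for v
  proof -
    have "w v * emeasure lebesgue F = (\<integral>\<^sup>+u. w v * indicator F u \<partial>lebesgue)"
      by (rule nn_integral_cmult_indicator[symmetric]) simp
    also have "\<dots> \<le> (\<integral>\<^sup>+u. Cw * (w u * indicator F u) \<partial>lebesgue)"
      using comp[OF v] by (intro nn_integral_mono) (auto simp: indicator_def)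
    also have "\<dots> = Cw * (\<integral>\<^sup>+u\<in>F. w u \<partial>lebesgue)"
      by (rule nn_integral_cmult) simp
    finally show ?thesis .
  qed
  have "emeasure (density lebesgue w) V * emeasure lebesgue F
      = (\<integral>\<^sup>+v. w v * indicator V v * emeasure lebesgue F \<partial>lebesgue)"
    unfolding dV by (rule nn_integral_multc[symmetric]) simp
  also have "\<dots> \<le> (\<integral>\<^sup>+v. Cw * (\<integral>\<^sup>+u\<in>F. w u \<partial>lebesgue) * indicator V v \<partial>lebesgue)"
    using 1 by (intro nn_integral_mono) (auto simp: indicator_def)
  also have "\<dots> = Cw * (\<integral>\<^sup>+u\<in>F. w u \<partial>lebesgue) * emeasure lebesgue V"
    by (rule nn_integral_cmult_indicator) simp
  also have "\<dots> \<le> Cw * (\<integral>\<^sup>+u\<in>F. w u \<partial>lebesgue) * (a * emeasure lebesgue F)"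
    by (intro mult_left_mono le) simp
  also have "\<dots> = (a * Cw * emeasure (density lebesgue w) F) * emeasure lebesgue F"
    unfolding dF by (simp only: mult_ac)
  finally show ?thesis
    using F0 by (simp add: ennreal_mult_le_mult_iff mult.commute[of _ "emeasure lebesgue F"] del: emeasure_completion)
qed

end

text \<open>
  One band of the function: \<open>h\<close> lives where \<open>\<Omega>\<close> is dense and \<open>E\<close>, the set on which the area function
  is at most \<open>t\<close>, still fills half of each ball.
\<close>

locale level_data = dilated_balls B b \<tau>
  for B :: "int \<Rightarrow> (real^'n) set" and b :: real and \<tau> :: int +
  fixes \<Omega> E :: "(real^'n) set" and h :: "(real^'n) \<times> int \<Rightarrow> ennreal" and t L :: real
  assumes sets_Omega [measurable]: "\<Omega> \<in> sets lebesgue" and fin_Omega: "emeasure lebesgue \<Omega> < \<infinity>"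
    and sets_E [measurable]: "E \<in> sets lebesgue" and h_slices: "slices_measurable h"
    and dens_E: "\<And>z l. h (z, l) \<noteq> 0 \<Longrightarrow> ennreal (b powi l) \<le> 2 * emeasure lebesgue (dball z l \<inter> E)"
    and dens_Omega: "\<And>z l. h (z, l) \<noteq> 0 \<Longrightarrow> (z, l) \<in> dense_in \<Omega>"
    and area_E: "\<And>w. w \<in> E \<Longrightarrow> areasq h w \<le> ennreal t"
    and t_pos: "0 < t"
    and L_large: "real_of_int (6 * \<tau> + 1) * (2 * b powi (4 * \<tau>)) \<le> L"
begin

lemma L_pos: "0 < L"
proof -
  have "0 < real_of_int (6 * \<tau> + 1) * (2 * b powi (4 * \<tau>))"
    using tau_nonneg by (intro mult_pos_pos) auto
  then show ?thesis using L_large by linarith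
qed

abbreviation "S m \<equiv> stop \<Omega> h (L * t) m"
abbreviation "U m \<equiv> stopset \<Omega> h (L * t) m"

text \<open>
  A single level cannot contribute more than a multiple of \<open>t\<close>, since its contribution at one
  point is seen, in a slightly wider cone, from a whole ball of the same scale.
\<close>

lemma area_at_bound: "area_at h l u \<le> ennreal (2 * b powi (4 * \<tau>) * t)"
proof -
  have "area_at h l u * ennreal (b powi l) = (\<integral>\<^sup>+v. area_at h l u * indicator (dball u l) v \<partial>lebesgue)"
    by (simp add: nn_integral_cmult_indicator emeasure_dball del: emeasure_completion)
  also have "\<dots> \<le> (\<integral>\<^sup>+v\<in>dball u l. wide_areasq h \<tau> l v \<partial>lebesgue)"
  proof (intro nn_integral_mono)
    fix v
    show "area_at h l u * indicator (dball u l) v \<le> wide_areasq h \<tau> l v * indicator (dball u l) v"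
    proof (cases "v \<in> dball u l")
      case True
      then have "dball u l \<subseteq> dball v (l + \<tau>)"
        by - (rule dball_subset_dball[of u v l l], auto simp: mem_dball B_minus_commute)
      then have "area_at h l u \<le> ennreal (b powi (- l)) * (\<integral>\<^sup>+z\<in>dball v (l + \<tau>). h (z, l) \<partial>lebesgue)"
        unfolding area_at_def by (intro mult_left_mono nn_integral_mono) (auto simp: indicator_def)
      also have "\<dots> = (\<integral>\<^sup>+k. ennreal (b powi (- k)) * (\<integral>\<^sup>+z\<in>dball v (k + \<tau>). h (z, k) \<partial>lebesgue)
            * indicator {l} k \<partial>count_space UNIV)"
        by (subst nn_integral_count_space_indicator[symmetric]) (auto simp: nn_integral_count_space_finite)
      also have "\<dots> \<le> wide_areasq h \<tau> l v"
        unfolding wide_areasq_def by (intro nn_integral_mono) (auto simp: indicator_def)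
      finally show ?thesis using True by simp
    qed simp
  qed
  also have "\<dots> \<le> 2 * ennreal (b powi (2 * \<tau> + 2 * \<tau> + l)) * ennreal t"
    by (rule carleson_estimate[OF h_slices sets_E dens_E area_E tau_nonneg])
  also have "\<dots> = ennreal (2 * b powi (4 * \<tau>) * t) * ennreal (b powi l)"
    using t_pos by (simp add: b_powi_add[of _ l] ennreal_mult' less_imp_le mult_ac)
  finally have "ennreal (b powi l) * area_at h l u \<le> ennreal (b powi l) * ennreal (2 * b powi (4 * \<tau>) * t)"
    by (simp only: mult.commute[of _ "ennreal (b powi l)"])
  then show ?thesis
    using ennreal_mult_le_mult_iff[OF ennreal_b_powi_ne_0 ennreal_neq_top] by blast
qed

text \<open>
  A large area above level \<open>k\<close> at \<open>u\<close> is also the area above the lowest visible level \<open>l \<ge> k\<close>,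
  and the point that makes this level visible has been stopped.
\<close>

lemma climb:
  assumes "ennreal (real m * (L * t)) < areasq_above h k u"
  shows "dball u (k + 2 * \<tau>) \<subseteq> U m"
proof -
  have "areasq_above h k u \<noteq> 0" using assms by auto
  then obtain l y where l: "k \<le> l" "y \<in> dball u l" "h (y, l) \<noteq> 0" "areasq_above h l u = areasq_above h k u"
    using areasq_above_lowest by blast
  have uy: "u \<in> dball y l" using l(2) mem_dball_commute by blast
  then have "(y, l) \<in> S m"
    using dens_Omega[OF l(3)] assms unfolding l(4)[symmetric] stop_def by blast
  then have "dball y (l + 3 * \<tau>) \<subseteq> U m" unfolding stopset_def by blast
  moreover have "dball u (k + 2 * \<tau>) \<subseteq> dball y (l + 3 * \<tau>)"
    using l(1) uy tau_nonneg by - (rule dball_subset_dball[of _ _ l "l + 2 * \<tau>"], auto simp: mem_dball)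
  ultimately show ?thesis by auto
qed

text \<open>
  Increasing the threshold by one step pays for the \<open>6 \<tau> + 1\<close> lowest levels; this is what
  \<open>L_large\<close> is for.
\<close>

lemma drop_levels:
  assumes "ennreal (real (Suc m) * (L * t)) < areasq_above h k u"
  shows "ennreal (real m * (L * t)) < areasq_above h (k + (6 * \<tau> + 1)) u"
proof (rule ccontr)
  assume "\<not> ?thesis"
  then have le: "areasq_above h (k + (6 * \<tau> + 1)) u \<le> ennreal (real m * (L * t))" by simp
  have "(\<integral>\<^sup>+l. area_at h l u * indicator {k..<k + (6 * \<tau> + 1)} l \<partial>count_space UNIV)
      \<le> (\<integral>\<^sup>+l. ennreal (2 * b powi (4 * \<tau>) * t) * indicator {k..<k + (6 * \<tau> + 1)} l \<partial>count_space UNIV)"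
    by (intro nn_integral_mono mult_right_mono area_at_bound) simp
  also have "\<dots> = ennreal (2 * b powi (4 * \<tau>) * t) * emeasure (count_space UNIV) {k..<k + (6 * \<tau> + 1)}"
    by (rule nn_integral_cmult_indicator) simp
  also have "emeasure (count_space UNIV) {k..<k + (6 * \<tau> + 1)} = ennreal (real_of_int (6 * \<tau> + 1))"
    using tau_nonneg by (simp add: emeasure_count_space_finite ennreal_of_nat_eq_real_of_nat)
  also have "ennreal (2 * b powi (4 * \<tau>) * t) * ennreal (real_of_int (6 * \<tau> + 1))
      = ennreal (real_of_int (6 * \<tau> + 1) * (2 * b powi (4 * \<tau>)) * t)"
    using tau_nonneg by (subst ennreal_mult''[symmetric]) (simp_all add: mult_ac)
  also have "\<dots> \<le> ennreal (L * t)"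
    using L_large t_pos by (intro ennreal_leI mult_right_mono) auto
  finally have "areasq_above h k u \<le> ennreal (L * t) + ennreal (real m * (L * t))"
    using areasq_above_split[of k "k + (6 * \<tau> + 1)" h u] le tau_nonneg by (simp add: add_mono)
  also have "\<dots> = ennreal (real (Suc m) * (L * t))"
    using L_pos t_pos by (subst ennreal_plus[symmetric]) (auto simp: algebra_simps)
  finally show False using assms by simp
qed

text \<open>
  Let \<open>v\<close> be stopped at step \<open>m + 1\<close> because of a point \<open>u\<close> near \<open>v\<close>.  By \<open>climb\<close>, applied
  after dropping levels, the scale at which this happens is below the Whitney scale \<open>\<kappa>\<close> of \<open>x\<close>, for
  otherwise \<open>U m\<close> would contain too large a ball around \<open>x\<close>.  For the same reason the area above \<open>\<kappa>\<close>
  at \<open>u\<close> does not exceed the threshold of step \<open>m\<close>.  So one full step \<open>L t\<close> of area comes from the levels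
  in between, and all of it is visible from \<open>v\<close> in a wider cone.
\<close>

lemma wide_area_large:
  assumes x: "\<not> dball x (\<kappa> + 1 + 3 * \<tau>) \<subseteq> U m"
    and v: "v \<in> U (Suc m)" "v \<in> dball x (\<kappa> + 2 * \<tau>)"
  shows "ennreal (L * t) \<le> wide_areasq h (5 * \<tau>) (\<kappa> + 2 * \<tau>) v"
proof -
  obtain y k u where y: "v \<in> dball y (k + 3 * \<tau>)" "u \<in> dball y k"
      "ennreal (real (Suc m) * (L * t)) < areasq_above h k u"
    using v(1) unfolding stopset_def stop_def by auto
  have uv: "u - v \<in> B (k + 4 * \<tau>)"
    using y tau_nonneg by - (rule B_triangle[of u y k v "k + 3 * \<tau>" "k + 3 * \<tau>"], auto simp: mem_dball B_minus_commute)
  have vx: "x - v \<in> B (\<kappa> + 2 * \<tau>)" using v(2) by (simp add: mem_dball B_minus_commute)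
  have "dball u (k + (6 * \<tau> + 1) + 2 * \<tau>) \<subseteq> U m"
    by (rule climb[OF drop_levels[OF y(3)]])
  moreover have "dball v (k + 7 * \<tau> + 1) \<subseteq> dball u (k + (6 * \<tau> + 1) + 2 * \<tau>)"
    using uv tau_nonneg by - (rule dball_subset_dball[of _ _ "k + 4 * \<tau>" "k + 7 * \<tau> + 1"], auto simp: B_minus_commute)
  ultimately have vU: "dball v (k + 7 * \<tau> + 1) \<subseteq> U m" by auto
  \<comment> \<open>the scale of the stopped ball is below the Whitney scale of \<open>x\<close>\<close>
  have k_small: "k + 3 * \<tau> < \<kappa>"
  proof (rule ccontr)
    assume "\<not> ?thesis"
    then have "dball x (\<kappa> + 1 + 3 * \<tau>) \<subseteq> dball v (k + 7 * \<tau> + 1)"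
      using vx tau_nonneg by - (rule dball_subset_dball[of _ _ "\<kappa> + 2 * \<tau>" "\<kappa> + 1 + 3 * \<tau>"], auto)
    with vU x show False by auto
  qed
  have xu: "x - u \<in> B (\<kappa> + 3 * \<tau>)"
  proof (rule B_triangle[OF vx])
    show "v - u \<in> B (k + 4 * \<tau>)" using uv by (simp only: B_minus_commute)
  qed (use k_small tau_nonneg in auto)
  have "areasq_above h (\<kappa> + 2 * \<tau> + 1) u \<le> ennreal (real m * (L * t))"
  proof (rule ccontr)
    assume "\<not> ?thesis"
    then have "ennreal (real m * (L * t)) < areasq_above h (\<kappa> + 2 * \<tau> + 1) u" by (simp only: not_le)
    then have "dball u (\<kappa> + 2 * \<tau> + 1 + 2 * \<tau>) \<subseteq> U m" by (rule climb)
    moreover have "dball x (\<kappa> + 1 + 3 * \<tau>) \<subseteq> dball u (\<kappa> + 2 * \<tau> + 1 + 2 * \<tau>)"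
      using xu tau_nonneg by - (rule dball_subset_dball[of _ _ "\<kappa> + 3 * \<tau>" "\<kappa> + 1 + 3 * \<tau>"], auto)
    ultimately show False using x by auto
  qed
  moreover have "areasq_above h k u = (\<integral>\<^sup>+l. area_at h l u * indicator {k..<\<kappa> + 2 * \<tau> + 1} l \<partial>count_space UNIV)
      + areasq_above h (\<kappa> + 2 * \<tau> + 1) u"
    using k_small tau_nonneg by (intro areasq_above_split) auto
  ultimately have "areasq_above h k u \<le> ennreal (real m * (L * t))
      + (\<integral>\<^sup>+l. area_at h l u * indicator {k..<\<kappa> + 2 * \<tau> + 1} l \<partial>count_space UNIV)"
    by (simp only: add.commute[of _ "areasq_above h (\<kappa> + 2 * \<tau> + 1) u"] add_right_mono)
  moreover have "ennreal (real m * (L * t)) + ennreal (L * t) = ennreal (real (Suc m) * (L * t))"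
    using L_pos t_pos by (subst ennreal_plus[symmetric]) (auto simp: algebra_simps)
  ultimately have "ennreal (real m * (L * t)) + ennreal (L * t) \<le> ennreal (real m * (L * t))
      + (\<integral>\<^sup>+l. area_at h l u * indicator {k..<\<kappa> + 2 * \<tau> + 1} l \<partial>count_space UNIV)"
    using y(3) by simp
  then have "ennreal (L * t) \<le> (\<integral>\<^sup>+l. area_at h l u * indicator {k..<\<kappa> + 2 * \<tau> + 1} l \<partial>count_space UNIV)"
    by (simp only: ennreal_add_left_cancel_le) simp
  also have "\<dots> \<le> wide_areasq h (5 * \<tau>) (\<kappa> + 2 * \<tau>) v"
    unfolding wide_areasq_def
  proof (intro nn_integral_mono)
    fix l :: int
    show "area_at h l u * indicator {k..<\<kappa> + 2 * \<tau> + 1} l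
      \<le> ennreal (b powi (- l)) * (\<integral>\<^sup>+z\<in>dball v (l + 5 * \<tau>). h (z, l) \<partial>lebesgue) * indicator {..\<kappa> + 2 * \<tau>} l"
    proof (cases "l \<in> {k..<\<kappa> + 2 * \<tau> + 1}")
      case True
      have "dball u l \<subseteq> dball v (l + 5 * \<tau>)"
        using uv True tau_nonneg by - (rule dball_subset_dball[of _ _ "k + 4 * \<tau>" "l + 4 * \<tau>"], auto)
      then have "area_at h l u \<le> ennreal (b powi (- l)) * (\<integral>\<^sup>+z\<in>dball v (l + 5 * \<tau>). h (z, l) \<partial>lebesgue)"
        unfolding area_at_def by (intro mult_left_mono nn_integral_mono) (auto simp: indicator_def)
      then show ?thesis using True by (auto simp: indicator_def)
    qed simp
  qed
  finally show ?thesis .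
qed

text \<open>
  Chebyshev's inequality for the widened area function, with the Carleson estimate.
\<close>

lemma stopset_slice:
  assumes fin: "emeasure lebesgue (U m) < \<infinity>"
    and \<kappa>: "dball x (\<kappa> + 3 * \<tau>) \<subseteq> U m" "\<not> dball x (\<kappa> + 1 + 3 * \<tau>) \<subseteq> U m"
  shows "emeasure lebesgue (U (Suc m) \<inter> dball x (\<kappa> + 2 * \<tau>))
    \<le> ennreal (2 * b powi (14 * \<tau>) / L) * emeasure lebesgue (U m \<inter> dball x \<kappa>)"
proof -
  let ?V = "U (Suc m) \<inter> dball x (\<kappa> + 2 * \<tau>)"
  let ?W = "wide_areasq h (5 * \<tau>) (\<kappa> + 2 * \<tau>)"
  have "ennreal (L * t) * emeasure lebesgue ?V = (\<integral>\<^sup>+v. ennreal (L * t) * indicator ?V v \<partial>lebesgue)"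
    by (rule nn_integral_cmult_indicator[symmetric]) auto
  also have "\<dots> \<le> (\<integral>\<^sup>+v\<in>dball x (\<kappa> + 2 * \<tau>). ?W v \<partial>lebesgue)"
  proof (intro nn_integral_mono)
    fix v
    show "ennreal (L * t) * indicator ?V v \<le> ?W v * indicator (dball x (\<kappa> + 2 * \<tau>)) v"
      using wide_area_large[OF \<kappa>(2), of v] by (cases "v \<in> ?V") auto
  qed
  also have "\<dots> \<le> 2 * ennreal (b powi (2 * (5 * \<tau>) + 2 * \<tau> + (\<kappa> + 2 * \<tau>))) * ennreal t"
    using tau_nonneg by (intro carleson_estimate[OF h_slices sets_E dens_E area_E]) auto
  also have "2 * (5 * \<tau>) + 2 * \<tau> + (\<kappa> + 2 * \<tau>) = 14 * \<tau> + \<kappa>" by simp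
  also have "2 * ennreal (b powi (14 * \<tau> + \<kappa>)) * ennreal t = ennreal (2 * b powi (14 * \<tau> + \<kappa>) * t)"
    using t_pos by (simp add: ennreal_mult' less_imp_le)
  also have "2 * b powi (14 * \<tau> + \<kappa>) * t = (L * t) * (2 * b powi (14 * \<tau>) / L * b powi \<kappa>)"
    using L_pos by (simp add: b_powi_add)
  also have "ennreal \<dots> = ennreal (L * t) * (ennreal (2 * b powi (14 * \<tau>) / L) * ennreal (b powi \<kappa>))"
  proof -
    have 0: "0 \<le> L * t" "0 \<le> 2 * b powi (14 * \<tau>) / L" "0 \<le> b powi \<kappa>"
      using L_pos t_pos by simp_all
    show ?thesis
      by (simp only: ennreal_mult[OF 0(1) mult_nonneg_nonneg[OF 0(2,3)]] ennreal_mult[OF 0(2,3)])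
  qed
  finally have *: "ennreal (L * t) * emeasure lebesgue ?V
      \<le> ennreal (L * t) * (ennreal (2 * b powi (14 * \<tau>) / L) * ennreal (b powi \<kappa>))" .
  moreover have "0 < ennreal (L * t)" using L_pos t_pos by simp
  ultimately have "emeasure lebesgue ?V \<le> ennreal (2 * b powi (14 * \<tau>) / L) * ennreal (b powi \<kappa>)"
    by (simp add: ennreal_mult_le_mult_iff del: emeasure_completion)
  moreover have "dball x \<kappa> \<subseteq> U m"
    using \<kappa>(1) dball_mono[of \<kappa> "\<kappa> + 3 * \<tau>" x] tau_nonneg by auto
  then have "U m \<inter> dball x \<kappa> = dball x \<kappa>" by auto
  ultimately show ?thesis by (simp only: emeasure_dball)
qed

text \<open>
  Weights that vary by a bounded factor across balls whose volume is at most a fixed multiple of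
  that of \<open>\<Omega>\<close>; these are the only balls that meet the stopping sets.
\<close>

definition comparable_weight :: "real \<Rightarrow> (real^'n \<Rightarrow> ennreal) \<Rightarrow> bool" where
  "comparable_weight Cw w \<longleftrightarrow> w \<in> borel_measurable lebesgue \<and>
     (\<forall>k x y. ennreal (b powi k) \<le> ennreal (2 * b powi (5 * \<tau>)) * emeasure lebesgue \<Omega> \<longrightarrow>
        x - y \<in> B (k + 6 * \<tau>) \<longrightarrow> w x \<le> ennreal Cw * w y)"

lemma weight_stopset_0:
  assumes "comparable_weight Cw w"
  shows "emeasure (density lebesgue w) (U 0)
    \<le> ennreal (2 * b powi (5 * \<tau>)) * ennreal Cw * emeasure (density lebesgue w) \<Omega>"
proof (rule covering_estimate[where I = "(\<lambda>(y, k). (y, k + 3 * \<tau>)) ` dense_in \<Omega>"])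
  have [measurable]: "w \<in> borel_measurable lebesgue" using assms by (simp add: comparable_weight_def)
  fix y k' assume "(y, k') \<in> (\<lambda>(y, k). (y, k + 3 * \<tau>)) ` dense_in \<Omega>"
  then obtain k where k: "k' = k + 3 * \<tau>" "ennreal (b powi k) < 2 * emeasure lebesgue (dball y k \<inter> \<Omega>)"
    by (auto simp: dense_in_def)
  let ?V = "U 0 \<inter> dball y (k' + 2 * \<tau>)"
  have kk: "k' + 2 * \<tau> = k + 5 * \<tau>" using k(1) by simp
  have Fsub: "emeasure lebesgue (dball y k \<inter> \<Omega>) \<le> emeasure lebesgue \<Omega>"
    by (intro emeasure_mono) auto
  have "emeasure lebesgue ?V \<le> emeasure lebesgue (dball y (k + 5 * \<tau>))"
    unfolding kk by (intro emeasure_mono) auto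
  also have "\<dots> = ennreal (b powi (5 * \<tau>)) * ennreal (b powi k)"
    by (simp only: emeasure_dball ennreal_b_powi_mult add.commute)
  also have "\<dots> \<le> ennreal (b powi (5 * \<tau>)) * (2 * emeasure lebesgue (dball y k \<inter> \<Omega>))"
    using k(2) by (intro mult_left_mono less_imp_le) auto
  also have "\<dots> = ennreal (2 * b powi (5 * \<tau>)) * emeasure lebesgue (dball y k \<inter> \<Omega>)"
    by (simp add: ennreal_mult' mult_ac del: emeasure_completion)
  finally have 1: "emeasure lebesgue ?V \<le> ennreal (2 * b powi (5 * \<tau>)) * emeasure lebesgue (dball y k \<inter> \<Omega>)" .
  have 2: "ennreal (b powi k) \<le> ennreal (2 * b powi (5 * \<tau>)) * emeasure lebesgue \<Omega>"
  proof -
    have "ennreal (b powi k) \<le> ennreal 2 * emeasure lebesgue \<Omega>"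
      using k(2) Fsub by (simp add: mult_left_mono order_trans[OF less_imp_le] del: emeasure_completion)
    also have "\<dots> \<le> ennreal (2 * b powi (5 * \<tau>)) * emeasure lebesgue \<Omega>"
      using b_powi_mono[of 0 "5 * \<tau>"] tau_nonneg by (intro mult_right_mono ennreal_leI) auto
    finally show ?thesis .
  qed
  have "emeasure (density lebesgue w) ?V
      \<le> ennreal (2 * b powi (5 * \<tau>)) * ennreal Cw * emeasure (density lebesgue w) (dball y k \<inter> \<Omega>)"
  proof (rule weighted_compare[OF _ _ _ 1])
    show "emeasure lebesgue (dball y k \<inter> \<Omega>) \<noteq> 0" using k(2) by (auto simp del: emeasure_completion)
    show "emeasure lebesgue (dball y k \<inter> \<Omega>) \<noteq> \<infinity>"
      using Fsub fin_Omega by (auto simp del: emeasure_completion simp: top_unique)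
    fix u v assume "v \<in> ?V" "u \<in> dball y k \<inter> \<Omega>"
    then have "v - u \<in> B (k + 6 * \<tau>)"
      using tau_nonneg unfolding kk
      by - (rule B_triangle[of v y "k + 5 * \<tau>" u k "k + 5 * \<tau>"], auto simp: mem_dball B_minus_commute)
    then show "w v \<le> ennreal Cw * w u" using assms 2 by (auto simp: comparable_weight_def)
  qed auto
  also have "\<dots> \<le> ennreal (2 * b powi (5 * \<tau>)) * ennreal Cw * emeasure (density lebesgue w) (\<Omega> \<inter> dball y k')"
    unfolding k(1) using dball_mono[of k "k + 3 * \<tau>" y] tau_nonneg by (intro mult_left_mono emeasure_mono) auto
  finally show "emeasure (density lebesgue w) ?V
    \<le> ennreal (2 * b powi (5 * \<tau>)) * ennreal Cw * emeasure (density lebesgue w) (\<Omega> \<inter> dball y k')" .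
next
  show "U 0 \<subseteq> (\<Union>(y, k)\<in>(\<lambda>(y, k). (y, k + 3 * \<tau>)) ` dense_in \<Omega>. dball y k)"
    by (auto simp: stopset_def stop_def)
qed auto

lemma lebesgue_stopset_0: "emeasure lebesgue (U 0) \<le> ennreal (2 * b powi (5 * \<tau>)) * emeasure lebesgue \<Omega>"
proof -
  have "density lebesgue (\<lambda>_. 1) = (lebesgue :: (real^'n) measure)" by (rule density_1)
  moreover have "comparable_weight 1 (\<lambda>_. 1)" by (simp add: comparable_weight_def)
  ultimately show ?thesis using weight_stopset_0[of 1 "\<lambda>_. 1"] by simp
qed

lemma finite_stopset: "emeasure lebesgue (U m) < \<infinity>"
proof -
  have "emeasure lebesgue (U m) \<le> emeasure lebesgue (U 0)"
    using stopset_antimono[of "L * t" 0 m] L_pos t_pos by (intro emeasure_mono) auto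
  also note lebesgue_stopset_0
  also have "ennreal (2 * b powi (5 * \<tau>)) * emeasure lebesgue \<Omega> < \<infinity>"
    using fin_Omega by (simp add: ennreal_mult_less_top del: emeasure_completion)
  finally show ?thesis .
qed

lemma weight_stopset_Suc:
  assumes "comparable_weight Cw w"
  shows "emeasure (density lebesgue w) (U (Suc m))
    \<le> ennreal (2 * b powi (14 * \<tau>) / L) * ennreal Cw * emeasure (density lebesgue w) (U m)"
proof (rule covering_estimate[where I = "{(x, \<kappa>). dball x (\<kappa> + 3 * \<tau>) \<subseteq> U m \<and> \<not> dball x (\<kappa> + 1 + 3 * \<tau>) \<subseteq> U m}"])
  have w [measurable]: "w \<in> borel_measurable lebesgue" using assms by (simp add: comparable_weight_def)
  have sub: "U (Suc m) \<subseteq> U m" using stopset_antimono[of "L * t" m "Suc m"] L_pos t_pos by auto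
  show "U (Suc m) \<subseteq> (\<Union>(y, k)\<in>{(x, \<kappa>). dball x (\<kappa> + 3 * \<tau>) \<subseteq> U m \<and> \<not> dball x (\<kappa> + 1 + 3 * \<tau>) \<subseteq> U m}. dball y k)"
  proof
    fix x assume "x \<in> U (Suc m)"
    then obtain \<kappa> where "dball x (\<kappa> + 3 * \<tau>) \<subseteq> U m" "\<not> dball x (\<kappa> + 1 + 3 * \<tau>) \<subseteq> U m"
      using whitney_scale_ex[OF finite_stopset open_stopset, of x m] sub by blast
    then show "x \<in> (\<Union>(y, k)\<in>{(x, \<kappa>). dball x (\<kappa> + 3 * \<tau>) \<subseteq> U m \<and> \<not> dball x (\<kappa> + 1 + 3 * \<tau>) \<subseteq> U m}. dball y k)"
      using centre_in_dball by blast
  qed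
  fix x \<kappa> assume "(x, \<kappa>) \<in> {(x, \<kappa>). dball x (\<kappa> + 3 * \<tau>) \<subseteq> U m \<and> \<not> dball x (\<kappa> + 1 + 3 * \<tau>) \<subseteq> U m}"
  then have \<kappa>: "dball x (\<kappa> + 3 * \<tau>) \<subseteq> U m" "\<not> dball x (\<kappa> + 1 + 3 * \<tau>) \<subseteq> U m" by auto
  have bU: "dball x \<kappa> \<subseteq> U m"
    using \<kappa>(1) dball_mono[of \<kappa> "\<kappa> + 3 * \<tau>" x] tau_nonneg by auto
  then have F: "U m \<inter> dball x \<kappa> = dball x \<kappa>" by auto
  show "emeasure (density lebesgue w) (U (Suc m) \<inter> dball x (\<kappa> + 2 * \<tau>))
      \<le> ennreal (2 * b powi (14 * \<tau>) / L) * ennreal Cw * emeasure (density lebesgue w) (U m \<inter> dball x \<kappa>)"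
  proof (rule weighted_compare[OF w _ _ stopset_slice[OF finite_stopset \<kappa>]])
    show "emeasure lebesgue (U m \<inter> dball x \<kappa>) \<noteq> 0"
      unfolding F emeasure_dball by (rule ennreal_b_powi_ne_0)
    show "emeasure lebesgue (U m \<inter> dball x \<kappa>) \<noteq> \<infinity>"
      unfolding F emeasure_dball by simp
    have "ennreal (b powi \<kappa>) \<le> emeasure lebesgue (U 0)"
      unfolding emeasure_dball[of x \<kappa>, symmetric]
      using bU stopset_antimono[of "L * t" 0 m] L_pos t_pos by (intro emeasure_mono) auto
    also note lebesgue_stopset_0
    finally have adm: "ennreal (b powi \<kappa>) \<le> ennreal (2 * b powi (5 * \<tau>)) * emeasure lebesgue \<Omega>" .
    fix u v assume "v \<in> U (Suc m) \<inter> dball x (\<kappa> + 2 * \<tau>)" "u \<in> U m \<inter> dball x \<kappa>"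
    then have "v - u \<in> B (\<kappa> + 6 * \<tau>)"
      using tau_nonneg
      by - (rule B_triangle[of v x "\<kappa> + 2 * \<tau>" u \<kappa> "\<kappa> + 2 * \<tau>"], auto simp: mem_dball B_minus_commute)
    then show "w v \<le> ennreal Cw * w u" using assms adm by (auto simp: comparable_weight_def)
  qed auto
qed auto

lemma weight_stopset_decay:
  assumes w: "comparable_weight Cw w" and Cw: "0 \<le> Cw"
    and \<theta>: "2 * b powi (14 * \<tau>) * Cw \<le> \<theta> * L"
  shows "emeasure (density lebesgue w) (U m)
    \<le> ennreal (2 * b powi (5 * \<tau>) * Cw * \<theta> ^ m) * emeasure (density lebesgue w) \<Omega>"
proof -
  have th0: "0 \<le> \<theta>"
  proof -
    have "0 \<le> \<theta> * L" using Cw \<theta> by (smt (verit) b_powi_pos mult_nonneg_nonneg)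
    then show ?thesis using L_pos by (simp add: zero_le_mult_iff)
  qed
  have step: "ennreal (2 * b powi (14 * \<tau>) / L) * ennreal Cw \<le> ennreal \<theta>"
  proof -
    have "ennreal (2 * b powi (14 * \<tau>) / L) * ennreal Cw = ennreal (2 * b powi (14 * \<tau>) / L * Cw)"
      using L_pos Cw by (intro ennreal_mult[symmetric]) (auto simp: less_imp_le)
    also have "\<dots> \<le> ennreal \<theta>"
      using \<theta> L_pos by (intro ennreal_leI) (simp add: pos_divide_le_eq)
    finally show ?thesis .
  qed
  show ?thesis
  proof (induction m)
    case 0
    show ?case using weight_stopset_0[OF w] Cw by (simp add: ennreal_mult' less_imp_le)
  next
    case (Suc m)
    have "emeasure (density lebesgue w) (U (Suc m))
        \<le> ennreal \<theta> * emeasure (density lebesgue w) (U m)"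
      using weight_stopset_Suc[OF w, of m] step by (meson mult_right_mono order_trans zero_le)
    also have "\<dots> \<le> ennreal \<theta> * (ennreal (2 * b powi (5 * \<tau>) * Cw * \<theta> ^ m) * emeasure (density lebesgue w) \<Omega>)"
      by (intro mult_left_mono Suc.IH) simp
    also have "\<dots> = ennreal (2 * b powi (5 * \<tau>) * Cw * \<theta> ^ Suc m) * emeasure (density lebesgue w) \<Omega>"
      using th0 Cw by (simp add: ennreal_mult' less_imp_le mult_ac)
    finally show ?case .
  qed
qed

end

section \<open>Whitney pieces of a tent function\<close>

text \<open>
  At every scale \<open>k\<close> the space is partitioned into measurable cells of the size of \<open>B\<^sub>k\<close>; \<open>ctr k z\<close> is a
  point near the cell with index \<open>z\<close>, and a ball of level \<open>k + \<tau>\<close> contains a bounded number of them.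
\<close>

locale gridded_balls = dilated_balls B b \<tau>
  for B :: "int \<Rightarrow> (real^'n) set" and b :: real and \<tau> :: int +
  fixes cell :: "int \<Rightarrow> real^'n \<Rightarrow> 'z::countable" and ctr :: "int \<Rightarrow> 'z \<Rightarrow> real^'n" and N :: nat
  assumes sets_cell: "{y. cell k y = z} \<in> sets lebesgue"
    and near_ctr: "y - ctr k (cell k y) \<in> B k"
    and cell_count: "finite {z. x - ctr k z \<in> B (k + \<tau>)}" "card {z. x - ctr k z \<in> B (k + \<tau>)} \<le> N"
begin

definition whitney :: "(real^'n) set \<Rightarrow> real^'n \<Rightarrow> int \<Rightarrow> bool" where
  "whitney U y k \<longleftrightarrow> dball y (k + 3 * \<tau>) \<subseteq> U \<and> \<not> dball y (k + 1 + 3 * \<tau>) \<subseteq> U"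

definition used :: "(real^'n) set \<Rightarrow> (int \<times> 'z) set" where
  "used U = {(k, z). \<exists>y. cell k y = z \<and> whitney U y k}"

definition whitney_ball :: "int \<Rightarrow> 'z \<Rightarrow> (real^'n) set" where
  "whitney_ball k z = dball (ctr k z) (k + \<tau>)"

lemma whitney_le:
  assumes "whitney U y k" "whitney U y k'"
  shows "k \<le> k'"
proof (rule ccontr)
  assume "\<not> ?thesis"
  then have "dball y (k' + 1 + 3 * \<tau>) \<subseteq> dball y (k + 3 * \<tau>)" by (intro dball_mono) simp
  with assms show False unfolding whitney_def by blast
qed

lemma whitney_unique: "whitney U y k \<Longrightarrow> whitney U y k' \<Longrightarrow> k = k'"
  using whitney_le by (meson antisym)

lemma dball_subset_whitney_ball:
  assumes "l \<le> k"
  shows "dball y l \<subseteq> whitney_ball k (cell k y)"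
  unfolding whitney_ball_def using assms near_ctr[of y k]
  by - (rule dball_subset_dball[of _ _ k k], auto)

lemma sets_whitney: "{y. whitney U y k} \<in> sets lebesgue"
proof -
  have *: "{y. dball y k \<subseteq> U} \<in> sets lebesgue" for k
  proof -
    have "- {y. dball y k \<subseteq> U} = (\<Union>u\<in>- U. dball u k)"
      using mem_dball_commute by blast
    then have "closed {y. dball y k \<subseteq> U}"
      unfolding closed_def using open_dball by auto
    then show ?thesis by (metis borel_closed sets_completionI_sets sets_lborel)
  qed
  have "{y. whitney U y k} = {y. dball y (k + 3 * \<tau>) \<subseteq> U} - {y. dball y (k + 1 + 3 * \<tau>) \<subseteq> U}"
    by (auto simp: whitney_def)
  then show ?thesis using * by auto
qed

text \<open>
  The scale of a used ball is determined, up to \<open>2 \<tau>\<close> levels, by any of its points; this is the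
  reason for bounded overlap.
\<close>

lemma used_ball:
  assumes "(k, z) \<in> used U" "x \<in> whitney_ball k z"
  shows "dball x (k + 2 * \<tau>) \<subseteq> U \<and> \<not> dball x (k + 1 + 4 * \<tau>) \<subseteq> U"
proof -
  obtain y where y: "cell k y = z" "whitney U y k" using assms(1) by (auto simp: used_def)
  have yz: "ctr k z - y \<in> B k" using near_ctr[of y k] y(1) by (simp add: B_minus_commute)
  have xz: "x - ctr k z \<in> B (k + \<tau>)" using assms(2) by (simp add: whitney_ball_def mem_dball)
  have xy: "x - y \<in> B (k + 2 * \<tau>)"
    using tau_nonneg by (intro B_triangle[OF xz yz, of "k + \<tau>"]) auto
  have "dball x (k + 2 * \<tau>) \<subseteq> dball y (k + 3 * \<tau>)"
    using tau_nonneg by (intro dball_subset_dball[OF xy, of "k + 2 * \<tau>"]) auto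
  moreover have "dball y (k + 1 + 3 * \<tau>) \<subseteq> dball x (k + 1 + 4 * \<tau>)"
    using tau_nonneg xy by (intro dball_subset_dball[of y x "k + 2 * \<tau>" "k + 1 + 3 * \<tau>"]) (auto simp: B_minus_commute)
  ultimately show ?thesis using y(2) unfolding whitney_def by blast
qed

lemma used_subset: "(k, z) \<in> used U \<Longrightarrow> whitney_ball k z \<subseteq> U"
  using used_ball centre_in_dball by blast

lemma used_overlap:
  "finite {(k, z) \<in> used U. x \<in> whitney_ball k z} \<and> card {(k, z) \<in> used U. x \<in> whitney_ball k z} \<le> nat (4 * \<tau> + 1) * N"
proof (cases "{(k, z) \<in> used U. x \<in> whitney_ball k z} = {}")
  case False
  then obtain k0 z0 where 0: "(k0, z0) \<in> used U" "x \<in> whitney_ball k0 z0" by auto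
  have close: "k \<le> k' + 2 * \<tau>" if "(k, z) \<in> used U" "x \<in> whitney_ball k z" "(k', z') \<in> used U" "x \<in> whitney_ball k' z'" for k z k' z'
  proof (rule ccontr)
    assume "\<not> ?thesis"
    then have "dball x (k' + 1 + 4 * \<tau>) \<subseteq> dball x (k + 2 * \<tau>)" by (intro dball_mono) simp
    with used_ball[OF that(1,2)] used_ball[OF that(3,4)] show False by blast
  qed
  let ?S = "Sigma {k0 - 2 * \<tau>..k0 + 2 * \<tau>} (\<lambda>k. {z. x - ctr k z \<in> B (k + \<tau>)})"
  have sub: "{(k, z) \<in> used U. x \<in> whitney_ball k z} \<subseteq> ?S"
  proof
    fix q assume "q \<in> {(k, z) \<in> used U. x \<in> whitney_ball k z}"
    then obtain k z where q: "q = (k, z)" and kz: "(k, z) \<in> used U" "x \<in> whitney_ball k z" by auto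
    from close[OF kz 0] close[OF 0 kz] kz(2) show "q \<in> ?S" by (auto simp: whitney_ball_def mem_dball q)
  qed
  have fin: "finite ?S" using cell_count(1) by (intro finite_SigmaI) auto
  have "card ?S = (\<Sum>k\<in>{k0 - 2 * \<tau>..k0 + 2 * \<tau>}. card {z. x - ctr k z \<in> B (k + \<tau>)})"
    using cell_count(1) by (intro card_SigmaI) auto
  also have "\<dots> \<le> (\<Sum>k\<in>{k0 - 2 * \<tau>..k0 + 2 * \<tau>}. N)"
    by (intro sum_mono cell_count(2))
  also have "\<dots> = nat (4 * \<tau> + 1) * N" by simp
  finally show ?thesis using sub fin by (meson card_mono finite_subset order_trans)
next
  case True
  then show ?thesis by (simp only: True) simp
qed

end

locale area_data = gridded_balls B b \<tau> cell ctr N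
  for B :: "int \<Rightarrow> (real^'n) set" and b :: real and \<tau> :: int
    and cell :: "int \<Rightarrow> real^'n \<Rightarrow> 'z::countable" and ctr :: "int \<Rightarrow> 'z \<Rightarrow> real^'n" and N :: nat +
  fixes h :: "(real^'n) \<times> int \<Rightarrow> ennreal" and L :: real
  assumes h_slices: "slices_measurable h"
    and fin_level: "\<And>i. emeasure lebesgue {x. ennreal (4 powi i) < areasq h x} < \<infinity>"
    and fin_AE: "AE x in lebesgue. areasq h x < \<infinity>"
    and L_large: "real_of_int (6 * \<tau> + 1) * (2 * b powi (4 * \<tau>)) \<le> L" "4 * b powi (14 * \<tau>) \<le> L"
begin

text \<open>
  The sets \<open>{\<A> > 2\<^sup>i}\<close>, written with the square of the area function.
\<close>

definition level :: "int \<Rightarrow> (real^'n) set" where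
  "level i = {x. ennreal (4 powi i) < areasq h x}"

definition band :: "int \<Rightarrow> (real^'n) \<times> int \<Rightarrow> ennreal" where
  "band i z = (if z \<in> dense_in (level i) - dense_in (level (i + 1)) then h z else 0)"

abbreviation thr :: "int \<Rightarrow> real" where "thr i \<equiv> 4 powi (i + 1)"

abbreviation stop_at :: "int \<Rightarrow> nat \<Rightarrow> ((real^'n) \<times> int) set" where
  "stop_at i m \<equiv> stop (level i) (band i) (L * thr i) m"

abbreviation stopset_at :: "int \<Rightarrow> nat \<Rightarrow> (real^'n) set" where
  "stopset_at i m \<equiv> stopset (level i) (band i) (L * thr i) m"

lemma sets_level [measurable]: "level i \<in> sets lebesgue"
proof -
  have [measurable]: "areasq h \<in> borel_measurable lebesgue" by (rule areasq_measurable[OF h_slices])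
  have "{x \<in> space lebesgue. ennreal (4 powi i) < areasq h x} \<in> sets lebesgue" by measurable
  then show ?thesis by (simp add: level_def)
qed

lemma level_antimono: "i \<le> j \<Longrightarrow> level j \<subseteq> level i"
proof -
  assume "i \<le> j"
  then have "ennreal (4 powi i) \<le> ennreal (4 powi j)"
    by (intro ennreal_leI power_int_increasing) auto
  then have "ennreal (4 powi i) < a" if "ennreal (4 powi j) < a" for a
    using that by (rule le_less_trans)
  then show ?thesis unfolding level_def by auto
qed

lemma dense_in_mono:
  assumes "X \<subseteq> Y" "Y \<in> sets lebesgue"
  shows "dense_in X \<subseteq> dense_in Y"
proof -
  have "emeasure lebesgue (dball y k \<inter> X) \<le> emeasure lebesgue (dball y k \<inter> Y)" for y k
    using assms by (intro emeasure_mono) auto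
  then have "2 * emeasure lebesgue (dball y k \<inter> X) \<le> 2 * emeasure lebesgue (dball y k \<inter> Y)" for y k
    by (intro mult_left_mono) auto
  then show ?thesis unfolding dense_in_def by (auto simp del: emeasure_completion intro: less_le_trans)
qed

lemma dense_level_antimono: "i \<le> j \<Longrightarrow> dense_in (level j) \<subseteq> dense_in (level i)"
  by (intro dense_in_mono level_antimono) auto

lemma measure_meets_measurable:
  assumes [measurable]: "X \<in> sets lebesgue"
  shows "(\<lambda>y. emeasure lebesgue (dball y k \<inter> X)) \<in> borel_measurable lebesgue"
proof -
  have "emeasure lebesgue (dball y k \<inter> X) = (\<integral>\<^sup>+x\<in>dball y k. indicator X x \<partial>lebesgue)" for y
  proof -
    have "(\<integral>\<^sup>+x\<in>dball y k. indicator X x \<partial>lebesgue) = (\<integral>\<^sup>+x. indicator (dball y k \<inter> X) x \<partial>lebesgue)"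
      by (intro nn_integral_cong) (auto simp: indicator_def)
    also have "\<dots> = emeasure lebesgue (dball y k \<inter> X)" by (rule nn_integral_indicator) auto
    finally show ?thesis by simp
  qed
  then show ?thesis using ball_integral_measurable[of "indicator X" k] by simp
qed

lemma dense_in_slice:
  assumes "X \<in> sets lebesgue"
  shows "{y. (y, k) \<in> dense_in X} \<in> sets lebesgue"
proof -
  have [measurable]: "(\<lambda>y. emeasure lebesgue (dball y k \<inter> X)) \<in> borel_measurable lebesgue"
    by (rule measure_meets_measurable[OF assms])
  have "{y \<in> space lebesgue. ennreal (b powi k) < 2 * emeasure lebesgue (dball y k \<inter> X)} \<in> sets lebesgue"
    by measurable
  then show ?thesis by (simp add: dense_in_def)
qed

lemma stop_slice:
  assumes "X \<in> sets lebesgue"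
  shows "{y. (y, k) \<in> stop X g c m} \<in> sets lebesgue"
proof -
  let ?P = "\<lambda>x. ennreal (real m * c) < areasq_above g k x"
  have "{y. (y, k) \<in> stop X g c m}
      = {y. (y, k) \<in> dense_in X} \<inter> (if m = 0 then UNIV else (\<Union>x\<in>{x. ?P x}. dball x k))"
    unfolding stop_def using mem_dball_commute by auto
  moreover have "open (\<Union>x\<in>{x. ?P x}. dball x k)" using open_dball by auto
  then have "(\<Union>x\<in>{x. ?P x}. dball x k) \<in> sets lebesgue"
    by (metis borel_open sets_completionI_sets sets_lborel)
  ultimately show ?thesis using dense_in_slice[OF assms] by auto
qed

lemma band_slices: "slices_measurable (band i)"
  unfolding slices_measurable_def
proof
  fix l
  have [measurable]: "(\<lambda>y. h (y, l)) \<in> borel_measurable lebesgue"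
    using h_slices by (simp add: slices_measurable_def)
  have m: "{y. (y, l) \<in> dense_in (level i) - dense_in (level (i + 1))} \<in> sets lebesgue"
  proof -
    have "{y. (y, l) \<in> dense_in (level i) - dense_in (level (i + 1))}
        = {y. (y, l) \<in> dense_in (level i)} - {y. (y, l) \<in> dense_in (level (i + 1))}" by auto
    then show ?thesis using dense_in_slice by auto
  qed
  have "(\<lambda>y. band i (y, l)) = (\<lambda>y. h (y, l) * indicator {y. (y, l) \<in> dense_in (level i) - dense_in (level (i + 1))} y)"
    by (auto simp: band_def fun_eq_iff)
  then show "(\<lambda>y. band i (y, l)) \<in> borel_measurable lebesgue" using m by simp
qed

lemma half_outside:
  assumes "X \<in> sets lebesgue" "(y, k) \<notin> dense_in X"
  shows "ennreal (b powi k) \<le> 2 * emeasure lebesgue (dball y k \<inter> - X)"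
proof -
  have "2 * emeasure lebesgue (dball y k \<inter> X) + 2 * emeasure lebesgue (dball y k \<inter> - X) = 2 * emeasure lebesgue (dball y k)"
  proof -
    have "emeasure lebesgue (dball y k \<inter> X) + emeasure lebesgue (dball y k \<inter> - X)
        = emeasure lebesgue ((dball y k \<inter> X) \<union> (dball y k \<inter> - X))"
      using assms(1) by (intro plus_emeasure) auto
    also have "(dball y k \<inter> X) \<union> (dball y k \<inter> - X) = dball y k" by auto
    finally show ?thesis by (simp only: distrib_left[symmetric])
  qed
  also have "\<dots> = ennreal (b powi k) + ennreal (b powi k)" by (simp only: emeasure_dball mult_2)
  finally have eq: "2 * emeasure lebesgue (dball y k \<inter> X) + 2 * emeasure lebesgue (dball y k \<inter> - X)
      = ennreal (b powi k) + ennreal (b powi k)" .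
  have "2 * emeasure lebesgue (dball y k \<inter> X) \<le> ennreal (b powi k)"
    using assms(2) by (simp add: dense_in_def not_less del: emeasure_completion)
  then have "ennreal (b powi k) + ennreal (b powi k)
      \<le> ennreal (b powi k) + 2 * emeasure lebesgue (dball y k \<inter> - X)"
    unfolding eq[symmetric] by (rule add_right_mono)
  then show ?thesis by (simp only: ennreal_add_left_cancel_le) simp
qed

lemma band_level: "level_data B b \<tau> (level i) (- level (i + 1)) (band i) (thr i) L"
proof
  show "emeasure lebesgue (level i) < \<infinity>" unfolding level_def by (rule fin_level)
  show "slices_measurable (band i)" by (rule band_slices)
  show "ennreal (b powi l) \<le> 2 * emeasure lebesgue (dball z l \<inter> - level (i + 1))" if "band i (z, l) \<noteq> 0" for z l
    using that by (intro half_outside) (auto simp: band_def split: if_splits)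
  show "(z, l) \<in> dense_in (level i)" if "band i (z, l) \<noteq> 0" for z l
    using that by (auto simp: band_def split: if_splits)
  show "areasq (band i) w \<le> ennreal (thr i)" if "w \<in> - level (i + 1)" for w
  proof -
    have "areasq (band i) w \<le> areasq h w"
      unfolding areasq_def by (intro nn_integral_mono area_at_mono) (auto simp: band_def)
    with that show ?thesis by (auto simp: level_def)
  qed
  show "- level (i + 1) \<in> sets lebesgue" using sets.compl_sets[OF sets_level[of "i + 1"]] by (simp add: Compl_eq_Diff_UNIV)
qed (use L_large in auto)

definition piece :: "int \<times> nat \<times> int \<times> 'z \<Rightarrow> ((real^'n) \<times> int) set" where
  "piece = (\<lambda>(i, m, k, z). {(y, l). (y, l) \<in> dense_in (level i) \<and> (y, l) \<notin> dense_in (level (i + 1)) \<and>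
      (y, l) \<in> stop_at i m \<and> (y, l) \<notin> stop_at i (Suc m) \<and> whitney (stopset_at i m) y k \<and> cell k y = z})"

lemma LT_nonneg: "0 \<le> L * thr i"
  using L_large(2) by (smt (verit) b_powi_nonneg mult_nonneg_nonneg zero_le_power_int)

lemma piece_slice: "{y. (y, l) \<in> piece j} \<in> sets lebesgue"
proof -
  obtain i m k z where j: "j = (i, m, k, z)" by (cases j)
  have "{y. (y, l) \<in> piece j} = ({y. (y, l) \<in> dense_in (level i)} - {y. (y, l) \<in> dense_in (level (i + 1))})
      \<inter> ({y. (y, l) \<in> stop_at i m} - {y. (y, l) \<in> stop_at i (Suc m)}) \<inter> {y. whitney (stopset_at i m) y k} \<inter> {y. cell k y = z}"
    unfolding j piece_def by auto
  then show ?thesis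
    using dense_in_slice stop_slice sets_whitney sets_cell by auto
qed

lemma piece_unique:
  assumes "q \<in> piece j" "q \<in> piece j'"
  shows "j = j'"
proof -
  obtain y l where q: "q = (y, l)" by (cases q)
  obtain i m k z where j: "j = (i, m, k, z)" by (cases j)
  obtain i' m' k' z' where j': "j' = (i', m', k', z')" by (cases j')
  have *: "i \<le> i'" if "(y, l) \<in> dense_in (level i)" "(y, l) \<notin> dense_in (level (i' + 1))" for i i'
    using that dense_level_antimono[of "i' + 1" i] by force
  have i: "i = i'" using assms *[of i i'] *[of i' i] unfolding j j' q piece_def by auto
  have "m \<le> m'" if "(y, l) \<in> stop_at i m" "(y, l) \<notin> stop_at i (Suc m')" for m m'
    using that stop_antimono[of "L * thr i" "Suc m'" m "level i" "band i"] LT_nonneg[of i]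
    by (meson not_less_eq_eq subsetD)
  then have m: "m = m'" using assms unfolding j j' q piece_def i by (auto intro: antisym)
  show ?thesis using assms whitney_unique unfolding j j' q piece_def i m by auto
qed

lemma piece_used: "q \<in> piece (i, m, k, z) \<Longrightarrow> (k, z) \<in> used (stopset_at i m)"
  unfolding piece_def used_def by auto

lemma piece_tent:
  assumes "(y, l) \<in> piece (i, m, k, z)"
  shows "dball y l \<subseteq> whitney_ball k z"
proof -
  have st: "(y, l) \<in> stop_at i m" and w: "whitney (stopset_at i m) y k" "cell k y = z"
    using assms by (auto simp: piece_def)
  have "dball y (l + 3 * \<tau>) \<subseteq> stopset_at i m" using st unfolding stopset_def by blast
  moreover interpret level_data B b \<tau> "level i" "- level (i + 1)" "band i" "thr i" L by (rule band_level)
  have "emeasure lebesgue (stopset_at i m) < \<infinity>" by (rule finite_stopset)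
  ultimately obtain \<kappa> where "l \<le> \<kappa>" "whitney (stopset_at i m) y \<kappa>"
    using whitney_scale[of "stopset_at i m" y l] unfolding whitney_def by auto
  then have "l \<le> k" using whitney_unique[OF w(1)] by simp
  then show ?thesis using dball_subset_whitney_ball w(2) by blast
qed

lemma piece_area:
  "areasq (\<lambda>q. if q \<in> piece (i, m, k, z) then h q else 0) x \<le> ennreal (real (Suc m) * (L * thr i))"
  by (rule areasq_stopped[where h = "band i" and \<Omega> = "level i"]) (auto simp: piece_def band_def split: if_splits)

lemma half_measure_pos:
  assumes "ennreal (b powi k) \<le> 2 * c"
  shows "0 < c"
proof (rule ccontr)
  assume "\<not> ?thesis"
  then have "c = 0" by simp
  with assms have "ennreal (b powi k) = 0" by simp
  with ennreal_b_powi_ne_0 show False by blast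
qed

lemma level_vanish: "(\<lambda>n. emeasure lebesgue (level (int n))) \<longlonglongrightarrow> 0"
proof -
  have dec: "decseq (\<lambda>n. level (int n))"
    unfolding decseq_def by (intro allI impI level_antimono) simp
  have lim: "(\<lambda>n. emeasure lebesgue (level (int n))) \<longlonglongrightarrow> emeasure lebesgue (\<Inter>n. level (int n))"
    using fin_level by (intro Lim_emeasure_decseq dec) (auto simp: level_def[symmetric] less_top[symmetric])
  have "AE x in lebesgue. x \<notin> (\<Inter>n. level (int n))"
    using fin_AE
  proof eventually_elim
    case (elim x)
    then obtain r where r: "areasq h x = ennreal r" "0 \<le> r" by (cases "areasq h x") auto
    obtain n where "r < 4 ^ n" using real_arch_pow[of 4 r] by auto
    then have "x \<notin> level (int n)" by (simp add: level_def r(1) not_less ennreal_leI)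
    then show ?case by auto
  qed
  moreover have "(\<Inter>n. level (int n)) \<in> sets lebesgue"
    by (rule sets.countable_INT) auto
  ultimately have "(\<Inter>n. level (int n)) \<in> null_sets lebesgue"
    by (simp add: AE_iff_null_sets)
  then have "emeasure lebesgue (\<Inter>n. level (int n)) = 0" by (rule null_setsD1)
  with lim show ?thesis by simp
qed

text \<open>
  If no level set is dense in \<open>y + B\<^sub>l\<close>, then neither is \<open>{\<A> > 0}\<close>, so half of the ball consists of
  points with \<open>\<A> = 0\<close>; by Tonelli \<open>h\<close> vanishes at almost all such \<open>y\<close>.
\<close>

lemma AE_some_dense:
  "AE y in lebesgue. h (y, l) \<noteq> 0 \<longrightarrow> (\<exists>i. (y, l) \<in> dense_in (level i))"
proof -
  let ?Z = "{x. areasq h x = 0}"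
  have hm [measurable]: "(\<lambda>y. h (y, l)) \<in> borel_measurable lebesgue"
    using h_slices by (simp add: slices_measurable_def)
  have [measurable]: "areasq h \<in> borel_measurable lebesgue" by (rule areasq_measurable[OF h_slices])
  have "{x \<in> space lebesgue. areasq h x = 0} \<in> sets lebesgue" by measurable
  then have Z: "?Z \<in> sets lebesgue" by simp
  have "(\<integral>\<^sup>+x\<in>?Z. (\<integral>\<^sup>+y\<in>dball x l. h (y, l) \<partial>lebesgue) \<partial>lebesgue) = (\<integral>\<^sup>+x. 0 \<partial>(lebesgue :: (real^'n) measure))"
  proof (intro nn_integral_cong)
    fix x
    show "(\<integral>\<^sup>+y\<in>dball x l. h (y, l) \<partial>lebesgue) * indicator ?Z x = 0"
    proof (cases "x \<in> ?Z")
      case True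
      then have "area_at h l x = 0" using area_at_le_areasq[of h l x] by simp
      then show ?thesis using ennreal_b_powi_ne_0[of "- l"] unfolding area_at_def mult_eq_0_iff by blast
    qed simp
  qed
  then have "(\<integral>\<^sup>+y. h (y, l) * emeasure lebesgue (dball y l \<inter> ?Z) \<partial>lebesgue) = 0"
    unfolding swap_ball_integral[OF hm Z] by simp
  moreover have "(\<lambda>y. h (y, l) * emeasure lebesgue (dball y l \<inter> ?Z)) \<in> borel_measurable lebesgue"
    by (intro borel_measurable_times_ennreal hm measure_meets_measurable Z)
  ultimately have "AE y in lebesgue. h (y, l) * emeasure lebesgue (dball y l \<inter> ?Z) = 0"
    by (simp only: nn_integral_0_iff_AE)
  then show ?thesis
  proof eventually_elim
    case (elim y)
    show ?case
    proof (intro impI, rule ccontr)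
      assume h0: "h (y, l) \<noteq> 0" and none: "\<nexists>i. (y, l) \<in> dense_in (level i)"
      define P where "P = - ?Z"
      have P: "P \<in> sets lebesgue" unfolding P_def using sets.compl_sets[OF Z] by (simp add: Compl_eq_Diff_UNIV)
      have un: "(\<Union>n. dball y l \<inter> level (- int n)) = dball y l \<inter> P"
      proof -
        have "(\<exists>n. x \<in> level (- int n)) \<longleftrightarrow> areasq h x \<noteq> 0" for x
        proof
          assume "areasq h x \<noteq> 0"
          show "\<exists>n. x \<in> level (- int n)"
          proof (cases "areasq h x")
            case (real r)
            with \<open>areasq h x \<noteq> 0\<close> have "0 < r" by auto
            then obtain n where "(1 / 4) ^ n < r" using real_arch_pow_inv[of r "1 / 4"] by auto
            moreover have "(4::real) powi (- int n) = (1 / 4) ^ n"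
              by (simp add: power_int_minus power_one_over inverse_eq_divide)
            ultimately have "ennreal (4 powi (- int n)) < areasq h x"
              unfolding real using \<open>0 < r\<close> by (simp only: ennreal_lessI)
            then show ?thesis by (auto simp: level_def)
          next
            case top
            then have "x \<in> level (- int 0)" by (simp add: level_def)
            then show ?thesis by blast
          qed
        qed (auto simp: level_def)
        then show ?thesis unfolding P_def by auto
      qed
      have inc: "incseq (\<lambda>n. dball y l \<inter> level (- int n))"
        unfolding incseq_def by (intro allI impI Int_mono subset_refl level_antimono) simp
      have "emeasure lebesgue (dball y l \<inter> P) = (SUP n. emeasure lebesgue (dball y l \<inter> level (- int n)))"
        unfolding un[symmetric] by (rule SUP_emeasure_incseq[OF _ inc, symmetric]) auto
      also have "2 * \<dots> = (SUP n. 2 * emeasure lebesgue (dball y l \<inter> level (- int n)))"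
        by (rule SUP_mult_left_ennreal)
      also have "\<dots> \<le> ennreal (b powi l)"
      proof (rule SUP_least)
        fix n
        from none have "(y, l) \<notin> dense_in (level (- int n))" by blast
        then show "2 * emeasure lebesgue (dball y l \<inter> level (- int n)) \<le> ennreal (b powi l)"
          by (simp add: dense_in_def not_less del: emeasure_completion)
      qed
      finally have "(y, l) \<notin> dense_in P" by (simp add: dense_in_def not_less del: emeasure_completion)
      then have "ennreal (b powi l) \<le> 2 * emeasure lebesgue (dball y l \<inter> - P)" by (rule half_outside[OF P])
      then have "0 < emeasure lebesgue (dball y l \<inter> - P)" by (rule half_measure_pos)
      moreover have "- P = ?Z" by (simp add: P_def)
      ultimately show False using elim h0 by (simp del: emeasure_completion)
    qed
  qed
qed

text \<open>
  The level sets and, by the decay, the stopping sets have arbitrarily small volume, so neither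
  stopping rule can select a fixed ball forever.
\<close>

lemma piece_exhaust:
  assumes h0: "h (y, l) \<noteq> 0" and dense: "(y, l) \<in> dense_in (level i0)"
  shows "\<exists>j. (y, l) \<in> piece j"
proof -
  have "\<exists>n. (y, l) \<notin> dense_in (level (i0 + int n))"
  proof (rule ccontr)
    assume "\<not> ?thesis"
    then have all: "(y, l) \<in> dense_in (level (i0 + int n))" for n by auto
    have "ennreal (b powi l) \<le> 2 * emeasure lebesgue (level (int n))" for n
    proof -
      have "(y, l) \<in> dense_in (level (int n))"
      proof -
        have "int n \<le> i0 + int (nat (int n - i0))" by simp
        from dense_level_antimono[OF this] all[of "nat (int n - i0)"] show ?thesis by blast
      qed
      then have "ennreal (b powi l) \<le> 2 * emeasure lebesgue (dball y l \<inter> level (int n))"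
        by (simp add: dense_in_def less_imp_le del: emeasure_completion)
      also have "\<dots> \<le> 2 * emeasure lebesgue (level (int n))"
        by (intro mult_left_mono emeasure_mono) auto
      finally show ?thesis .
    qed
    moreover have "(\<lambda>n. 2 * emeasure lebesgue (level (int n))) \<longlonglongrightarrow> 2 * 0"
      by (intro ennreal_tendsto_cmult level_vanish) simp
    ultimately have "ennreal (b powi l) \<le> 2 * 0"
      by (intro LIMSEQ_le_const[of _ "2 * 0 :: ennreal"]) auto
    with half_measure_pos[of l 0] show False by simp
  qed
  then obtain n where n: "(y, l) \<notin> dense_in (level (i0 + int n))"
      "\<And>j. j < n \<Longrightarrow> (y, l) \<in> dense_in (level (i0 + int j))"
    using exists_least_iff[of "\<lambda>n. (y, l) \<notin> dense_in (level (i0 + int n))"] by auto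
  have "n \<noteq> 0" using n(1) dense by (intro notI) simp
  define i where "i = i0 + int (n - 1)"
  have i: "(y, l) \<in> dense_in (level i)" "(y, l) \<notin> dense_in (level (i + 1))"
    using n(2)[of "n - 1"] n(1) \<open>n \<noteq> 0\<close> by (auto simp: i_def algebra_simps)
  have Lbig: "4 * b powi (14 * \<tau>) \<le> L" by (rule L_large(2))
  interpret level_data B b \<tau> "level i" "- level (i + 1)" "band i" "thr i" L by (rule band_level)
  \<comment> \<open>otherwise a fixed ball would lie in all stopping sets of the band\<close>
  have "\<exists>m. (y, l) \<notin> stop_at i m"
  proof (rule ccontr)
    assume "\<not> ?thesis"
    then have "dball y (l + 3 * \<tau>) \<subseteq> stopset_at i m" for m unfolding stopset_def by blast
    then have le: "ennreal (b powi (l + 3 * \<tau>)) \<le> emeasure lebesgue (stopset_at i m)" for m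
      unfolding emeasure_dball[of y, symmetric] by (intro emeasure_mono) auto
    have "density lebesgue (\<lambda>_. 1) = (lebesgue :: (real^'n) measure)" by (rule density_1)
    moreover have "comparable_weight 1 (\<lambda>_. 1)" by (simp add: comparable_weight_def)
    ultimately have dec: "emeasure lebesgue (stopset_at i m)
        \<le> ennreal (2 * b powi (5 * \<tau>) * (1 / 2) ^ m) * emeasure lebesgue (level i)" for m
      using weight_stopset_decay[of 1 "\<lambda>_. 1" "1 / 2" m] Lbig
      by (simp del: emeasure_completion)
    have "(\<lambda>m. 2 * b powi (5 * \<tau>) * (1 / 2) ^ m) \<longlonglongrightarrow> 2 * b powi (5 * \<tau>) * 0"
      by (intro tendsto_mult tendsto_const LIMSEQ_power_zero) simp
    then have "(\<lambda>m. emeasure lebesgue (level i) * ennreal (2 * b powi (5 * \<tau>) * (1 / 2) ^ m))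
        \<longlonglongrightarrow> emeasure lebesgue (level i) * ennreal (2 * b powi (5 * \<tau>) * 0)"
      using fin_Omega by (intro ennreal_tendsto_cmult tendsto_ennrealI) auto
    then have "(\<lambda>m. ennreal (2 * b powi (5 * \<tau>) * (1 / 2) ^ m) * emeasure lebesgue (level i))
        \<longlonglongrightarrow> ennreal (2 * b powi (5 * \<tau>) * 0) * emeasure lebesgue (level i)"
      by (simp only: mult.commute)
    then have "ennreal (b powi (l + 3 * \<tau>)) \<le> ennreal (2 * b powi (5 * \<tau>) * 0) * emeasure lebesgue (level i)"
    proof (rule LIMSEQ_le_const)
      show "\<exists>M. \<forall>m\<ge>M. ennreal (b powi (l + 3 * \<tau>))
          \<le> ennreal (2 * b powi (5 * \<tau>) * (1 / 2) ^ m) * emeasure lebesgue (level i)"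
        using order_trans[OF le dec] by blast
    qed
    then show False using ennreal_b_powi_ne_0[of "l + 3 * \<tau>"] by simp
  qed
  then obtain m' where m': "(y, l) \<notin> stop_at i m'" "\<And>j. j < m' \<Longrightarrow> (y, l) \<in> stop_at i j"
    using exists_least_iff[of "\<lambda>m. (y, l) \<notin> stop_at i m"] by auto
  have "(y, l) \<in> stop_at i 0" using i(1) by (simp add: stop_def)
  with m' obtain m where m: "m' = Suc m" by (cases m') auto
  then have st: "(y, l) \<in> stop_at i m" "(y, l) \<notin> stop_at i (Suc m)" using m' by auto
  have "dball y (l + 3 * \<tau>) \<subseteq> stopset_at i m" using st(1) unfolding stopset_def by blast
  then obtain k where "whitney (stopset_at i m) y k"
    using whitney_scale[OF finite_stopset sets_stopset] unfolding whitney_def by metis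
  then have "(y, l) \<in> piece (i, m, k, cell k y)" using i st by (simp add: piece_def)
  then show ?thesis by blast
qed

lemma AE_piece: "AE y in lebesgue. h (y, l) \<noteq> 0 \<longrightarrow> (\<exists>j. (y, l) \<in> piece j)"
  using AE_some_dense[of l] by eventually_elim (use piece_exhaust in blast)

end

section \<open>The balls of an expansive dilation\<close>

lemma funpow_matrix_commute:
  fixes X :: "real^'n^'n"
  shows "((\<lambda>Y. X ** Y) ^^ n) (mat 1) ** X = X ** ((\<lambda>Y. X ** Y) ^^ n) (mat 1)"
  by (induction n) (simp_all add: matrix_mul_assoc[symmetric])

lemma det_funpow_matrix:
  fixes X :: "real^'n^'n"
  shows "det (((\<lambda>Y. X ** Y) ^^ n) (mat 1)) = det X ^ n"
  by (induction n) (simp_all add: det_mul)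

lemma matrix_inv_inverse:
  fixes X :: "real^'n^'n"
  assumes "det X \<noteq> 0"
  shows "X ** matrix_inv X = mat 1 \<and> matrix_inv X ** X = mat 1"
proof -
  have "\<exists>Y. X ** Y = mat 1 \<and> Y ** X = mat 1"
    using assms by (simp add: invertible_det_nz[symmetric] invertible_def)
  then show ?thesis unfolding matrix_inv_def by (rule someI_ex)
qed

locale ellipsoid_dilation =
  fixes A :: "real^'n^'n" and \<Delta> :: "(real^'n) set" and r0 :: real
  assumes ell: "open_ellipsoid0 \<Delta>" and vol: "emeasure lebesgue \<Delta> = 1" and r0: "1 < r0"
    and sub: "(\<lambda>x. r0 *\<^sub>R x) ` \<Delta> \<subseteq> (\<lambda>x. A *v x) ` \<Delta>"
begin

lemma Delta_norm: "\<exists>P::real^'n^'n. invertible P \<and> \<Delta> = {x. norm (P *v x) < 1}"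
  using ell by (simp add: open_ellipsoid0_def)

lemma Delta_zero: "0 \<in> \<Delta>"
  using Delta_norm by auto

lemma Delta_sym: "x \<in> \<Delta> \<Longrightarrow> - x \<in> \<Delta>"
proof -
  obtain P :: "real^'n^'n" where P: "\<Delta> = {x. norm (P *v x) < 1}" using Delta_norm by auto
  have "P *v (- x) = - (P *v x)" by (simp add: vec.neg)
  then show "x \<in> \<Delta> \<Longrightarrow> - x \<in> \<Delta>" by (simp add: P)
qed

lemma Delta_convex: "convex \<Delta>"
proof -
  obtain P :: "real^'n^'n" where P: "\<Delta> = {x. norm (P *v x) < 1}" using Delta_norm by auto
  have "\<Delta> = (\<lambda>x. P *v x) -` ball 0 1" by (auto simp: P)
  then show ?thesis using convex_linear_vimage[OF matrix_vector_mul_linear convex_ball] by metis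
qed

lemma Delta_open: "open \<Delta>"
proof -
  obtain P :: "real^'n^'n" where P: "\<Delta> = {x. norm (P *v x) < 1}" using Delta_norm by auto
  have "continuous_on UNIV (\<lambda>x. norm (P *v x))"
    by (intro continuous_on_norm linear_continuous_on matrix_vector_mul_bounded_linear)
  from open_Collect_less[OF this continuous_on_const] show ?thesis unfolding P by simp
qed

lemma Delta_bounded: "bounded \<Delta>"
proof -
  obtain P :: "real^'n^'n" where P: "invertible P" "\<Delta> = {x. norm (P *v x) < 1}" using Delta_norm by auto
  obtain Q where Q: "Q ** P = mat 1" using P(1) by (auto simp: invertible_def)
  have "\<Delta> \<subseteq> (\<lambda>x. Q *v x) ` ball 0 1"
  proof
    fix x assume "x \<in> \<Delta>"
    then have "P *v x \<in> ball 0 1" by (simp add: P)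
    moreover have "x = Q *v (P *v x)" by (simp add: matrix_vector_mul_assoc Q)
    ultimately show "x \<in> (\<lambda>x. Q *v x) ` ball 0 1" by blast
  qed
  then show ?thesis
    using bounded_linear_image[OF bounded_ball matrix_vector_mul_bounded_linear] bounded_subset by metis
qed

lemma Delta_lmeasurable: "\<Delta> \<in> lmeasurable"
proof (rule fmeasurableI)
  show "\<Delta> \<in> sets lebesgue" using Delta_open by (metis borel_open sets_completionI_sets sets_lborel)
  show "emeasure lebesgue \<Delta> < \<infinity>" by (simp add: vol del: emeasure_completion)
qed

lemma measure_Delta: "measure lebesgue \<Delta> = 1"
  using vol by (simp add: measure_def del: emeasure_completion)

lemma measure_image_Delta:
  fixes X :: "real^'n^'n"
  shows "(\<lambda>x. X *v x) ` \<Delta> \<in> lmeasurable" "measure lebesgue ((\<lambda>x. X *v x) ` \<Delta>) = \<bar>det X\<bar>"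
  using measure_matrix_image[OF matrix_vector_mul_linear Delta_lmeasurable, of X] measure_Delta
  by simp_all

text \<open>
  Comparing volumes in \<open>r\<^sub>0 \<Delta> \<subseteq> A \<Delta>\<close>.
\<close>

lemma dil_gt_1: "1 < dil A"
proof -
  have eq: "(\<lambda>x. r0 *\<^sub>R x) ` \<Delta> = (\<lambda>x. (r0 *\<^sub>R mat 1) *v x) ` \<Delta>"
    by (simp add: scaleR_matrix_vector_assoc[symmetric])
  have "measure lebesgue ((\<lambda>x. r0 *\<^sub>R x) ` \<Delta>) \<le> measure lebesgue ((\<lambda>x. A *v x) ` \<Delta>)"
    using measure_image_Delta unfolding eq by (intro measure_mono_fmeasurable[OF sub[unfolded eq]]) auto
  then have "\<bar>det (r0 *\<^sub>R mat 1 :: real^'n^'n)\<bar> \<le> dil A"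
    unfolding eq measure_image_Delta dil_def .
  moreover have "det (r0 *\<^sub>R mat 1 :: real^'n^'n) = r0 ^ CARD('n)"
  proof -
    have "(r0 *\<^sub>R mat 1 :: real^'n^'n) = (\<chi> i. r0 *s row i (mat 1))"
      by (simp add: vec_eq_iff row_def mat_def)
    then show ?thesis
      using det_rows_mul[of "\<lambda>_. r0" "\<lambda>i. row i (mat 1 :: real^'n^'n)"]
      by (simp add: row_def vec_lambda_eta)
  qed
  moreover have "1 < r0 ^ CARD('n)" using r0 by (intro one_less_power) auto
  ultimately show ?thesis by simp
qed

lemma A_inv: "A ** matrix_inv A = mat 1" "matrix_inv A ** A = mat 1"
  using matrix_inv_inverse[of A] dil_gt_1 by (auto simp: dil_def)

definition M :: "int \<Rightarrow> real^'n^'n" where "M k = mat_powi A k"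

lemma M_0: "M 0 = mat 1" by (simp add: M_def mat_powi_def)

lemma M_Suc_left: "M (k + 1) = A ** M k"
proof (cases "0 \<le> k")
  case True
  then have "nat (k + 1) = Suc (nat k)" by simp
  with True show ?thesis by (simp add: M_def mat_powi_def)
next
  case False
  then have k: "nat (- k) = Suc (nat (- (k + 1)))" by simp
  have "M k = matrix_inv A ** M (k + 1)"
  proof (cases "k + 1 = 0")
    case True
    then have "k = - 1" by simp
    then show ?thesis by (simp add: M_def mat_powi_def)
  next
    case k1: False
    with False k show ?thesis by (simp add: M_def mat_powi_def)
  qed
  then show ?thesis by (simp add: matrix_mul_assoc A_inv)
qed

lemma A_commutes_M: "M k ** A = A ** M k"
proof -
  have "((\<lambda>X. matrix_inv A ** X) ^^ n) (mat 1) ** A = A ** ((\<lambda>X. matrix_inv A ** X) ^^ n) (mat 1)" for n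
  proof (induction n)
    case (Suc n)
    then have "((\<lambda>X. matrix_inv A ** X) ^^ Suc n) (mat 1) ** A
        = (matrix_inv A ** A) ** ((\<lambda>X. matrix_inv A ** X) ^^ n) (mat 1)"
      by (simp add: matrix_mul_assoc[symmetric])
    also have "\<dots> = (A ** matrix_inv A) ** ((\<lambda>X. matrix_inv A ** X) ^^ n) (mat 1)"
      by (simp add: A_inv)
    finally show ?case by (simp add: matrix_mul_assoc)
  qed simp
  then show ?thesis unfolding M_def mat_powi_def by (simp add: funpow_matrix_commute)
qed

lemma M_add_nat: "M (k + int n) = M k ** M (int n)"
proof (induction n)
  case (Suc n)
  have "M (k + int (Suc n)) = A ** M (k + int n)"
    using M_Suc_left[of "k + int n"] by (simp add: add.commute add.left_commute)
  also have "\<dots> = M k ** (A ** M (int n))"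
    by (simp add: Suc matrix_mul_assoc A_commutes_M)
  also have "A ** M (int n) = M (int (Suc n))"
    using M_Suc_left[of "int n"] by (simp add: add.commute)
  finally show ?case .
qed (simp add: M_0)

lemma det_M: "\<bar>det (M k)\<bar> = dil A powi k"
proof -
  have "det (matrix_inv A) = inverse (det A)"
    using A_inv(1) by (metis det_I det_mul inverse_unique)
  then show ?thesis
    by (simp add: M_def mat_powi_def det_funpow_matrix power_int_def dil_def power_abs power_inverse abs_inverse)
qed

lemma det_M_ne_0: "det (M k) \<noteq> 0"
  using det_M[of k] dil_gt_1 by auto

abbreviation "B k \<equiv> Bk A \<Delta> k"

lemma B_M: "B k = (\<lambda>x. M k *v x) ` \<Delta>"
  by (simp add: Bk_def M_def)

lemma B_0: "B 0 = \<Delta>" by (simp add: B_M M_0)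

lemma B_expand: "x \<in> B k \<Longrightarrow> r0 *\<^sub>R x \<in> B (k + 1)"
proof -
  assume "x \<in> B k"
  then obtain d where d: "x = M k *v d" "d \<in> \<Delta>" by (auto simp: B_M)
  then obtain e where e: "r0 *\<^sub>R d = A *v e" "e \<in> \<Delta>" using sub by blast
  have "r0 *\<^sub>R x = M k *v (A *v e)" unfolding d(1) e(1)[symmetric]
    by (rule linear_scale[OF matrix_vector_mul_linear, symmetric])
  also have "\<dots> = M (k + 1) *v e" by (simp add: matrix_vector_mul_assoc A_commutes_M M_Suc_left)
  finally show ?thesis using e(2) by (auto simp: B_M)
qed

lemma B_expand_power: "x \<in> B k \<Longrightarrow> r0 ^ j *\<^sub>R x \<in> B (k + int j)"
proof (induction j)
  case (Suc j)
  from B_expand[OF Suc.IH[OF Suc.prems]] show ?case by (simp add: add.commute add.left_commute)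
qed simp

lemma B_convex: "convex (B k)"
  unfolding B_M by (intro convex_linear_image matrix_vector_mul_linear Delta_convex)

lemma B_contains_0: "0 \<in> B k"
  using Delta_zero unfolding B_M by (intro image_eqI[of _ _ 0]) auto

lemma B_shrink: "x \<in> B k \<Longrightarrow> 0 \<le> c \<Longrightarrow> c \<le> 1 \<Longrightarrow> c *\<^sub>R x \<in> B k"
  using convexD_alt[OF B_convex B_contains_0, of x k c] by simp

lemma B_mono1: "B k \<subseteq> B (k + 1)"
proof
  fix x assume "x \<in> B k"
  from B_shrink[OF B_expand[OF this], of "inverse r0"] show "x \<in> B (k + 1)"
    using r0 by (simp add: inverse_le_1_iff)
qed

lemma B_mono: "k \<le> l \<Longrightarrow> B k \<subseteq> B l"
proof (induction l rule: int_ge_induct)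
  case (step l)
  then show ?case using B_mono1[of l] by blast
qed simp

text \<open>
  With \<open>r\<^sub>0\<^sup>\<tau> > 2\<close> the sum of two balls of level \<open>k\<close> lies in the ball of level \<open>k + \<tau>\<close>, by
  convexity.
\<close>

definition tau :: nat where "tau = (SOME n. 2 < r0 ^ n)"

lemma tau: "2 < r0 ^ tau"
  unfolding tau_def by (rule someI_ex[OF real_arch_pow[OF r0]])

lemma B_add: 
  assumes "x \<in> B k" "y \<in> B k"
  shows "x + y \<in> B (k + int tau)"
proof -
  have "(1 / 2) *\<^sub>R x + (1 / 2) *\<^sub>R y \<in> B k"
    using assms by (intro convexD[OF B_convex]) auto
  from B_shrink[OF B_expand_power[OF this, of tau], of "2 / r0 ^ tau"]
  have "(2 / r0 ^ tau) *\<^sub>R r0 ^ tau *\<^sub>R ((1 / 2) *\<^sub>R x + (1 / 2) *\<^sub>R y) \<in> B (k + int tau)"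
    using tau by simp
  also have "(2 / r0 ^ tau) *\<^sub>R r0 ^ tau *\<^sub>R ((1 / 2) *\<^sub>R x + (1 / 2) *\<^sub>R y) = x + y"
    using r0 by (simp add: scaleR_add_right)
  finally show ?thesis .
qed

lemma B_in_open:
  assumes "open V" "0 \<in> V"
  shows "\<exists>k. B k \<subseteq> V"
proof -
  obtain e where e: "0 < e" "ball 0 e \<subseteq> V" using assms openE by blast
  obtain R where R: "0 < R" "\<And>x. x \<in> \<Delta> \<Longrightarrow> norm x \<le> R"
    using Delta_bounded by (auto simp: bounded_pos)
  obtain j where j: "R / e < r0 ^ j" using real_arch_pow[OF r0] by blast
  have "B (- int j) \<subseteq> ball 0 e"
  proof
    fix x assume "x \<in> B (- int j)"
    from B_expand_power[OF this, of j] have "r0 ^ j *\<^sub>R x \<in> \<Delta>" by (simp add: B_0)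
    from R(2)[OF this] have "r0 ^ j * norm x \<le> R" using r0 by simp
    also have "R < r0 ^ j * e" using j e(1) by (simp add: pos_divide_less_eq)
    finally show "x \<in> ball 0 e" using r0 by simp
  qed
  then show ?thesis using e(2) by blast
qed

lemma B_covers: "\<exists>k. x \<in> B k"
proof -
  obtain e where e: "0 < e" "ball 0 e \<subseteq> \<Delta>" using Delta_open Delta_zero openE by blast
  obtain j where j: "norm x / e < r0 ^ j" using real_arch_pow[OF r0] by blast
  have "norm (inverse (r0 ^ j) *\<^sub>R x) < e"
    using j r0 e(1) by (simp add: field_simps)
  then have "inverse (r0 ^ j) *\<^sub>R x \<in> B 0" using e(2) by (auto simp: B_0)
  from B_expand_power[OF this, of j] have "x \<in> B (int j)" using r0 by simp
  then show ?thesis by blast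
qed

lemma surj_M: "surj (\<lambda>x. M k *v x)"
  using det_M_ne_0[of k] det_nz_iff_inj[of "\<lambda>x. M k *v x"]
  by (simp add: linear_injective_imp_surjective)

sublocale dilated_balls B "dil A" "int tau"
proof
  show "1 < dil A" by (rule dil_gt_1)
  show "open (B k)" for k
    unfolding B_M by (rule open_surjective_linear_image[OF Delta_open matrix_vector_mul_linear surj_M])
  show "- x \<in> B k" if "x \<in> B k" for x k
    using that Delta_sym unfolding B_M by (auto simp: vec.neg[symmetric])
  show "emeasure lebesgue (B k) = ennreal (dil A powi k)" for k
    using measure_image_Delta[of "M k"]
    by (simp add: B_M emeasure_eq_measure2 det_M del: emeasure_completion)
qed (use B_contains_0 B_mono B_add B_in_open B_covers in auto)

text \<open>
  The cells are the images under \<open>A\<^sup>k\<close> of a cubic grid that is fine enough for a cell to fit into a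
  translate of \<open>\<Delta>\<close>.
\<close>

definition mesh :: real where
  "mesh = (SOME c. 0 < c \<and> (\<forall>u. (\<forall>i. \<bar>u $ i\<bar> \<le> c) \<longrightarrow> u \<in> \<Delta>))"

lemma mesh: "0 < mesh" "(\<And>i. \<bar>u $ i\<bar> \<le> mesh) \<Longrightarrow> u \<in> \<Delta>"
proof -
  obtain e where e: "0 < e" "ball 0 e \<subseteq> \<Delta>" using Delta_open Delta_zero openE by blast
  have "u \<in> \<Delta>" if u: "\<And>i. \<bar>u $ i\<bar> \<le> e / (2 * CARD('n))" for u :: "real^'n"
  proof -
    have "norm u \<le> (\<Sum>i\<in>UNIV. \<bar>u $ i\<bar>)" by (rule norm_le_l1_cart)
    also have "\<dots> \<le> (\<Sum>i\<in>(UNIV :: 'n set). e / (2 * CARD('n)))" by (intro sum_mono u)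
    also have "\<dots> < e" using e(1) by simp
    finally show ?thesis using e(2) by auto
  qed
  moreover have "0 < e / (2 * CARD('n))" using e(1) by simp
  ultimately have "\<exists>c. 0 < c \<and> (\<forall>u. (\<forall>i. \<bar>u $ i\<bar> \<le> c) \<longrightarrow> u \<in> \<Delta>)" by blast
  from someI_ex[OF this] show "0 < mesh" "(\<And>i. \<bar>u $ i\<bar> \<le> mesh) \<Longrightarrow> u \<in> \<Delta>"
    unfolding mesh_def by auto
qed

definition cell :: "int \<Rightarrow> real^'n \<Rightarrow> int^'n" where
  "cell k y = (\<chi> i. \<lfloor>(matrix_inv (M k) *v y) $ i / mesh\<rfloor>)"

definition ctr :: "int \<Rightarrow> int^'n \<Rightarrow> real^'n" where
  "ctr k z = M k *v (\<chi> i. mesh * real_of_int (z $ i))"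

lemma M_inv_cancel: "M k *v (matrix_inv (M k) *v y) = y" "matrix_inv (M k) *v (M k *v y) = y"
  using matrix_inv_inverse[OF det_M_ne_0[of k]] by (simp_all add: matrix_vector_mul_assoc)

lemma minus_ctr: "y - ctr k z = M k *v (matrix_inv (M k) *v y - (\<chi> i. mesh * real_of_int (z $ i)))"
  unfolding ctr_def by (simp add: matrix_vector_mult_diff_distrib M_inv_cancel)

lemma cell_near: "y - ctr k (cell k y) \<in> B k"
proof -
  define u where "u = matrix_inv (M k) *v y"
  have "\<bar>u $ i - mesh * real_of_int \<lfloor>u $ i / mesh\<rfloor>\<bar> \<le> mesh" for i
  proof -
    have fl: "real_of_int \<lfloor>u $ i / mesh\<rfloor> \<le> u $ i / mesh" "u $ i / mesh \<le> real_of_int \<lfloor>u $ i / mesh\<rfloor> + 1"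
      by linarith+
    have "mesh * (u $ i / mesh) = u $ i" using mesh(1) by simp
    then have "mesh * real_of_int \<lfloor>u $ i / mesh\<rfloor> \<le> u $ i" "u $ i \<le> mesh * (real_of_int \<lfloor>u $ i / mesh\<rfloor> + 1)"
      using mult_left_mono[OF fl(1), of mesh] mult_left_mono[OF fl(2), of mesh] mesh(1) by simp_all
    then show ?thesis using mesh(1) by (simp add: abs_le_iff algebra_simps)
  qed
  then have "u - (\<chi> i. mesh * real_of_int (cell k y $ i)) \<in> \<Delta>"
    by (intro mesh(2)) (simp add: cell_def u_def)
  then show ?thesis unfolding minus_ctr B_M u_def by blast
qed

lemma cell_sets: "{y. cell k y = z} \<in> sets lebesgue"
proof -
  have lin: "(\<lambda>y. (matrix_inv (M k) *v y) $ i) \<in> borel_measurable borel" for i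
    by (intro borel_measurable_continuous_onI continuous_intros linear_continuous_on matrix_vector_mul_bounded_linear)
  have "{y. cell k y = z} = (\<Inter>i\<in>UNIV. {y. real_of_int (z $ i) \<le> (matrix_inv (M k) *v y) $ i / mesh
      \<and> (matrix_inv (M k) *v y) $ i / mesh < real_of_int (z $ i) + 1})"
    unfolding cell_def vec_eq_iff by (auto simp: floor_eq_iff)
  also have "\<dots> \<in> sets borel"
  proof (intro sets.finite_INT)
    fix i
    note [measurable] = lin[of i]
    have "{y \<in> space borel. real_of_int (z $ i) \<le> (matrix_inv (M k) *v y) $ i / mesh
      \<and> (matrix_inv (M k) *v y) $ i / mesh < real_of_int (z $ i) + 1} \<in> sets borel" by measurable
    then show "{y. real_of_int (z $ i) \<le> (matrix_inv (M k) *v y) $ i / mesh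
      \<and> (matrix_inv (M k) *v y) $ i / mesh < real_of_int (z $ i) + 1} \<in> sets borel" by simp
  qed auto
  finally show ?thesis by (metis sets_completionI_sets sets_lborel)
qed

definition spread :: int where
  "spread = (SOME K. 0 \<le> K \<and> (\<forall>u\<in>B (int tau). \<forall>i. \<bar>u $ i\<bar> \<le> mesh * (real_of_int K - 1)))"

lemma spread: "0 \<le> spread" "u \<in> B (int tau) \<Longrightarrow> \<bar>u $ i\<bar> \<le> mesh * (real_of_int spread - 1)"
proof -
  have "bounded (B (int tau))"
    unfolding B_M by (intro bounded_linear_image Delta_bounded matrix_vector_mul_bounded_linear)
  then obtain R where R: "0 < R" "\<And>u. u \<in> B (int tau) \<Longrightarrow> norm u \<le> R" by (auto simp: bounded_pos)
  define K where "K = \<lceil>R / mesh\<rceil> + 1"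
  have K: "R \<le> mesh * (real_of_int K - 1)"
    using mesh(1) mult_left_mono[OF le_of_int_ceiling[of "R / mesh"], of mesh] by (simp add: K_def)
  have "0 \<le> K \<and> (\<forall>u\<in>B (int tau). \<forall>i. \<bar>u $ i\<bar> \<le> mesh * (real_of_int K - 1))"
  proof (intro conjI ballI allI)
    show "0 \<le> K" using R(1) mesh(1) by (simp add: K_def) (smt (verit) divide_pos_pos zero_le_ceiling)
    fix u i assume "u \<in> B (int tau)"
    then show "\<bar>u $ i\<bar> \<le> mesh * (real_of_int K - 1)"
      using R(2)[of u] component_le_norm_cart[of u i] K by linarith
  qed
  then have "\<exists>K. 0 \<le> K \<and> (\<forall>u\<in>B (int tau). \<forall>i. \<bar>u $ i\<bar> \<le> mesh * (real_of_int K - 1))" by blast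
  from someI_ex[OF this] show "0 \<le> spread" "u \<in> B (int tau) \<Longrightarrow> \<bar>u $ i\<bar> \<le> mesh * (real_of_int spread - 1)"
    unfolding spread_def by auto
qed

lemma cell_count_bound:
  "finite {z. x - ctr k z \<in> B (k + int tau)} \<and>
   card {z. x - ctr k z \<in> B (k + int tau)} \<le> nat (2 * spread + 1) ^ CARD('n)"
proof -
  define a where "a i = \<lfloor>(matrix_inv (M k) *v x) $ i / mesh\<rfloor>" for i
  let ?S = "PiE UNIV (\<lambda>i. {a i - spread..a i + spread})"
  have sub: "{z. x - ctr k z \<in> B (k + int tau)} \<subseteq> (\<lambda>f. \<chi> i. f i) ` ?S"
  proof
    fix z assume "z \<in> {z. x - ctr k z \<in> B (k + int tau)}"
    then obtain d where d: "x - ctr k z = M (k + int tau) *v d" "d \<in> \<Delta>" by (auto simp: B_M)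
    define u where "u = matrix_inv (M k) *v x - (\<chi> i. mesh * real_of_int (z $ i))"
    have "M k *v u = M k *v (M (int tau) *v d)"
      using d(1) unfolding minus_ctr u_def by (simp add: M_add_nat matrix_vector_mul_assoc)
    then have "u = M (int tau) *v d" by (metis M_inv_cancel(2))
    then have uB: "u \<in> B (int tau)" using d(2) by (auto simp: B_M)
    have "z $ i \<in> {a i - spread..a i + spread}" for i
    proof -
      define v where "v = (matrix_inv (M k) *v x) $ i / mesh"
      have "\<bar>v - real_of_int (z $ i)\<bar> * mesh = \<bar>u $ i\<bar>"
      proof -
        have "\<bar>v - real_of_int (z $ i)\<bar> * mesh = \<bar>(v - real_of_int (z $ i)) * mesh\<bar>"
          using mesh(1) by (simp add: abs_mult)
        also have "(v - real_of_int (z $ i)) * mesh = u $ i"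
          using mesh(1) by (simp add: v_def u_def left_diff_distrib)
        finally show ?thesis .
      qed
      also have "\<dots> \<le> (real_of_int spread - 1) * mesh" using spread(2)[OF uB, of i] by (simp add: mult.commute)
      finally have "\<bar>v - real_of_int (z $ i)\<bar> \<le> real_of_int spread - 1" using mesh(1) by simp
      then show ?thesis unfolding a_def v_def[symmetric] by simp linarith
    qed
    then have "(\<lambda>i. z $ i) \<in> ?S" by (auto simp: PiE_iff)
    then show "z \<in> (\<lambda>f. \<chi> i. f i) ` ?S" by (intro image_eqI[of _ _ "\<lambda>i. z $ i"]) (auto simp: vec_eq_iff)
  qed
  have fin: "finite ?S" by (intro finite_PiE) auto
  have "card ((\<lambda>f. (\<chi> i. f i) :: int^'n) ` ?S) \<le> card ?S" using fin by (rule card_image_le)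
  also have "card ?S = nat (2 * spread + 1) ^ CARD('n)" by (subst card_PiE) auto
  finally show ?thesis using sub fin by (meson card_mono finite_imageI finite_subset order_trans)
qed

sublocale gridded_balls B "dil A" "int tau" cell ctr "nat (2 * spread + 1) ^ CARD('n)"
  using cell_sets cell_near cell_count_bound by unfold_locales auto

lemma qnorm_shell:
  assumes "x \<noteq> 0"
  shows "\<exists>k. x \<in> B (k + 1) \<and> x \<notin> B k \<and> qnorm A \<Delta> x = dil A powi k"
proof -
  obtain k1 where k1: "x \<in> B k1" using B_covers by blast
  obtain k0 where k0: "B k0 \<subseteq> - {x}" using B_in_open[of "- {x}"] assms by auto
  have up: "x \<in> B l \<Longrightarrow> l \<le> l' \<Longrightarrow> x \<in> B l'" for l l' using B_mono by blast
  have lt: "k0 < k1" using k0 k1 B_mono[of k1 k0] by force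
  have "\<exists>n. x \<in> B (k0 + int n)" using k1 lt by (intro exI[of _ "nat (k1 - k0)"]) simp
  then obtain n where n: "x \<in> B (k0 + int n)" "\<And>j. j < n \<Longrightarrow> x \<notin> B (k0 + int j)"
    using exists_least_iff[of "\<lambda>n. x \<in> B (k0 + int n)"] by auto
  have "n \<noteq> 0" using n(1) k0 by (intro notI) auto
  define k where "k = k0 + int (n - 1)"
  have k: "x \<in> B (k + 1)" "x \<notin> B k"
    using n(1) n(2)[of "n - 1"] \<open>n \<noteq> 0\<close> by (auto simp: k_def algebra_simps)
  have shell: "x \<in> B (l + 1) - B l \<longleftrightarrow> l = k" for l
    using k up[of "l + 1" k] up[of "k + 1" l] by (metis DiffD1 DiffD2 DiffI linorder_cases zless_imp_add1_zle)
  have "(\<Sum>\<^sub>\<infinity>l\<in>UNIV. dil A powi l * indicator (B (l + 1) - B l) x)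
      = (\<Sum>\<^sub>\<infinity>l\<in>{k}. dil A powi l * indicator (B (l + 1) - B l) x)"
    by (intro infsum_cong_neutral) (use shell in \<open>auto simp: indicator_def\<close>)
  also have "\<dots> = dil A powi k" using k by simp
  finally show ?thesis using k assms by (auto simp: qnorm_def)
qed

lemma qnorm_pos: "x \<noteq> 0 \<Longrightarrow> 0 < qnorm A \<Delta> x"
  using qnorm_shell[of x] by auto

lemma qnorm_le:
  assumes "x \<in> B k"
  shows "qnorm A \<Delta> x \<le> dil A powi k"
proof (cases "x = 0")
  case False
  then obtain l where l: "x \<notin> B l" "qnorm A \<Delta> x = dil A powi l" using qnorm_shell by blast
  have "l \<le> k" using l(1) assms B_mono[of k l] by (metis linear subsetD)
  then show ?thesis using b_powi_mono l(2) by simp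
qed (simp add: qnorm_def)

lemma qnorm_less_imp:
  assumes "qnorm A \<Delta> x < dil A powi k"
  shows "x \<in> B k"
proof (cases "x = 0")
  case False
  then obtain l where l: "x \<in> B (l + 1)" "qnorm A \<Delta> x = dil A powi l" using qnorm_shell by blast
  have "l < k"
  proof (rule ccontr)
    assume "\<not> ?thesis"
    then have "dil A powi k \<le> dil A powi l" by (intro b_powi_mono) simp
    with l(2) assms show False by simp
  qed
  then show ?thesis using l(1) B_mono[of "l + 1" k] by auto
qed (simp add: B_contains_0)

end

section \<open>Exponents and the size of the stopping sets\<close>

lemma ennpowr_ennreal: "0 \<le> x \<Longrightarrow> ennpowr (ennreal x) r = ennreal (x powr r)"
  by (simp add: ennpowr_def)

lemma ennpowr_top [simp]: "ennpowr \<infinity> r = \<infinity>"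
  by (simp add: ennpowr_def)

lemma ennpowr_0 [simp]: "ennpowr 0 r = 0"
  by (simp add: ennpowr_def)

lemma ennpowr_ennpowr: "ennpowr (ennpowr x a) c = ennpowr x (a * c)"
proof (cases x)
  case (real r)
  then show ?thesis by (simp add: ennpowr_ennreal powr_powr)
qed (simp add: ennpowr_top[unfolded infinity_ennreal_def])

lemma ennpowr_mono:
  assumes "x \<le> y" "0 \<le> r"
  shows "ennpowr x r \<le> ennpowr y r"
proof (cases y)
  case (real s)
  then obtain r' where "x = ennreal r'" "0 \<le> r'" using assms(1) by (cases x) (auto simp: top_unique)
  then show ?thesis using real assms by (simp add: ennpowr_ennreal powr_mono2)
qed (simp add: ennpowr_top[unfolded infinity_ennreal_def])

lemma ennpowr_mult:
  assumes "0 \<le> a" "0 < r" 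
  shows "ennpowr (ennreal a * x) r = ennreal (a powr r) * ennpowr x r"
proof (cases x)
  case (real s)
  then show ?thesis using assms(1)
    by (simp add: ennreal_mult[symmetric] ennpowr_ennreal powr_mult)
next
  case top
  show ?thesis
  proof (cases "a = 0")
    case False
    then have "ennreal a * top = top" "ennreal (a powr r) * top = top"
      using assms(1) by (auto simp: ennreal_mult_eq_top_iff)
    then show ?thesis using top by (simp add: ennpowr_top[unfolded infinity_ennreal_def])
  qed (simp add: top)
qed

lemma ennpowr_1 [simp]: "ennpowr x 1 = x"
  by (cases x) (auto simp: ennpowr_ennreal ennpowr_top[unfolded infinity_ennreal_def])

lemma ennpowr_measurable [measurable]:
  assumes "f \<in> borel_measurable M" "g \<in> borel_measurable M"
  shows "(\<lambda>x. ennpowr (f x) (g x)) \<in> borel_measurable M"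
  using assms unfolding ennpowr_def by measurable

lemma geometric_int_sum:
  assumes q: "0 < q"
  shows "(\<integral>\<^sup>+i. ennreal (2 powr (real_of_int i * q)) * indicator {..K} i \<partial>count_space UNIV)
    = ennreal (2 powr (real_of_int K * q) / (1 - 2 powr (- q)))"
proof -
  have bij: "bij_betw (\<lambda>n. K - int n) UNIV {..K}"
    by (rule bij_betw_byWitness[where f' = "\<lambda>i. nat (K - i)"]) auto
  have a: "2 powr (- q) < 1" "0 \<le> 2 powr (- q)" using q by (auto simp: powr_less_one)
  have trm: "2 powr (real_of_int (K - int n) * q) = 2 powr (real_of_int K * q) * (2 powr (- q)) ^ n" for n
    by (simp add: powr_realpow[symmetric] powr_powr powr_add[symmetric] algebra_simps)
  have "(\<integral>\<^sup>+i. ennreal (2 powr (real_of_int i * q)) * indicator {..K} i \<partial>count_space UNIV)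
      = (\<integral>\<^sup>+i. ennreal (2 powr (real_of_int i * q)) \<partial>count_space {..K})"
    by (rule nn_integral_count_space_indicator[symmetric]) simp
  also have "\<dots> = (\<integral>\<^sup>+n. ennreal (2 powr (real_of_int (K - int n) * q)) \<partial>count_space UNIV)"
    by (rule nn_integral_bij_count_space[OF bij, symmetric])
  also have "\<dots> = (\<Sum>n. ennreal (2 powr (real_of_int K * q) * (2 powr (- q)) ^ n))"
    by (simp only: nn_integral_count_space_nat trm)
  also have "\<dots> = ennreal (2 powr (real_of_int K * q) * (1 / (1 - 2 powr (- q))))"
    using a by (intro suminf_ennreal_eq sums_mult geometric_sums) auto
  finally show ?thesis by simp
qed

lemma int_set_max:
  fixes I :: "int set"
  assumes "i0 \<in> I" "\<And>i. i \<in> I \<Longrightarrow> i \<le> n"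
  shows "\<exists>K\<in>I. \<forall>i\<in>I. i \<le> K"
proof -
  let ?J = "{i \<in> I. i0 \<le> i}"
  have fin: "finite ?J" using assms(2) by (intro finite_subset[of ?J "{i0..n}"]) auto
  have ne: "?J \<noteq> {}" using assms(1) by auto
  have "Max ?J \<in> ?J" using Max_in[OF fin ne] .
  moreover have "i \<le> Max ?J" if "i \<in> I" for i
  proof (cases "i0 \<le> i")
    case True then show ?thesis using that fin by (intro Max_ge) auto
  next
    case False then show ?thesis using \<open>Max ?J \<in> ?J\<close> by auto
  qed
  ultimately show ?thesis by blast
qed

lemma powi_4_eq: "(4::real) powi i = (2 powr real_of_int i) powr 2"
proof -
  have "(4::real) powi i = (2 powr 2) powr real_of_int i" by (simp add: powr_real_of_int')
  then show ?thesis by (simp only: powr_powr mult.commute)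
qed

lemma ennpowr_area_lower:
  assumes "ennreal (4 powi i) < s" "0 < p"
  shows "ennreal (2 powr (real_of_int i * p)) \<le> ennpowr s (p / 2)"
proof -
  have "ennreal (2 powr (real_of_int i * p)) = ennpowr (ennreal (4 powi i)) (p / 2)"
    by (simp add: ennpowr_ennreal powi_4_eq powr_powr)
  also have "\<dots> \<le> ennpowr s (p / 2)"
    using assms by (intro ennpowr_mono) auto
  finally show ?thesis .
qed

text \<open>
  The sum is geometric and ends at the last \<open>i\<close> with \<open>4\<^sup>i < s\<close>.
\<close>

lemma level_sum_bound:
  assumes pm: "0 < pm" "pm \<le> p"
  shows "(\<integral>\<^sup>+i. ennreal (2 powr (real_of_int i * p)) * indicator {i. ennreal (4 powi i) < s} i \<partial>count_space UNIV)
    \<le> ennreal (1 / (1 - 2 powr (- pm))) * ennpowr s (p / 2)"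
proof (cases "s = \<infinity>")
  case True
  have "0 < 1 / (1 - 2 powr (- pm))" using pm by (simp add: powr_less_one)
  then have "ennreal (1 / (1 - 2 powr (- pm))) * ennpowr s (p / 2) = \<infinity>"
    using True pm by (simp add: ennreal_mult_eq_top_iff ennpowr_top[unfolded infinity_ennreal_def])
  then show ?thesis by simp
next
  case False
  then obtain r where r: "s = ennreal r" "0 \<le> r" by (cases s) auto
  let ?I = "{i. ennreal (4 powi i) < s}"
  show ?thesis
  proof (cases "?I = {}")
    case True
    then show ?thesis by (simp only: True) simp
  next
    case ne: False
    then obtain i0 where i0: "i0 \<in> ?I" by blast
    obtain n where n: "r < 4 ^ n" using real_arch_pow[of 4 r] by auto
    have "i \<le> int n" if "i \<in> ?I" for i
    proof (rule ccontr)
      assume "\<not> ?thesis"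
      then have "(4::real) powi int n \<le> 4 powi i" by (intro power_int_increasing) auto
      moreover have "4 powi i < r" using that r by (simp add: ennreal_less_iff)
      ultimately show False using n by simp
    qed
    from int_set_max[OF i0 this] obtain K where K: "K \<in> ?I" "\<And>i. i \<in> ?I \<Longrightarrow> i \<le> K" by blast
    have mono: "1 - 2 powr (- pm) \<le> 1 - 2 powr (- p)" "0 < 1 - 2 powr (- pm)"
      using pm by (auto simp: powr_less_one)
    have "(\<integral>\<^sup>+i. ennreal (2 powr (real_of_int i * p)) * indicator ?I i \<partial>count_space UNIV)
        \<le> (\<integral>\<^sup>+i. ennreal (2 powr (real_of_int i * p)) * indicator {..K} i \<partial>count_space UNIV)"
      using K(2) by (intro nn_integral_mono mult_left_mono) (auto simp: indicator_def)
    also have "\<dots> = ennreal (2 powr (real_of_int K * p) / (1 - 2 powr (- p)))"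
      using pm by (intro geometric_int_sum) simp
    also have "\<dots> \<le> ennreal (2 powr (real_of_int K * p) / (1 - 2 powr (- pm)))"
      using mono less_le_trans[OF mono(2,1)] by (intro ennreal_leI divide_left_mono mult_pos_pos) auto
    also have "\<dots> = ennreal (1 / (1 - 2 powr (- pm))) * ennreal (2 powr (real_of_int K * p))"
      using mono by (subst ennreal_mult[symmetric]) auto
    also have "\<dots> \<le> ennreal (1 / (1 - 2 powr (- pm))) * ennpowr s (p / 2)"
      using K(1) pm by (intro mult_left_mono ennpowr_area_lower) auto
    finally show ?thesis .
  qed
qed

lemma min_le_powr:
  fixes a z d :: real
  assumes "0 < a" "0 < z" "0 \<le> d" "d \<le> 1"
  shows "min a z \<le> a powr d * z powr (1 - d)"
proof (cases "a \<le> z")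
  case True
  have "a = a powr d * a powr (1 - d)"
    using assms unfolding powr_add[symmetric] by simp
  also have "\<dots> \<le> a powr d * z powr (1 - d)" using True assms by (intro mult_left_mono powr_mono2) auto
  finally show ?thesis using True by simp
next
  case False
  have "z = z powr d * z powr (1 - d)"
    using assms unfolding powr_add[symmetric] by simp
  also have "\<dots> \<le> a powr d * z powr (1 - d)" using False assms by (intro mult_right_mono powr_mono2) auto
  finally show ?thesis using False by simp
qed

text \<open>
  The exponent as a real function, with the two log-Hoelder conditions; of \<open>\<rho>\<close> only the
  comparison with the balls matters.
\<close>

locale log_holder_exponent = dilated_balls B b \<tau>
  for B :: "int \<Rightarrow> (real^'n) set" and b :: real and \<tau> :: int +
  fixes \<rho> :: "real^'n \<Rightarrow> real" and p :: "real^'n \<Rightarrow> real" and pm pp cl ci pinf :: real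
  assumes rho_pos: "x \<noteq> 0 \<Longrightarrow> 0 < \<rho> x"
    and rho_le: "x \<in> B k \<Longrightarrow> \<rho> x \<le> b powi k"
    and rho_less: "\<rho> x < b powi k \<Longrightarrow> x \<in> B k"
    and p_meas [measurable]: "p \<in> borel_measurable lebesgue"
    and pm_pos: "0 < pm" and pm_le_pp: "pm \<le> pp"
    and p_bounds: "AE x in lebesgue. pm \<le> p x \<and> p x \<le> pp"
    and p_pos: "0 < p x"
    and log_local: "\<bar>p x - p y\<bar> \<le> cl / ln (exp 1 + 1 / \<rho> (x - y))"
    and log_decay: "\<bar>p x - pinf\<bar> \<le> ci / ln (exp 1 + \<rho> x)"
    and cl_pos: "0 < cl" and ci_pos: "0 < ci"
begin

definition weight :: "int \<Rightarrow> real^'n \<Rightarrow> ennreal" where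
  "weight i x = ennreal (2 powr (real_of_int i * p x))"

lemma weight_measurable [measurable]: "weight i \<in> borel_measurable lebesgue"
  unfolding weight_def by measurable

lemma ball_scale:
  assumes "0 < s"
  shows "\<exists>k. s < b powi k \<and> b powi k \<le> b * s"
proof -
  define k where "k = \<lfloor>log b s\<rfloor> + 1"
  have eq: "b powi j = b powr real_of_int j" for j using b_gt_1 by (simp add: powr_real_of_int')
  have "s = b powr log b s" using assms b_gt_1 by simp
  moreover have "b powr log b s < b powr real_of_int k"
    using b_gt_1 by (intro powr_less_mono) (auto simp: k_def)
  moreover have "b powr real_of_int k \<le> b powr (log b s + 1)"
    using b_gt_1 by (intro powr_mono) (auto simp: k_def)
  moreover have "b powr (log b s + 1) = b * s" using assms b_gt_1 by (simp add: powr_add)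
  ultimately show ?thesis unfolding eq by (intro exI[of _ k]) auto
qed

text \<open>
  Far from the origin \<open>p\<close> is close to \<open>p\<^sub>\<infinity>\<close>, and the complement of a ball is not a null set.
\<close>

lemma pm_le_pinf: "pm \<le> pinf"
proof (rule ccontr)
  assume "\<not> ?thesis"
  define \<epsilon> where "\<epsilon> = pm - pinf"
  then have eps: "0 < \<epsilon>" using \<open>\<not> pm \<le> pinf\<close> by simp
  obtain k where k: "exp (ci / \<epsilon>) < b powi k" using ball_scale[of "exp (ci / \<epsilon>)"] by auto
  have small: "p x < pm" if "x \<notin> B k" for x
  proof -
    have "exp (ci / \<epsilon>) < \<rho> x" using rho_less[of x k] that k by fastforce
    then have "exp (ci / \<epsilon>) < exp 1 + \<rho> x" by (simp add: add_pos_pos less_trans[of _ "\<rho> x"])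
    then have "ci / \<epsilon> < ln (exp 1 + \<rho> x)" by (metis exp_gt_zero less_trans ln_exp ln_less_cancel_iff)
    moreover have "0 < ci / \<epsilon>" using ci_pos eps by simp
    ultimately have "ci / ln (exp 1 + \<rho> x) < \<epsilon>"
      using ci_pos eps less_trans[of 0 "ci / \<epsilon>" "ln (exp 1 + \<rho> x)"]
      by (simp add: pos_divide_less_eq mult.commute)
    then show ?thesis using log_decay[of x] unfolding \<epsilon>_def by linarith
  qed
  have "AE x in lebesgue. x \<in> B k"
    using p_bounds by eventually_elim (use small in force)
  then have "AE x in lebesgue. x \<in> dball 0 k" by (simp add: mem_dball)
  then have "emeasure lebesgue (dball 0 (k + 1)) \<le> emeasure lebesgue (dball 0 k)"
    by (intro emeasure_mono_AE) auto
  then have "b powi (k + 1) \<le> b powi k" by (simp only: emeasure_dball) simp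
  then show False using b_gt_1 by (simp add: b_powi_add)
qed

definition local_const :: real where
  "local_const = exp (cl * (1 + ln (2 * b powi (11 * \<tau>))) / pm)"

lemma local_const_ge_1: "1 \<le> local_const"
proof -
  have "1 \<le> 2 * b powi (11 * \<tau>)" using b_powi_mono[of 0 "11 * \<tau>"] tau_nonneg by simp
  then have "0 \<le> ln (2 * b powi (11 * \<tau>))" by simp
  then show ?thesis using cl_pos pm_pos by (simp add: local_const_def)
qed

text \<open>
  On a ball of volume \<open>O(2\<^bsup>- i p\<^sub>-\<^esup>)\<close> the oscillation of \<open>p\<close> is \<open>O(1 / (1 + i))\<close>.
\<close>

lemma weight_comparable:
  assumes i: "0 \<le> i" and k: "b powi k \<le> 2 * b powi (5 * \<tau>) * 2 powr (- real_of_int i * pm)"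
    and xy: "x - y \<in> B (k + 6 * \<tau>)"
  shows "weight i x \<le> ennreal local_const * weight i y"
proof -
  define K where "K = 2 * b powi (11 * \<tau>)"
  define X where "X = 2 powr (real_of_int i * pm)"
  have K_ge_1: "1 \<le> K" using b_powi_mono[of 0 "11 * \<tau>"] tau_nonneg by (simp add: K_def)
  have X1: "1 \<le> X" using i pm_pos by (simp add: X_def ge_one_powr_ge_zero)
  have main: "real_of_int i * ln 2 * \<bar>p x - p y\<bar> \<le> cl * (1 + ln K) / pm"
  proof (cases "x = y")
    case True
    then show ?thesis using K_ge_1 cl_pos pm_pos by simp
  next
    case False
    then have rp: "0 < \<rho> (x - y)" by (intro rho_pos) simp
    have "\<rho> (x - y) \<le> b powi k * b powi (6 * \<tau>)"
      using rho_le[OF xy] by (simp add: b_powi_add)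
    also have "\<dots> \<le> 2 * b powi (5 * \<tau>) * 2 powr (- real_of_int i * pm) * b powi (6 * \<tau>)"
      by (intro mult_right_mono k) simp
    also have "\<dots> = K / X"
    proof -
      have "b powi (11 * \<tau>) = b powi (5 * \<tau>) * b powi (6 * \<tau>)" by (simp flip: b_powi_add)
      then show ?thesis by (simp add: K_def X_def powr_minus divide_inverse)
    qed
    finally have "X / K \<le> 1 / \<rho> (x - y)" using rp X1 K_ge_1 by (simp add: field_simps)
    define l where "l = ln (exp 1 + 1 / \<rho> (x - y))"
    have "ln (X / K) \<le> l"
      unfolding l_def using X1 K_ge_1 \<open>X / K \<le> 1 / \<rho> (x - y)\<close>
      by (subst ln_le_cancel_iff) (auto simp: add_pos_pos rp intro: order_trans[of _ "1 / \<rho> (x - y)"])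
    moreover have l1: "1 \<le> l"
    proof -
      have "ln (exp 1) \<le> l" unfolding l_def using rp by (subst ln_le_cancel_iff) (auto simp: add_pos_pos)
      then show ?thesis by simp
    qed
    moreover have "ln K \<le> ln K * l" using K_ge_1 l1 by (simp add: mult_le_cancel_left1)
    moreover have "ln X = ln K + ln (X / K)" using K_ge_1 X1 by (simp add: ln_div)
    ultimately have "ln X \<le> (1 + ln K) * l" by (simp add: distrib_right)
    moreover have "ln X = real_of_int i * ln 2 * pm" by (simp add: X_def ln_powr)
    ultimately have i_le: "real_of_int i * ln 2 \<le> (1 + ln K) * l / pm"
      using pm_pos by (simp add: pos_le_divide_eq)
    have "real_of_int i * ln 2 * \<bar>p x - p y\<bar> \<le> ((1 + ln K) * l / pm) * (cl / l)"
      using i log_local[of x y] l1 K_ge_1 pm_pos unfolding l_def[symmetric]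
      by (intro mult_mono[OF i_le]) auto
    also have "\<dots> = cl * (1 + ln K) / pm" using l1 by simp
    finally show ?thesis .
  qed
  have "real_of_int i * p x * ln 2 \<le> cl * (1 + ln K) / pm + real_of_int i * p y * ln 2"
  proof -
    have "real_of_int i * ln 2 * (p x - p y) \<le> real_of_int i * ln 2 * \<bar>p x - p y\<bar>"
      using i by (intro mult_left_mono) auto
    with main show ?thesis by (simp add: algebra_simps)
  qed
  then have "2 powr (real_of_int i * p x) \<le> local_const * 2 powr (real_of_int i * p y)"
    unfolding local_const_def powr_def K_def by (simp flip: exp_add)
  then show ?thesis
    unfolding weight_def using local_const_ge_1 by (simp add: ennreal_mult[symmetric] ennreal_leI)
qed

definition decay_const :: real where "decay_const = exp (2 * ci / pm)"

lemma decay_const_ge_1: "1 \<le> decay_const"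
  using ci_pos pm_pos by (simp add: decay_const_def)

text \<open>
  Outside the ball of volume about \<open>2\<^bsup>- i p\<^sub>- / 2\<^esup>\<close> one has \<open>|i| \<le> C log (e + \<rho>(x))\<close>, which the decay
  condition absorbs.
\<close>

lemma far_compare:
  assumes i: "i < 0" and k: "2 powr (- real_of_int i * pm / 2) < b powi k" and x: "x \<notin> B k"
  shows "2 powr (real_of_int i * p x) \<le> decay_const * 2 powr (real_of_int i * pinf)"
    and "2 powr (real_of_int i * pinf) \<le> decay_const * 2 powr (real_of_int i * p x)"
proof -
  define n where "n = - real_of_int i"
  have n: "0 < n" using i by (simp add: n_def)
  have rk: "b powi k \<le> \<rho> x" using rho_less[of x k] x by fastforce
  define l where "l = ln (exp 1 + \<rho> x)"
  have rp: "0 < \<rho> x" using rk b_powi_pos[of k] by linarith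
  have l1: "1 \<le> l"
  proof -
    have "ln (exp 1) \<le> l" unfolding l_def using rp by (subst ln_le_cancel_iff) (auto simp: add_pos_pos)
    then show ?thesis by simp
  qed
  have "2 powr (n * pm / 2) \<le> exp 1 + \<rho> x"
    using k rk unfolding n_def by (simp add: add_increasing)
  then have "ln (2 powr (n * pm / 2)) \<le> l"
    unfolding l_def using rp by (subst ln_le_cancel_iff) (auto simp: add_pos_pos)
  then have nl: "n * ln 2 \<le> 2 / pm * l"
    using pm_pos by (simp add: ln_powr field_simps)
  have "n * ln 2 * \<bar>p x - pinf\<bar> \<le> (2 / pm * l) * (ci / l)"
    using n log_decay[of x] l1 pm_pos unfolding l_def[symmetric]
    by (intro mult_mono[OF nl]) auto
  also have "\<dots> = 2 * ci / pm" using l1 by simp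
  finally have main: "n * ln 2 * \<bar>p x - pinf\<bar> \<le> 2 * ci / pm" .
  have "n * ln 2 * (p x - pinf) \<le> 2 * ci / pm" "n * ln 2 * (pinf - p x) \<le> 2 * ci / pm"
    using main n by (auto intro: order_trans[rotated, OF main] mult_left_mono)
  then have "real_of_int i * pinf * ln 2 \<le> 2 * ci / pm + real_of_int i * p x * ln 2"
    "real_of_int i * p x * ln 2 \<le> 2 * ci / pm + real_of_int i * pinf * ln 2"
    by (simp_all add: n_def algebra_simps)
  then show "2 powr (real_of_int i * p x) \<le> decay_const * 2 powr (real_of_int i * pinf)"
    and "2 powr (real_of_int i * pinf) \<le> decay_const * 2 powr (real_of_int i * p x)"
    unfolding decay_const_def powr_def by (simp_all flip: exp_add)
qed

end
locale tent_exponent = gridded_balls B b \<tau> cell ctr N + log_holder_exponent B b \<tau> \<rho> p pm pp cl ci pinf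
  for B :: "int \<Rightarrow> (real^'n) set" and b :: real and \<tau> :: int
    and cell :: "int \<Rightarrow> real^'n \<Rightarrow> 'z::countable" and ctr :: "int \<Rightarrow> 'z \<Rightarrow> real^'n" and N :: nat
    and \<rho> :: "real^'n \<Rightarrow> real" and p :: "real^'n \<Rightarrow> real" and pm pp cl ci pinf :: real

text \<open>
  The parameters are chosen in this order: \<open>q_small\<close> fixes the rate \<open>\<theta>\<close> of decay that the weights in
  \<open>weight_total\<close> can afford, and then the step \<open>L\<close> of the stopping rule is taken large enough to produce it.
\<close>

locale stopping_parameters = tent_exponent B b \<tau> cell ctr N \<rho> p pm pp cl ci pinf
  for B :: "int \<Rightarrow> (real^'n) set" and b :: real and \<tau> :: int
    and cell :: "int \<Rightarrow> real^'n \<Rightarrow> 'z::countable" and ctr :: "int \<Rightarrow> 'z \<Rightarrow> real^'n" and N :: nat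
    and \<rho> :: "real^'n \<Rightarrow> real" and p :: "real^'n \<Rightarrow> real" and pm pp cl ci pinf :: real +
  fixes \<theta> L pu :: real
  assumes theta: "0 < \<theta>" "\<theta> \<le> 1"
    and L_drop: "real_of_int (6 * \<tau> + 1) * (2 * b powi (4 * \<tau>)) \<le> L"
    and L_half: "4 * b powi (14 * \<tau>) \<le> L"
    and L_theta: "2 * b powi (14 * \<tau>) * local_const \<le> \<theta> * L"
    and pu: "0 < pu" "pu \<le> 1" "pu \<le> pm"
    and q_small: "\<theta> powr (pm / (4 * pp)) * 4 powr (pp / pu) = 1 / 2"
begin

lemma L_pos: "0 < L"
  using L_half b_powi_pos[of "14 * \<tau>"] by linarith

definition gsum :: "real \<Rightarrow> real" where "gsum q = 1 / (1 - 2 powr (- q))"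

lemma gsum_pos: "0 < q \<Longrightarrow> 0 < gsum q"
  by (simp add: gsum_def powr_less_one)

definition \<delta> :: real where "\<delta> = pm / (4 * pp)"
definition q :: real where "q = \<theta> powr \<delta>"

lemma delta: "0 < \<delta>" "\<delta> \<le> 1 / 4"
  using pm_pos pm_le_pp by (auto simp: \<delta>_def field_simps)

lemma q_bounds: "0 < q" "q \<le> 1" "\<theta> \<le> q"
  using theta delta powr_mono'[of \<delta> 1 \<theta>] by (auto simp: q_def powr_le1)

definition stop_const :: real where
  "stop_const = 2 * b powi (5 * \<tau>) * (local_const + (decay_const * decay_const + decay_const * b + b)) * (gsum pm + gsum (pm / 4))"

lemma stop_const_nonneg: "0 \<le> stop_const"
  unfolding stop_const_def using local_const_ge_1 decay_const_ge_1 b_gt_1 gsum_pos[of pm] gsum_pos[of "pm / 4"] pm_pos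
  by (intro mult_nonneg_nonneg add_nonneg_nonneg) auto

definition overlap :: real where "overlap = real (nat (4 * \<tau> + 1) * N)"

definition c0 :: real where "c0 = overlap * (2 * sqrt L) powr pu"

definition coef_const :: real where "coef_const = max 1 (2 * c0 * gsum pu)"

definition modular_const :: real where "modular_const = coef_const powr (pp / pu) * (stop_const * 2)"

end

locale normalised_area = stopping_parameters B b \<tau> cell ctr N \<rho> p pm pp cl ci pinf \<theta> L pu
  for B :: "int \<Rightarrow> (real^'n) set" and b :: real and \<tau> :: int
    and cell :: "int \<Rightarrow> real^'n \<Rightarrow> 'z::countable" and ctr :: "int \<Rightarrow> 'z \<Rightarrow> real^'n" and N :: nat
    and \<rho> :: "real^'n \<Rightarrow> real" and p :: "real^'n \<Rightarrow> real" and pm pp cl ci pinf :: real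
    and \<theta> L pu :: real +
  fixes h :: "(real^'n) \<times> int \<Rightarrow> ennreal"
  assumes slices: "slices_measurable h"
    and modular: "(\<integral>\<^sup>+x. ennpowr (areasq h x) (p x / 2) \<partial>lebesgue) \<le> 1"
begin

abbreviation "lset i \<equiv> {x. ennreal (4 powi i) < areasq h x}"

lemma area_meas [measurable]: "areasq h \<in> borel_measurable lebesgue"
  by (rule areasq_measurable[OF slices])

lemma lset_sets [measurable]: "lset i \<in> sets lebesgue"
proof -
  have "{x \<in> space lebesgue. ennreal (4 powi i) < areasq h x} \<in> sets lebesgue" by measurable
  then show ?thesis by simp
qed

lemma weight_le_area: "x \<in> lset i \<Longrightarrow> weight i x \<le> ennpowr (areasq h x) (p x / 2)"
  unfolding weight_def using p_pos by (intro ennpowr_area_lower) auto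

lemma level_measure_bound:
  assumes "AE x in lebesgue. c \<le> real_of_int i * p x"
  shows "emeasure lebesgue (lset i) \<le> ennreal (2 powr (- c))"
proof -
  have "ennreal (2 powr c) * emeasure lebesgue (lset i) = (\<integral>\<^sup>+x. ennreal (2 powr c) * indicator (lset i) x \<partial>lebesgue)"
    by (rule nn_integral_cmult_indicator[symmetric]) simp
  also have "\<dots> \<le> (\<integral>\<^sup>+x. ennpowr (areasq h x) (p x / 2) \<partial>lebesgue)"
  proof (rule nn_integral_mono_AE)
    show "AE x in lebesgue. ennreal (2 powr c) * indicator (lset i) x \<le> ennpowr (areasq h x) (p x / 2)"
      using assms
    proof eventually_elim
      case (elim x)
      show ?case
      proof (cases "x \<in> lset i")
        case True
        have "ennreal (2 powr c) \<le> weight i x" unfolding weight_def using elim by (intro ennreal_leI) simp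
        also have "\<dots> \<le> ennpowr (areasq h x) (p x / 2)" by (rule weight_le_area[OF True])
        finally show ?thesis using True by simp
      qed simp
    qed
  qed
  also note modular
  finally have "ennreal (2 powr (- c)) * (ennreal (2 powr c) * emeasure lebesgue (lset i)) \<le> ennreal (2 powr (- c)) * 1"
    by (rule mult_left_mono) simp
  moreover have "ennreal (2 powr (- c)) * ennreal (2 powr c) = 1"
    by (simp add: ennreal_mult[symmetric] powr_add[symmetric] del: ennreal_mult)
  ultimately show ?thesis by (simp only: mult.assoc[symmetric]) simp
qed

lemma level_measure_pos:
  assumes "0 \<le> i"
  shows "emeasure lebesgue (lset i) \<le> ennreal (2 powr (- real_of_int i * pm))"
proof -
  have "AE x in lebesgue. real_of_int i * pm \<le> real_of_int i * p x"
    using p_bounds by eventually_elim (use assms in \<open>auto intro: mult_left_mono\<close>)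
  from level_measure_bound[OF this] show ?thesis by simp
qed

lemma level_measure_neg:
  assumes "i < 0"
  shows "emeasure lebesgue (lset i) \<le> ennreal (2 powr (- real_of_int i * pp))"
proof -
  have "AE x in lebesgue. real_of_int i * pp \<le> real_of_int i * p x"
    using p_bounds by eventually_elim (use assms in \<open>auto intro: mult_left_mono_neg\<close>)
  from level_measure_bound[OF this] show ?thesis by simp
qed

lemma level_finite: "emeasure lebesgue (lset i) < \<infinity>"
  using level_measure_pos[of i] level_measure_neg[of i]
  by (cases "0 \<le> i") (auto intro: le_less_trans simp del: emeasure_completion)

lemma area_finite_AE: "AE x in lebesgue. areasq h x < \<infinity>"
proof -
  have "(\<lambda>x. ennpowr (areasq h x) (p x / 2)) \<in> borel_measurable lebesgue" by measurable
  moreover have "(\<integral>\<^sup>+x. ennpowr (areasq h x) (p x / 2) \<partial>lebesgue) \<noteq> \<infinity>"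
    using modular by (auto simp: top_unique)
  ultimately have "AE x in lebesgue. ennpowr (areasq h x) (p x / 2) \<noteq> \<infinity>"
    by (rule nn_integral_PInf_AE)
  then show ?thesis
    by eventually_elim (auto simp: less_top[symmetric] ennpowr_top[unfolded infinity_ennreal_def])
qed

sublocale area_data B b \<tau> cell ctr N h L
  using slices level_finite area_finite_AE L_drop L_half by unfold_locales auto

lemma level_eq: "level i = lset i" by (simp add: level_def)

lemma level_weight_sum:
  "(\<integral>\<^sup>+i. (\<integral>\<^sup>+x\<in>level i. weight i x \<partial>lebesgue) \<partial>count_space UNIV) \<le> ennreal (gsum pm)"
proof -
  have "(\<integral>\<^sup>+i. (\<integral>\<^sup>+x\<in>level i. weight i x \<partial>lebesgue) \<partial>count_space UNIV)
      = (\<integral>\<^sup>+x. (\<integral>\<^sup>+i. weight i x * indicator (level i) x \<partial>count_space UNIV) \<partial>lebesgue)"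
    by (rule nn_integral_count_space_nn_integral[symmetric]) auto
  also have "\<dots> \<le> (\<integral>\<^sup>+x. ennreal (gsum pm) * ennpowr (areasq h x) (p x / 2) \<partial>lebesgue)"
  proof (rule nn_integral_mono_AE)
    show "AE x in lebesgue. (\<integral>\<^sup>+i. weight i x * indicator (level i) x \<partial>count_space UNIV)
        \<le> ennreal (gsum pm) * ennpowr (areasq h x) (p x / 2)"
      using p_bounds
    proof eventually_elim
      case (elim x)
      have "(\<integral>\<^sup>+i. weight i x * indicator (level i) x \<partial>count_space UNIV)
        = (\<integral>\<^sup>+i. ennreal (2 powr (real_of_int i * p x)) * indicator {i. ennreal (4 powi i) < areasq h x} i \<partial>count_space UNIV)"
        by (intro nn_integral_cong) (auto simp: weight_def level_def indicator_def)
      also have "\<dots> \<le> ennreal (gsum pm) * ennpowr (areasq h x) (p x / 2)"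
        unfolding gsum_def using elim pm_pos by (intro level_sum_bound) auto
      finally show ?case .
    qed
  qed
  also have "\<dots> = ennreal (gsum pm) * (\<integral>\<^sup>+x. ennpowr (areasq h x) (p x / 2) \<partial>lebesgue)"
    by (rule nn_integral_cmult) measurable
  also have "\<dots> \<le> ennreal (gsum pm) * 1" by (intro mult_left_mono modular) simp
  finally show ?thesis by simp
qed

lemma stop_weight_pos:
  assumes i: "0 \<le> i"
  shows "(\<integral>\<^sup>+x\<in>stopset_at i m. weight i x \<partial>lebesgue)
    \<le> ennreal (2 * b powi (5 * \<tau>) * local_const * q ^ m) * (\<integral>\<^sup>+x\<in>level i. weight i x \<partial>lebesgue)"
proof -
  interpret lv: level_data B b \<tau> "level i" "- level (i + 1)" "band i" "thr i" L by (rule band_level)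
  have "lv.comparable_weight local_const (weight i)"
    unfolding lv.comparable_weight_def
  proof (intro conjI allI impI)
    fix k x y
    assume k: "ennreal (b powi k) \<le> ennreal (2 * b powi (5 * \<tau>)) * emeasure lebesgue (level i)"
      and xy: "x - y \<in> B (k + 6 * \<tau>)"
    have "ennreal (b powi k) \<le> ennreal (2 * b powi (5 * \<tau>)) * ennreal (2 powr (- real_of_int i * pm))"
      using level_measure_pos[OF i] unfolding level_eq[symmetric]
      by (intro order_trans[OF k] mult_left_mono) auto
    also have "\<dots> = ennreal (2 * b powi (5 * \<tau>) * 2 powr (- real_of_int i * pm))"
      by (rule ennreal_mult[symmetric]) auto
    finally have "b powi k \<le> 2 * b powi (5 * \<tau>) * 2 powr (- real_of_int i * pm)"
      by (subst (asm) ennreal_le_iff) auto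
    from weight_comparable[OF i this xy] show "weight i x \<le> ennreal local_const * weight i y" .
  qed measurable
  from lv.weight_stopset_decay[OF this _ L_theta, of m] local_const_ge_1
  have "(\<integral>\<^sup>+x\<in>stopset_at i m. weight i x \<partial>lebesgue)
    \<le> ennreal (2 * b powi (5 * \<tau>) * local_const * \<theta> ^ m) * (\<integral>\<^sup>+x\<in>level i. weight i x \<partial>lebesgue)"
    by (simp add: emeasure_density del: emeasure_completion)
  also have "\<dots> \<le> ennreal (2 * b powi (5 * \<tau>) * local_const * q ^ m) * (\<integral>\<^sup>+x\<in>level i. weight i x \<partial>lebesgue)"
    using q_bounds theta local_const_ge_1 by (intro mult_right_mono ennreal_leI mult_left_mono power_mono) auto
  finally show ?thesis .
qed

lemma stop_measure:
  "emeasure lebesgue (stopset_at i m) \<le> ennreal (2 * b powi (5 * \<tau>) * \<theta> ^ m) * emeasure lebesgue (level i)"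
proof -
  interpret lv: level_data B b \<tau> "level i" "- level (i + 1)" "band i" "thr i" L by (rule band_level)
  have "lv.comparable_weight 1 (\<lambda>_. 1)" by (simp add: lv.comparable_weight_def)
  moreover have "2 * b powi (14 * \<tau>) * 1 \<le> \<theta> * L"
  proof -
    have "2 * b powi (14 * \<tau>) * 1 \<le> 2 * b powi (14 * \<tau>) * local_const"
      using local_const_ge_1 by (intro mult_left_mono) auto
    with L_theta show ?thesis by linarith
  qed
  ultimately show ?thesis
    using lv.weight_stopset_decay[of 1 "\<lambda>_. 1" \<theta> m] by (simp add: density_1 del: emeasure_completion)
qed

text \<open>
  Both the decay of the stopping set and the volume of the ball bound the intersection, and so
  does their geometric mean with exponents \<open>\<delta>\<close> and \<open>1 - \<delta>\<close>.  With \<open>\<delta> = p\<^sub>- / (4 p\<^sub>+)\<close> the growth of the first bound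
  as \<open>i \<rightarrow> -\<infinity>\<close> costs only \<open>2\<^bsup>|i| p\<^sub>- / 4\<^esup>\<close>, and a power of the decay in \<open>m\<close> survives.
\<close>

lemma stop_near_origin:
  assumes i: "i < 0" and k: "b powi k \<le> b * 2 powr (- real_of_int i * pm / 2)"
  shows "emeasure lebesgue (stopset_at i m \<inter> dball 0 k)
    \<le> ennreal (2 * b powi (5 * \<tau>) * b * q ^ m * 2 powr (- real_of_int i * (3 / 4 * pm)))"
proof -
  define n where "n = - real_of_int i"
  have n: "0 < n" using i by (simp add: n_def)
  define c where "c = 2 * b powi (5 * \<tau>)"
  define a where "a = c * \<theta> ^ m * 2 powr (n * pp)"
  define z where "z = b * 2 powr (n * pm / 2)"
  have c1: "1 \<le> c" using b_powi_mono[of 0 "5 * \<tau>"] tau_nonneg by (simp add: c_def)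
  have pos: "0 < a" "0 < z" using theta b_gt_1 c1 by (auto simp: a_def z_def)
  have "emeasure lebesgue (stopset_at i m \<inter> dball 0 k) \<le> emeasure lebesgue (stopset_at i m)"
    by (intro emeasure_mono) auto
  also have "\<dots> \<le> ennreal (c * \<theta> ^ m) * emeasure lebesgue (level i)"
    unfolding c_def by (rule stop_measure)
  also have "\<dots> \<le> ennreal (c * \<theta> ^ m) * ennreal (2 powr (n * pp))"
    using level_measure_neg[OF i] unfolding level_eq n_def by (intro mult_left_mono) auto
  also have "\<dots> = ennreal a"
    unfolding a_def using c1 theta by (intro ennreal_mult[symmetric]) auto
  finally have 1: "emeasure lebesgue (stopset_at i m \<inter> dball 0 k) \<le> ennreal a" .
  have "emeasure lebesgue (stopset_at i m \<inter> dball 0 k) \<le> emeasure lebesgue (dball 0 k)"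
    by (intro emeasure_mono) auto
  also have "\<dots> \<le> ennreal z"
    unfolding emeasure_dball z_def n_def by (intro ennreal_leI k)
  finally have "emeasure lebesgue (stopset_at i m \<inter> dball 0 k) \<le> ennreal (min a z)"
    using 1 by (simp add: min_def del: emeasure_completion)
  also have "min a z \<le> a powr \<delta> * z powr (1 - \<delta>)"
    using pos delta by (intro min_le_powr) auto
  also have "a powr \<delta> = c powr \<delta> * q ^ m * 2 powr (n * pm / 4)"
  proof -
    have "(\<theta> ^ m) powr \<delta> = q ^ m"
    proof -
      have "\<theta> ^ m = \<theta> powr real m" using theta by (simp add: powr_realpow)
      moreover have "q ^ m = q powr real m" using q_bounds by (simp add: powr_realpow)
      ultimately show ?thesis unfolding q_def by (simp only: powr_powr mult.commute)
    qed
    moreover have "(2 powr (n * pp)) powr \<delta> = 2 powr (n * pm / 4)"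
      unfolding \<delta>_def powr_powr using pm_pos pm_le_pp by simp
    ultimately show ?thesis unfolding a_def using c1 theta by (simp add: powr_mult)
  qed
  also have "c powr \<delta> * q ^ m * 2 powr (n * pm / 4) * z powr (1 - \<delta>)
      \<le> c * q ^ m * 2 powr (n * pm / 4) * (b * 2 powr (n * pm / 2))"
  proof (intro mult_mono mult_right_mono)
    show "c powr \<delta> \<le> c" using powr_mono[of \<delta> 1 c] c1 delta by simp
    have "1 \<le> 2 powr (n * pm / 2)" using n pm_pos by (intro ge_one_powr_ge_zero) auto
    then have "1 * 1 \<le> z" unfolding z_def using b_gt_1 by (intro mult_mono) auto
    then have "1 \<le> z" by simp
    then have "z powr (1 - \<delta>) \<le> z" using powr_mono[of "1 - \<delta>" 1 z] delta by simp
    then show "z powr (1 - \<delta>) \<le> b * 2 powr (n * pm / 2)" by (simp add: z_def)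
  qed (use c1 q_bounds b_gt_1 in auto)
  also have "c * q ^ m * 2 powr (n * pm / 4) * (b * 2 powr (n * pm / 2))
      = c * b * q ^ m * (2 powr (n * pm / 4) * 2 powr (n * pm / 2))" by simp
  also have "2 powr (n * pm / 4) * 2 powr (n * pm / 2) = 2 powr (n * (3 / 4 * pm))"
    by (simp flip: powr_add add: field_simps)
  finally show ?thesis unfolding c_def n_def by (simp add: ennreal_leI)
qed

text \<open>
  The weight \<open>2\<^bsup>i p(x)\<^esup>\<close> is replaced by the constant \<open>2\<^bsup>i p\<^sub>\<infinity>\<^esup>\<close>, for which the decay of volume
  applies, and back again; both replacements fail only near the origin, at the price of the summable
  error \<open>2\<^bsup>i p\<^sub>- / 4\<^esup>\<close>.
\<close>

lemma stop_weight_neg: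
  assumes i: "i < 0"
  shows "(\<integral>\<^sup>+x\<in>stopset_at i m. weight i x \<partial>lebesgue)
    \<le> ennreal (2 * b powi (5 * \<tau>) * (decay_const * decay_const + decay_const * b + b) * q ^ m)
        * ((\<integral>\<^sup>+x\<in>level i. weight i x \<partial>lebesgue) + ennreal (2 powr (real_of_int i * (pm / 4))))"
proof -
  define P where "P = 2 powr (real_of_int i * pinf)"
  define e where "e = 2 powr (real_of_int i * (pm / 4))"
  define c where "c = 2 * b powi (5 * \<tau>)"
  define W where "W = (\<integral>\<^sup>+x\<in>level i. weight i x \<partial>lebesgue)"
  have c0: "0 \<le> c" by (simp add: c_def)
  have b0: "0 \<le> b" using b_gt_1 by simp
  have e0: "0 \<le> e" by (simp add: e_def)
  have P0: "0 \<le> P" by (simp add: P_def)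
  have D0: "0 \<le> decay_const" using decay_const_ge_1 by simp
  have q0: "0 \<le> q ^ m" using q_bounds by simp
  obtain k where k: "2 powr (- real_of_int i * pm / 2) < b powi k" "b powi k \<le> b * 2 powr (- real_of_int i * pm / 2)"
    using ball_scale[of "2 powr (- real_of_int i * pm / 2)"] by auto
  let ?Z = "dball 0 k"
  have Z: "x \<in> ?Z \<longleftrightarrow> x \<in> B k" for x by (simp add: mem_dball)
  have "(\<integral>\<^sup>+x\<in>stopset_at i m. weight i x \<partial>lebesgue)
      \<le> (\<integral>\<^sup>+x. ennreal (decay_const * P) * indicator (stopset_at i m) x + ennreal (2 powr (real_of_int i * pm)) * indicator (stopset_at i m \<inter> ?Z) x \<partial>lebesgue)"
  proof (rule nn_integral_mono_AE)
    show "AE x in lebesgue. weight i x * indicator (stopset_at i m) x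
      \<le> ennreal (decay_const * P) * indicator (stopset_at i m) x + ennreal (2 powr (real_of_int i * pm)) * indicator (stopset_at i m \<inter> ?Z) x"
      using p_bounds
    proof eventually_elim
      case (elim x)
      show ?case
      proof (cases "x \<in> stopset_at i m")
        case xU: True
        show ?thesis
        proof (cases "x \<in> ?Z")
          case True
          have "weight i x \<le> ennreal (2 powr (real_of_int i * pm))"
            unfolding weight_def using elim i by (intro ennreal_leI powr_mono mult_left_mono_neg) auto
          then show ?thesis using xU True by (simp add: add_increasing)
        next
          case False
          have "weight i x \<le> ennreal (decay_const * P)"
            unfolding weight_def P_def using far_compare(1)[OF i k(1), of x] False Z by (intro ennreal_leI) auto
          then show ?thesis using xU False by simp
        qed
      qed simp
    qed
  qed
  also have "\<dots> = ennreal (decay_const * P) * emeasure lebesgue (stopset_at i m)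
      + ennreal (2 powr (real_of_int i * pm)) * emeasure lebesgue (stopset_at i m \<inter> ?Z)"
    by (subst nn_integral_add) (auto simp: nn_integral_cmult_indicator simp del: emeasure_completion)
  also have "ennreal (2 powr (real_of_int i * pm)) * emeasure lebesgue (stopset_at i m \<inter> ?Z)
      \<le> ennreal (2 powr (real_of_int i * pm)) * ennreal (c * b * q ^ m * 2 powr (- real_of_int i * (3 / 4 * pm)))"
    unfolding c_def by (intro mult_left_mono stop_near_origin[OF i k(2)]) simp
  also have "\<dots> = ennreal (c * b * q ^ m * e)"
  proof -
    have "2 powr (real_of_int i * pm) * 2 powr (- real_of_int i * (3 / 4 * pm)) = e"
      unfolding e_def by (simp flip: powr_add add: field_simps)
    then have eq: "2 powr (real_of_int i * pm) * (c * b * q ^ m * 2 powr (- real_of_int i * (3 / 4 * pm))) = c * b * q ^ m * e"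
      by (simp only: mult_ac)
    have "0 \<le> c * b * q ^ m * 2 powr (- real_of_int i * (3 / 4 * pm))"
      using c0 b0 q0 by (intro mult_nonneg_nonneg) auto
    from ennreal_mult[OF powr_ge_zero this, of 2 "real_of_int i * pm"] show ?thesis
      unfolding eq by (rule sym)
  qed
  finally have 1: "(\<integral>\<^sup>+x\<in>stopset_at i m. weight i x \<partial>lebesgue)
      \<le> ennreal (decay_const * P) * emeasure lebesgue (stopset_at i m) + ennreal (c * b * q ^ m * e)"
    by (simp add: add_left_mono)
  have 2: "ennreal P * emeasure lebesgue (level i) \<le> ennreal decay_const * W + ennreal (b * e)"
  proof -
    have "ennreal P * emeasure lebesgue (level i) = (\<integral>\<^sup>+x. ennreal P * indicator (level i) x \<partial>lebesgue)"
      by (rule nn_integral_cmult_indicator[symmetric]) simp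
    also have "\<dots> \<le> (\<integral>\<^sup>+x. ennreal decay_const * (weight i x * indicator (level i) x) + ennreal P * indicator ?Z x \<partial>lebesgue)"
    proof (rule nn_integral_mono)
      fix x
      show "ennreal P * indicator (level i) x \<le> ennreal decay_const * (weight i x * indicator (level i) x) + ennreal P * indicator ?Z x"
      proof (cases "x \<in> ?Z")
        case True
        then show ?thesis by (cases "x \<in> level i") (auto simp: add_increasing)
      next
        case False
        have "ennreal P \<le> ennreal (decay_const * 2 powr (real_of_int i * p x))"
          unfolding P_def using far_compare(2)[OF i k(1), of x] False Z by (intro ennreal_leI) auto
        also have "\<dots> = ennreal decay_const * weight i x" unfolding weight_def using D0 by (intro ennreal_mult) auto
        finally show ?thesis using False by (cases "x \<in> level i") auto
      qed
    qed
    also have "\<dots> = ennreal decay_const * W + ennreal P * emeasure lebesgue ?Z"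
      unfolding W_def by (subst nn_integral_add)
        (auto simp: nn_integral_cmult nn_integral_cmult_indicator simp del: emeasure_completion)
    also have "ennreal P * emeasure lebesgue ?Z \<le> ennreal (b * e)"
    proof -
      have "P \<le> 2 powr (real_of_int i * pm)"
        unfolding P_def using pm_le_pinf i by (intro powr_mono mult_left_mono_neg) auto
      then have "P * b powi k \<le> 2 powr (real_of_int i * pm) * (b * 2 powr (- real_of_int i * pm / 2))"
        using k(2) by (intro mult_mono) auto
      also have "\<dots> = b * (2 powr (real_of_int i * pm) * 2 powr (- real_of_int i * pm / 2))" by simp
      also have "2 powr (real_of_int i * pm) * 2 powr (- real_of_int i * pm / 2) = 2 powr (real_of_int i * (pm / 2))"
        by (simp flip: powr_add add: field_simps)
      also have "\<dots> \<le> e"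
        unfolding e_def using i pm_pos by (intro powr_mono mult_left_mono_neg) auto
      finally have "P * b powi k \<le> b * e" using b0 by (simp add: mult_left_mono)
      then show ?thesis unfolding emeasure_dball using P0 by (simp add: ennreal_mult[symmetric] ennreal_leI)
    qed
    finally show ?thesis by (simp add: add_left_mono)
  qed
  have thq: "\<theta> ^ m \<le> q ^ m" using q_bounds theta by (intro power_mono) auto
  have "ennreal (decay_const * P) * emeasure lebesgue (stopset_at i m)
      \<le> ennreal (decay_const * P) * (ennreal (c * q ^ m) * emeasure lebesgue (level i))"
  proof (intro mult_left_mono)
    have "emeasure lebesgue (stopset_at i m) \<le> ennreal (c * \<theta> ^ m) * emeasure lebesgue (level i)"
      unfolding c_def by (rule stop_measure)
    also have "\<dots> \<le> ennreal (c * q ^ m) * emeasure lebesgue (level i)"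
      using thq c0 by (intro mult_right_mono ennreal_leI mult_left_mono) auto
    finally show "emeasure lebesgue (stopset_at i m) \<le> ennreal (c * q ^ m) * emeasure lebesgue (level i)" .
  qed simp
  also have "\<dots> = ennreal (decay_const * c * q ^ m) * (ennreal P * emeasure lebesgue (level i))"
  proof -
    have "ennreal (decay_const * P) * ennreal (c * q ^ m) = ennreal (decay_const * c * q ^ m) * ennreal P"
      using D0 P0 c0 q0 by (simp add: ennreal_mult[symmetric] mult_ac)
    then show ?thesis by (simp only: mult.assoc[symmetric])
  qed
  also have "\<dots> \<le> ennreal (decay_const * c * q ^ m) * (ennreal decay_const * W + ennreal (b * e))"
    by (intro mult_left_mono 2) simp
  also have "\<dots> = ennreal (decay_const * c * q ^ m * decay_const) * W + ennreal (decay_const * c * q ^ m * (b * e))"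
    using D0 c0 q0 b0 e0 by (simp add: distrib_left mult.assoc[symmetric] ennreal_mult[symmetric])
  finally have "(\<integral>\<^sup>+x\<in>stopset_at i m. weight i x \<partial>lebesgue)
      \<le> ennreal (decay_const * c * q ^ m * decay_const) * W + ennreal (decay_const * c * q ^ m * (b * e)) + ennreal (c * b * q ^ m * e)"
    using 1 by (meson add_right_mono order_trans)
  also have "\<dots> = ennreal (decay_const * c * q ^ m * decay_const) * W + ennreal (c * q ^ m * (decay_const * b + b) * e)"
    using D0 c0 q0 b0 e0 by (simp add: add.assoc ennreal_plus[symmetric] algebra_simps del: ennreal_plus)
  also have "\<dots> \<le> ennreal (c * (decay_const * decay_const + decay_const * b + b) * q ^ m) * W
      + ennreal (c * (decay_const * decay_const + decay_const * b + b) * q ^ m * e)"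
    using D0 c0 q0 b0 e0
    by (intro add_mono mult_right_mono ennreal_leI) (auto simp: algebra_simps)
  also have "\<dots> = ennreal (c * (decay_const * decay_const + decay_const * b + b) * q ^ m) * (W + ennreal e)"
    using D0 c0 q0 b0 e0 by (simp add: distrib_left ennreal_mult)
  finally show ?thesis unfolding c_def W_def e_def .
qed

lemma stop_weight_sum:
  "(\<integral>\<^sup>+i. (\<integral>\<^sup>+x\<in>stopset_at i m. weight i x \<partial>lebesgue) \<partial>count_space UNIV) \<le> ennreal (stop_const * q ^ m)"
proof -
  define c where "c = 2 * b powi (5 * \<tau>) * (local_const + (decay_const * decay_const + decay_const * b + b)) * q ^ m"
  have nn: "0 \<le> decay_const * decay_const + decay_const * b + b" "0 \<le> local_const" "0 \<le> q ^ m"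
    using decay_const_ge_1 b_gt_1 local_const_ge_1 q_bounds by auto
  have c0: "0 \<le> c" using nn by (simp add: c_def)
  have "(\<integral>\<^sup>+x\<in>stopset_at i m. weight i x \<partial>lebesgue) \<le> ennreal c * ((\<integral>\<^sup>+x\<in>level i. weight i x \<partial>lebesgue)
      + ennreal (2 powr (real_of_int i * (pm / 4))) * indicator {..-1} i)" for i
  proof (cases "0 \<le> i")
    case True
    have "2 * b powi (5 * \<tau>) * local_const * q ^ m \<le> c"
      unfolding c_def using nn by (intro mult_right_mono mult_left_mono) auto
    then have "ennreal (2 * b powi (5 * \<tau>) * local_const * q ^ m) * (\<integral>\<^sup>+x\<in>level i. weight i x \<partial>lebesgue)
        \<le> ennreal c * (\<integral>\<^sup>+x\<in>level i. weight i x \<partial>lebesgue)"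
      by (intro mult_right_mono ennreal_leI) auto
    from order_trans[OF stop_weight_pos[OF True] this] show ?thesis using True by simp
  next
    case False
    have "2 * b powi (5 * \<tau>) * (decay_const * decay_const + decay_const * b + b) * q ^ m \<le> c"
      unfolding c_def using nn by (intro mult_right_mono mult_left_mono) auto
    then have "ennreal (2 * b powi (5 * \<tau>) * (decay_const * decay_const + decay_const * b + b) * q ^ m)
          * ((\<integral>\<^sup>+x\<in>level i. weight i x \<partial>lebesgue) + ennreal (2 powr (real_of_int i * (pm / 4))))
        \<le> ennreal c * ((\<integral>\<^sup>+x\<in>level i. weight i x \<partial>lebesgue) + ennreal (2 powr (real_of_int i * (pm / 4))))"
      by (intro mult_right_mono ennreal_leI) auto
    from order_trans[OF stop_weight_neg this] False show ?thesis by simp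
  qed
  then have "(\<integral>\<^sup>+i. (\<integral>\<^sup>+x\<in>stopset_at i m. weight i x \<partial>lebesgue) \<partial>count_space UNIV)
      \<le> (\<integral>\<^sup>+i. ennreal c * ((\<integral>\<^sup>+x\<in>level i. weight i x \<partial>lebesgue)
      + ennreal (2 powr (real_of_int i * (pm / 4))) * indicator {..-1} i) \<partial>count_space UNIV)"
    by (intro nn_integral_mono)
  also have "\<dots> = ennreal c * ((\<integral>\<^sup>+i. (\<integral>\<^sup>+x\<in>level i. weight i x \<partial>lebesgue) \<partial>count_space UNIV)
      + (\<integral>\<^sup>+i. ennreal (2 powr (real_of_int i * (pm / 4))) * indicator {..-1} i \<partial>count_space UNIV))"
    by (subst nn_integral_cmult) (auto simp: nn_integral_add)
  also have "(\<integral>\<^sup>+i. ennreal (2 powr (real_of_int i * (pm / 4))) * indicator {..-1} i \<partial>count_space UNIV)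
      \<le> ennreal (gsum (pm / 4))"
  proof -
    have "2 powr (real_of_int (- 1) * (pm / 4)) / (1 - 2 powr (- (pm / 4))) \<le> gsum (pm / 4)"
      unfolding gsum_def using pm_pos by (intro divide_right_mono) (auto simp: powr_le1 powr_less_one less_imp_le)
    then show ?thesis using pm_pos by (subst geometric_int_sum) (auto intro: ennreal_leI)
  qed
  also note level_weight_sum
  also have "ennreal c * (ennreal (gsum pm) + ennreal (gsum (pm / 4))) = ennreal (c * (gsum pm + gsum (pm / 4)))"
    using gsum_pos[of pm] gsum_pos[of "pm / 4"] pm_pos c0
    by (simp add: ennreal_plus[symmetric] ennreal_mult[symmetric] del: ennreal_plus)
  also have "c * (gsum pm + gsum (pm / 4)) = stop_const * q ^ m"
    by (simp add: c_def stop_const_def)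
  finally show ?thesis by (simp add: add_mono mult_left_mono)
qed

end

section \<open>Summing the pieces\<close>

lemma infsum_eq_nn_integral_int:
  fixes f :: "int \<Rightarrow> ennreal"
  shows "(\<Sum>\<^sub>\<infinity>l. f l) = (\<integral>\<^sup>+l. f l \<partial>count_space UNIV)"
proof -
  have bij: "bij_betw (from_nat_into (UNIV :: int set)) UNIV UNIV"
    by (intro bij_betw_from_nat_into) (auto simp: infinite_UNIV_int)
  let ?g = "from_nat_into (UNIV :: int set)"
  have "(\<Sum>\<^sub>\<infinity>l. f l) = (\<Sum>\<^sub>\<infinity>n. f (?g n))"
    by (rule infsum_reindex_bij_betw[OF bij, symmetric])
  also have "\<dots> = (\<Sum>n. f (?g n))"
  proof -
    have "(\<lambda>n. f (?g n)) summable_on UNIV" by (rule nonneg_summable_on_complete) simp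
    from has_sum_imp_sums[OF has_sum_infsum[OF this]] show ?thesis by (rule sums_unique)
  qed
  also have "\<dots> = (\<integral>\<^sup>+n. f (?g n) \<partial>count_space UNIV)"
    by (rule nn_integral_count_space_nat[symmetric])
  also have "\<dots> = (\<integral>\<^sup>+l. f l \<partial>count_space UNIV)"
    by (rule nn_integral_bij_count_space[OF bij])
  finally show ?thesis .
qed

context normalised_area
begin

definition piece_bound :: "int \<Rightarrow> nat \<Rightarrow> real" where
  "piece_bound i m = 2 powr (real_of_int i + 1) * sqrt (real (Suc m) * L)"

lemma piece_bound_pos: "0 < piece_bound i m"
  using L_pos by (simp add: piece_bound_def)

lemma piece_bound_sq: "(piece_bound i m)\<^sup>2 = real (Suc m) * (L * thr i)"
proof -
  have "thr i = (2 powr (real_of_int i + 1))\<^sup>2"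
    by (simp add: powi_4_eq powr_numeral)
  then show ?thesis unfolding piece_bound_def using L_pos by (simp add: power_mult_distrib)
qed

text \<open>
  The coefficient of a piece divided by the norm of the indicator of its ball; it vanishes for
  cells that carry no Whitney ball.
\<close>

definition coef :: "int \<times> nat \<times> int \<times> 'z \<Rightarrow> real" where
  "coef = (\<lambda>(i, m, k, z). if (k, z) \<in> used (stopset_at i m) then piece_bound i m else 0)"

definition index_ball :: "int \<times> nat \<times> int \<times> 'z \<Rightarrow> (real^'n) set" where
  "index_ball = (\<lambda>(i, m, k, z). whitney_ball k z)"

definition coef_sum :: "real^'n \<Rightarrow> ennreal" where
  "coef_sum x = (\<integral>\<^sup>+j. ennpowr (ennreal (coef j)) pu * indicator (index_ball j) x \<partial>count_space UNIV)"

definition coef_level_sum :: "nat \<Rightarrow> real^'n \<Rightarrow> ennreal" where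
  "coef_level_sum m x = (\<integral>\<^sup>+i. ennreal (2 powr (real_of_int i * pu)) * indicator (stopset_at i m) x \<partial>count_space UNIV)"

definition weight_level_sum :: "nat \<Rightarrow> real^'n \<Rightarrow> ennreal" where
  "weight_level_sum m x = (\<integral>\<^sup>+i. weight i x * indicator (stopset_at i m) x \<partial>count_space UNIV)"

definition weight_total :: "real^'n \<Rightarrow> ennreal" where
  "weight_total x = (\<integral>\<^sup>+m. ennreal ((4 powr (pp / pu)) ^ m) * weight_level_sum m x \<partial>count_space UNIV)"

lemma piece_bound_powr_bound: "piece_bound i m powr pu \<le> 2 powr (real_of_int i * pu) * (2 * sqrt L) powr pu * 2 ^ m"
proof -
  have "piece_bound i m = 2 powr real_of_int i * (2 * sqrt L) * sqrt (real (Suc m))"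
    using L_pos by (simp add: piece_bound_def powr_add real_sqrt_mult)
  then have "piece_bound i m powr pu = 2 powr (real_of_int i * pu) * (2 * sqrt L) powr pu * sqrt (real (Suc m)) powr pu"
    using L_pos by (simp add: powr_mult powr_powr)
  also have "sqrt (real (Suc m)) powr pu \<le> 2 ^ m"
  proof -
    have "sqrt (real (Suc m)) powr pu \<le> sqrt (real (Suc m)) powr 1"
      using pu by (intro powr_mono) auto
    also have "\<dots> \<le> real (Suc m)"
      by (simp add: real_le_lsqrt power2_eq_square)
    also have "real (Suc m) \<le> 2 ^ m"
      using of_nat_mono[OF Suc_leI[OF less_exp[of m]]] by simp
    finally show ?thesis .
  qed
  finally show ?thesis by (simp add: mult_left_mono)
qed

lemma coef_sum_le: "coef_sum x \<le> (\<integral>\<^sup>+m. ennreal (c0 * 2 ^ m) * coef_level_sum m x \<partial>count_space UNIV)"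
proof -
  have inner: "(\<integral>\<^sup>+r. ennpowr (ennreal (coef (i, m, r))) pu * indicator (index_ball (i, m, r)) x \<partial>count_space UNIV)
      \<le> ennreal (c0 * 2 ^ m) * (ennreal (2 powr (real_of_int i * pu)) * indicator (stopset_at i m) x)" for i m
  proof -
    let ?X = "{(k, z) \<in> used (stopset_at i m). x \<in> whitney_ball k z}"
    have "emeasure (count_space UNIV) ?X = ennreal (real (card ?X))"
      using used_overlap[of "stopset_at i m" x] by (simp add: emeasure_count_space_finite ennreal_of_nat_eq_real_of_nat)
    also have "\<dots> \<le> ennreal overlap * indicator (stopset_at i m) x"
    proof (cases "x \<in> stopset_at i m")
      case True
      have "real (card ?X) \<le> overlap"
        unfolding overlap_def by (rule of_nat_mono[OF conjunct2[OF used_overlap]])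
      then show ?thesis using True by (simp add: ennreal_leI)
    next
      case False
      then have "(k, z) \<notin> ?X" for k z using used_subset[of k z "stopset_at i m"] by blast
      then have "?X = {}" by auto
      then have "card ?X = 0" by (simp only: card.empty)
      then show ?thesis by simp
    qed
    finally have count: "emeasure (count_space UNIV) ?X \<le> ennreal overlap * indicator (stopset_at i m) x" .
    have "(\<integral>\<^sup>+r. ennpowr (ennreal (coef (i, m, r))) pu * indicator (index_ball (i, m, r)) x \<partial>count_space UNIV)
        = (\<integral>\<^sup>+r. ennreal (piece_bound i m powr pu) * indicator ?X r \<partial>count_space UNIV)"
      using piece_bound_pos[of i m]
      by (intro nn_integral_cong) (auto simp: coef_def index_ball_def indicator_def ennpowr_ennreal split: prod.splits)
    also have "\<dots> = ennreal (piece_bound i m powr pu) * emeasure (count_space UNIV) ?X"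
      by (rule nn_integral_cmult_indicator) simp
    also have "\<dots> \<le> ennreal (2 powr (real_of_int i * pu) * (2 * sqrt L) powr pu * 2 ^ m) * (ennreal overlap * indicator (stopset_at i m) x)"
      by (rule mult_mono[OF ennreal_leI[OF piece_bound_powr_bound] count]) simp_all
    also have "\<dots> = ennreal (c0 * 2 ^ m) * (ennreal (2 powr (real_of_int i * pu)) * indicator (stopset_at i m) x)"
    proof -
      have o: "0 \<le> overlap" by (simp add: overlap_def)
      have "ennreal (2 powr (real_of_int i * pu) * (2 * sqrt L) powr pu * 2 ^ m) * ennreal overlap
          = ennreal (2 powr (real_of_int i * pu) * (2 * sqrt L) powr pu * 2 ^ m * overlap)"
        using o by (intro ennreal_mult[symmetric] mult_nonneg_nonneg) simp_all
      also have "2 powr (real_of_int i * pu) * (2 * sqrt L) powr pu * 2 ^ m * overlap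
          = c0 * 2 ^ m * 2 powr (real_of_int i * pu)"
        by (simp only: c0_def mult_ac)
      also have "ennreal (c0 * 2 ^ m * 2 powr (real_of_int i * pu)) = ennreal (c0 * 2 ^ m) * ennreal (2 powr (real_of_int i * pu))"
        unfolding c0_def using o by (intro ennreal_mult mult_nonneg_nonneg) simp_all
      finally have "ennreal (2 powr (real_of_int i * pu) * (2 * sqrt L) powr pu * 2 ^ m) * ennreal overlap
          = ennreal (c0 * 2 ^ m) * ennreal (2 powr (real_of_int i * pu))" .
      then show ?thesis by (simp only: mult.assoc[symmetric])
    qed
    finally show ?thesis .
  qed
  have "coef_sum x = (\<integral>\<^sup>+i. \<integral>\<^sup>+m. (\<integral>\<^sup>+r. ennpowr (ennreal (coef (i, m, r))) pu * indicator (index_ball (i, m, r)) x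
        \<partial>count_space UNIV) \<partial>count_space UNIV \<partial>count_space UNIV)"
    unfolding coef_sum_def
    by (subst nn_integral_fst_count_space[symmetric], subst nn_integral_fst_count_space[symmetric]) simp
  also have "\<dots> \<le> (\<integral>\<^sup>+i. \<integral>\<^sup>+m. ennreal (c0 * 2 ^ m) * (ennreal (2 powr (real_of_int i * pu)) * indicator (stopset_at i m) x)
        \<partial>count_space UNIV \<partial>count_space UNIV)"
    by (intro nn_integral_mono inner)
  also have "\<dots> = (\<integral>\<^sup>+m. \<integral>\<^sup>+i. ennreal (c0 * 2 ^ m) * (ennreal (2 powr (real_of_int i * pu)) * indicator (stopset_at i m) x)
        \<partial>count_space UNIV \<partial>count_space UNIV)"
    by (rule nn_integral_count_space_nn_integral) auto
  also have "\<dots> = (\<integral>\<^sup>+m. ennreal (c0 * 2 ^ m) * coef_level_sum m x \<partial>count_space UNIV)"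
    unfolding coef_level_sum_def by (intro nn_integral_cong nn_integral_cmult) auto
  finally show ?thesis .
qed

text \<open>
  For fixed \<open>m\<close> the sum is geometric in \<open>i\<close>, so it is controlled by its largest term.  This is
  how a sum of powers passes inside the exponent \<open>p(x) / r\<close> without a convexity inequality.
\<close>

lemma coef_level_sum_le:
  assumes px: "pm \<le> p x"
  shows "coef_level_sum m x \<le> ennreal (gsum pu) * ennpowr (weight_level_sum m x) (pu / p x)"
proof -
  have p0: "0 < p x" by (rule p_pos)
  let ?I = "{i. x \<in> stopset_at i m}"
  show ?thesis
  proof (cases "weight_level_sum m x = \<infinity>")
    case True
    then show ?thesis using gsum_pos[OF pu(1)]
      by (simp add: ennpowr_top[unfolded infinity_ennreal_def] ennreal_mult_eq_top_iff)
  next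
    case False
    then obtain r where r: "weight_level_sum m x = ennreal r" "0 \<le> r" by (cases "weight_level_sum m x") auto
    have le_T: "2 powr (real_of_int i * p x) \<le> r" if "i \<in> ?I" for i
    proof -
      have "ennreal (2 powr (real_of_int i * p x))
          = (\<integral>\<^sup>+j. weight i x * indicator {i} j \<partial>count_space UNIV)"
        by (simp add: nn_integral_cmult_indicator weight_def)
      also have "\<dots> \<le> weight_level_sum m x"
        unfolding weight_level_sum_def using that by (intro nn_integral_mono) (auto simp: indicator_def)
      finally show ?thesis using r by simp
    qed
    show ?thesis
    proof (cases "?I = {}")
      case True
      then have "coef_level_sum m x = (\<integral>\<^sup>+i. 0 \<partial>count_space (UNIV :: int set))"
        unfolding coef_level_sum_def by (intro nn_integral_cong) auto
      then show ?thesis by simp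
    next
      case ne: False
      then obtain i0 where i0: "i0 \<in> ?I" by blast
      have r0: "0 < r" by (rule less_le_trans[OF _ le_T[OF i0]]) simp
      have "i \<le> \<lceil>log 2 r / p x\<rceil>" if "i \<in> ?I" for i
      proof -
        have "log 2 (2 powr (real_of_int i * p x)) \<le> log 2 r"
          using le_T[OF that] r0 by (subst log_le_cancel_iff) auto
        then have "real_of_int i \<le> log 2 r / p x" using p0 by (simp add: pos_le_divide_eq)
        then show ?thesis by linarith
      qed
      from int_set_max[OF i0 this] obtain K where K: "K \<in> ?I" "\<And>i. i \<in> ?I \<Longrightarrow> i \<le> K" by blast
      have "coef_level_sum m x \<le> (\<integral>\<^sup>+i. ennreal (2 powr (real_of_int i * pu)) * indicator {..K} i \<partial>count_space UNIV)"
        unfolding coef_level_sum_def using K(2) by (intro nn_integral_mono mult_left_mono) (auto simp: indicator_def)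
      also have "\<dots> = ennreal (gsum pu * 2 powr (real_of_int K * pu))"
        using pu by (simp add: geometric_int_sum gsum_def)
      also have "2 powr (real_of_int K * pu) = (2 powr (real_of_int K * p x)) powr (pu / p x)"
        using p0 by (simp add: powr_powr)
      also have "\<dots> \<le> r powr (pu / p x)"
        using le_T[OF K(1)] p0 pu by (intro powr_mono2) auto
      finally have "coef_level_sum m x \<le> ennreal (gsum pu * r powr (pu / p x))"
        using gsum_pos[OF pu(1)] by (simp add: mult_left_mono ennreal_leI)
      also have "\<dots> = ennreal (gsum pu) * ennpowr (weight_level_sum m x) (pu / p x)"
        using gsum_pos[OF pu(1)] r by (simp add: ennpowr_ennreal ennreal_mult)
      finally show ?thesis .
    qed
  qed
qed

text \<open>
  The weights \<open>4\<^bsup>m p\<^sub>+ / r\<^esup>\<close> in \<open>weight_total\<close> make the \<open>m\<close>-th term of the sum at most a multiple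
  of \<open>2\<^sup>-\<^sup>m\<close> times a power of the total.
\<close>

lemma coef_sum_powr_le:
  assumes px: "pm \<le> p x" "p x \<le> pp"
  shows "ennpowr (coef_sum x) (p x / pu) \<le> ennreal (coef_const powr (pp / pu)) * weight_total x"
proof -
  define r where "r = p x / pu"
  have p0: "0 < p x" by (rule p_pos)
  have r0: "0 < r" using p0 pu by (simp add: r_def)
  have c00: "0 \<le> c0" by (simp add: c0_def overlap_def)
  have g0: "0 < gsum pu" by (rule gsum_pos[OF pu(1)])
  \<comment> \<open>a single term of \<open>weight_total\<close>, raised to the power \<open>1 / r\<close>\<close>
  have T_le: "ennreal (4 ^ m) * ennpowr (weight_level_sum m x) (1 / r) \<le> ennpowr (weight_total x) (1 / r)" for m
  proof -
    define R where "R = (4::real) powr (pp / pu)"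
    have "4 powr r \<le> R" unfolding R_def r_def using px pu by (intro powr_mono divide_right_mono) auto
    then have "(4 powr r) powr (1 / r) \<le> R powr (1 / r)" using r0 by (intro powr_mono2) auto
    then have R4: "4 \<le> R powr (1 / r)" using r0 by (simp add: powr_powr)
    have "(4::real) ^ m \<le> (R powr (1 / r)) ^ m" using R4 by (intro power_mono) auto
    also have "\<dots> = (R ^ m) powr (1 / r)"
    proof -
      have "0 < R" by (simp add: R_def)
      then have "R ^ m = R powr real m" "(R powr (1 / r)) ^ m = (R powr (1 / r)) powr real m"
        by (simp_all add: powr_realpow)
      then show ?thesis by (simp only: powr_powr mult.commute)
    qed
    finally have "ennreal (4 ^ m) * ennpowr (weight_level_sum m x) (1 / r) \<le> ennreal ((R ^ m) powr (1 / r)) * ennpowr (weight_level_sum m x) (1 / r)"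
      by (intro mult_right_mono ennreal_leI) auto
    also have "\<dots> = ennpowr (ennreal (R ^ m) * weight_level_sum m x) (1 / r)"
      using r0 by (intro ennpowr_mult[symmetric]) (auto simp: R_def)
    also have "\<dots> \<le> ennpowr (weight_total x) (1 / r)"
    proof (rule ennpowr_mono)
      have "ennreal (R ^ m) * weight_level_sum m x = (\<integral>\<^sup>+j. ennreal (R ^ m) * weight_level_sum m x * indicator {m} j \<partial>count_space UNIV)"
        by (simp add: nn_integral_cmult_indicator)
      also have "\<dots> \<le> weight_total x"
        unfolding weight_total_def R_def by (intro nn_integral_mono) (auto simp: indicator_def)
      finally show "ennreal (R ^ m) * weight_level_sum m x \<le> weight_total x" .
    qed (use r0 in simp)
    finally show ?thesis .
  qed
  have "coef_sum x \<le> (\<integral>\<^sup>+m. ennreal (c0 * 2 ^ m) * coef_level_sum m x \<partial>count_space UNIV)"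
    by (rule coef_sum_le)
  also have "\<dots> \<le> (\<integral>\<^sup>+m. ennreal (c0 * gsum pu * (1 / 2) ^ m) * ennpowr (weight_total x) (1 / r) \<partial>count_space UNIV)"
  proof (rule nn_integral_mono)
    fix m :: nat
    have "ennreal (c0 * 2 ^ m) * coef_level_sum m x \<le> ennreal (c0 * 2 ^ m) * (ennreal (gsum pu) * ennpowr (weight_level_sum m x) (1 / r))"
      using coef_level_sum_le[OF px(1), of m] by (intro mult_left_mono) (simp_all add: r_def)
    also have "\<dots> = ennreal (c0 * gsum pu * (1 / 2) ^ m) * (ennreal (4 ^ m) * ennpowr (weight_level_sum m x) (1 / r))"
    proof -
      have "(4::real) ^ m = 2 ^ m * 2 ^ m" by (simp flip: power_mult_distrib)
      then have "c0 * 2 ^ m * gsum pu = c0 * gsum pu * (1 / 2) ^ m * 4 ^ m"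
        by (simp add: power_one_over)
      then have "ennreal (c0 * 2 ^ m) * ennreal (gsum pu) = ennreal (c0 * gsum pu * (1 / 2) ^ m) * ennreal (4 ^ m)"
        using c00 g0 by (subst (1 2) ennreal_mult[symmetric]) auto
      then show ?thesis by (simp only: mult.assoc[symmetric])
    qed
    also have "\<dots> \<le> ennreal (c0 * gsum pu * (1 / 2) ^ m) * ennpowr (weight_total x) (1 / r)"
      by (intro mult_left_mono T_le) simp
    finally show "ennreal (c0 * 2 ^ m) * coef_level_sum m x \<le> ennreal (c0 * gsum pu * (1 / 2) ^ m) * ennpowr (weight_total x) (1 / r)" .
  qed
  also have "\<dots> = (\<Sum>m. ennreal (c0 * gsum pu * (1 / 2) ^ m)) * ennpowr (weight_total x) (1 / r)"
    by (simp add: nn_integral_count_space_nat)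
  also have "(\<Sum>m. ennreal (c0 * gsum pu * (1 / 2) ^ m)) = ennreal (c0 * gsum pu * (1 / (1 - 1 / 2)))"
    using c00 g0 by (intro suminf_ennreal_eq sums_mult geometric_sums) auto
  also have "\<dots> \<le> ennreal coef_const" unfolding coef_const_def by (intro ennreal_leI) simp
  finally have "coef_sum x \<le> ennreal coef_const * ennpowr (weight_total x) (1 / r)"
    by (simp add: mult_right_mono)
  then have "ennpowr (coef_sum x) r \<le> ennpowr (ennreal coef_const * ennpowr (weight_total x) (1 / r)) r"
    using r0 by (intro ennpowr_mono) auto
  also have "\<dots> = ennreal (coef_const powr r) * weight_total x"
    using r0 by (subst ennpowr_mult) (auto simp: coef_const_def ennpowr_ennpowr)
  also have "\<dots> \<le> ennreal (coef_const powr (pp / pu)) * weight_total x"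
    unfolding r_def using px pu by (intro mult_right_mono ennreal_leI powr_mono divide_right_mono) (auto simp: coef_const_def)
  finally show ?thesis unfolding r_def .
qed

lemma coef_sum_modular:
  "(\<integral>\<^sup>+x. ennpowr (coef_sum x) (p x / pu) \<partial>lebesgue) \<le> ennreal modular_const"
proof -
  define R where "R = (4::real) powr (pp / pu)"
  have T_meas [measurable]: "weight_level_sum m \<in> borel_measurable lebesgue" for m
    unfolding weight_level_sum_def[abs_def] by (intro nn_integral_countable_measurable) auto
  have "(\<integral>\<^sup>+x. ennpowr (coef_sum x) (p x / pu) \<partial>lebesgue)
      \<le> (\<integral>\<^sup>+x. ennreal (coef_const powr (pp / pu)) * weight_total x \<partial>lebesgue)"
    by (rule nn_integral_mono_AE, use p_bounds in eventually_elim) (use coef_sum_powr_le in blast)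
  also have "\<dots> = ennreal (coef_const powr (pp / pu)) * (\<integral>\<^sup>+x. weight_total x \<partial>lebesgue)"
    unfolding weight_total_def nn_integral_count_space_nat by (rule nn_integral_cmult) measurable
  also have "(\<integral>\<^sup>+x. weight_total x \<partial>lebesgue) = (\<integral>\<^sup>+m. (\<integral>\<^sup>+x. ennreal (R ^ m) * weight_level_sum m x \<partial>lebesgue) \<partial>count_space UNIV)"
    unfolding weight_total_def R_def by (rule nn_integral_count_space_nn_integral) auto
  also have "\<dots> \<le> (\<integral>\<^sup>+m. ennreal (stop_const * (1 / 2) ^ m) \<partial>count_space UNIV)"
  proof (rule nn_integral_mono)
    fix m :: nat
    have "(\<integral>\<^sup>+x. ennreal (R ^ m) * weight_level_sum m x \<partial>lebesgue) = ennreal (R ^ m) * (\<integral>\<^sup>+x. weight_level_sum m x \<partial>lebesgue)"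
      by (rule nn_integral_cmult) measurable
    also have "(\<integral>\<^sup>+x. weight_level_sum m x \<partial>lebesgue) = (\<integral>\<^sup>+i. (\<integral>\<^sup>+x\<in>stopset_at i m. weight i x \<partial>lebesgue) \<partial>count_space UNIV)"
      unfolding weight_level_sum_def by (rule nn_integral_count_space_nn_integral) auto
    also have "ennreal (R ^ m) * \<dots> \<le> ennreal (R ^ m) * ennreal (stop_const * q ^ m)"
      by (intro mult_left_mono stop_weight_sum) simp
    also have "\<dots> = ennreal (stop_const * (q * R) ^ m)"
      using stop_const_nonneg q_bounds by (subst ennreal_mult[symmetric]) (auto simp: R_def power_mult_distrib mult_ac)
    also have "q * R = 1 / 2" using q_small by (simp add: q_def \<delta>_def R_def)
    finally show "(\<integral>\<^sup>+x. ennreal (R ^ m) * weight_level_sum m x \<partial>lebesgue) \<le> ennreal (stop_const * (1 / 2) ^ m)" .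
  qed
  also have "\<dots> = (\<Sum>m. ennreal (stop_const * (1 / 2) ^ m))" by (rule nn_integral_count_space_nat)
  also have "\<dots> = ennreal (stop_const * (1 / (1 - 1 / 2)))"
    using stop_const_nonneg by (intro suminf_ennreal_eq sums_mult geometric_sums) auto
  also have "ennreal (coef_const powr (pp / pu)) * \<dots> = ennreal modular_const"
    unfolding modular_const_def using stop_const_nonneg by (subst ennreal_mult[symmetric]) auto
  finally show ?thesis by (simp add: mult_left_mono)
qed

end

section \<open>Atoms and the decomposition\<close>

lemma Lp_var_norm_le:
  assumes "0 < t" "(\<integral>\<^sup>+x. ennpowr (f x / ennreal t) (real_of_ereal (P x)) \<partial>lebesgue) \<le> 1"
  shows "Lp_var_norm P f \<le> ennreal t"
  unfolding Lp_var_norm_def using assms by (intro Inf_lower) auto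

lemma Lp_var_norm_lessE:
  assumes "Lp_var_norm P f < c"
  obtains t where "0 < t" "ennreal t < c"
    "(\<integral>\<^sup>+x. ennpowr (f x / ennreal t) (real_of_ereal (P x)) \<partial>lebesgue) \<le> 1"
  using assms unfolding Lp_var_norm_def Inf_less_iff by auto

lemma divide_ennreal_pos: "0 < t \<Longrightarrow> x / ennreal t = ennreal (1 / t) * x"
  by (simp add: divide_ennreal_def inverse_ennreal mult.commute inverse_eq_divide)

lemma AE_lebesgue_ex:
  assumes "AE x in (lebesgue :: (real^'n) measure). Q x"
  shows "\<exists>x. Q x"
proof -
  have "emeasure (lebesgue :: (real^'n) measure) (space lebesgue) \<noteq> 0"
    by (simp add: emeasure_lborel_UNIV)
  then have "ae_filter (lebesgue :: (real^'n) measure) \<noteq> bot" by (simp add: ae_filter_eq_bot_iff)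
  from eventually_happens'[OF this assms] show ?thesis .
qed

lemma RnZ_sets_slices:
  assumes "\<And>l. {y. (y, l) \<in> X} \<in> sets lebesgue"
  shows "X \<in> sets RnZ"
proof -
  have "X = (\<Union>l. {y. (y, l) \<in> X} \<times> {l})" by auto
  also have "\<dots> \<in> sets RnZ"
    unfolding RnZ_def using assms by (intro sets.countable_UN) auto
  finally show ?thesis .
qed

lemma RnZ_slice_measurable:
  assumes "f \<in> borel_measurable RnZ"
  shows "(\<lambda>y. f (y, l)) \<in> borel_measurable lebesgue"
  by (rule measurable_compose[OF _ assms]) (simp add: RnZ_def)

lemma AE_RnZ_slices:
  assumes "{z. \<not> Q z} \<in> sets RnZ" "\<And>l. AE y in lebesgue. Q (y, l)"
  shows "AE z in RnZ. Q z"
proof -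
  interpret sigma_finite_measure "count_space (UNIV :: int set)"
    by (rule sigma_finite_measure_count_space)
  have "{y. \<not> Q (y, l)} \<times> {l} \<in> null_sets RnZ" for l
  proof -
    have N: "{y. \<not> Q (y, l)} \<in> sets lebesgue"
      using sets_Pair2[OF assms(1)[unfolded RnZ_def], of l] by (simp add: vimage_def)
    then have "emeasure lebesgue {y. \<not> Q (y, l)} = 0"
      using assms(2)[of l] by (subst AE_iff_measurable[symmetric, OF N]) auto
    then show ?thesis
      using N by (auto simp: null_sets_def RnZ_def emeasure_pair_measure_Times simp del: emeasure_completion)
  qed
  then have "(\<Union>l. {y. \<not> Q (y, l)} \<times> {l}) \<in> null_sets RnZ" by (rule null_sets_UN)
  also have "(\<Union>l. {y. \<not> Q (y, l)} \<times> {l}) = {z. \<not> Q z}" by auto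
  finally show ?thesis by (rule AE_I') auto
qed

lemma C_log_finite:
  assumes "P \<in> C_log A \<Delta>"
  shows "P x = ereal (real_of_ereal (P x))"
proof -
  from assms obtain c p0 where "\<bar>P x - ereal p0\<bar> \<le> ereal c" unfolding C_log_def by blast
  then show ?thesis by (cases "P x") auto
qed

lemma essinf_AE: "AE x in M. essinf M f \<le> f x"
  using esssup_AE[of "\<lambda>x. - f x" M] unfolding essinf_def
  by eventually_elim (simp add: ereal_uminus_le_reorder)

lemma (in ellipsoid_dilation) C_log_real:
  assumes P: "P \<in> C_log A \<Delta>"
  shows "\<exists>cl ci pinf. log_holder_exponent B (dil A) (int tau) (qnorm A \<Delta>) (\<lambda>x. real_of_ereal (P x))
    (real_of_ereal (essinf lebesgue P)) (real_of_ereal (esssup lebesgue P)) cl ci pinf"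
proof -
  let ?p = "\<lambda>x. real_of_ereal (P x)"
  have fin: "P x = ereal (?p x)" for x by (rule C_log_finite[OF P])
  from P have ve: "P \<in> borel_measurable lebesgue" "\<And>x. 0 < P x" "0 < essinf lebesgue P" "esssup lebesgue P < \<infinity>"
    by (auto simp: C_log_def var_exponents_def)
  from P obtain cl ci p0 where c: "0 < cl" "0 < ci"
    "\<And>x y. \<bar>P x - P y\<bar> \<le> ereal (cl / ln (exp 1 + 1 / qnorm A \<Delta> (x - y)))"
    "\<And>x. \<bar>P x - ereal p0\<bar> \<le> ereal (ci / ln (exp 1 + qnorm A \<Delta> x))"
    unfolding C_log_def by blast
  have lo: "AE x in lebesgue. essinf lebesgue P \<le> P x" by (rule essinf_AE)
  have hi: "AE x in lebesgue. P x \<le> esssup lebesgue P" by (rule esssup_AE)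
  obtain x0 where x0: "essinf lebesgue P \<le> P x0" "P x0 \<le> esssup lebesgue P"
    using AE_lebesgue_ex[OF AE_conjI[OF lo hi]] by blast
  have e1: "essinf lebesgue P = ereal (real_of_ereal (essinf lebesgue P))"
    using x0(1) ve(3) fin[of x0] by (cases "essinf lebesgue P") auto
  have e2: "esssup lebesgue P = ereal (real_of_ereal (esssup lebesgue P))"
    using x0(2) ve(4) fin[of x0] by (cases "esssup lebesgue P") auto
  have "log_holder_exponent B (dil A) (int tau) (qnorm A \<Delta>) ?p
    (real_of_ereal (essinf lebesgue P)) (real_of_ereal (esssup lebesgue P)) cl ci p0"
  proof unfold_locales
    show "?p \<in> borel_measurable lebesgue" using ve(1) by measurable
    show "0 < real_of_ereal (essinf lebesgue P)" using ve(3) e1 by (metis ereal_less(2))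
    show "real_of_ereal (essinf lebesgue P) \<le> real_of_ereal (esssup lebesgue P)"
      using order_trans[OF x0] e1 e2 by (metis ereal_less_eq(3))
    show "AE x in lebesgue. real_of_ereal (essinf lebesgue P) \<le> ?p x \<and> ?p x \<le> real_of_ereal (esssup lebesgue P)"
      using lo hi by eventually_elim (metis e1 e2 fin ereal_less_eq(3))
    show "0 < ?p x" for x using ve(2)[of x] fin[of x] by (metis ereal_less(2))
    show "\<bar>?p x - ?p y\<bar> \<le> cl / ln (exp 1 + 1 / qnorm A \<Delta> (x - y))" for x y
      using c(3)[of x y] by (subst (asm) (1 2) fin) simp
    show "\<bar>?p x - p0\<bar> \<le> ci / ln (exp 1 + qnorm A \<Delta> x)" for x
      using c(4)[of x] by (subst (asm) fin) simp
  qed (use qnorm_pos qnorm_le qnorm_less_imp c in auto)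
  then show ?thesis by blast
qed

context dilated_balls
begin

lemma areasq_cmult:
  assumes "slices_measurable g"
  shows "areasq (\<lambda>z. ennreal c * g z) x = ennreal c * areasq g x"
proof -
  have [measurable]: "(\<lambda>y. g (y, l)) \<in> borel_measurable lebesgue" for l
    using assms by (simp add: slices_measurable_def)
  have "area_at (\<lambda>z. ennreal c * g z) l x = ennreal c * area_at g l x" for l
    unfolding area_at_def by (simp add: mult.assoc nn_integral_cmult mult.left_commute)
  then show ?thesis unfolding areasq_def by (simp add: nn_integral_cmult)
qed

end

locale tent_setting = ellipsoid_dilation A \<Delta> r0
  + stopping_parameters "Bk A \<Delta>" "dil A" "int tau" cell ctr "nat (2 * spread + 1) ^ CARD('n)"
      "qnorm A \<Delta>" "\<lambda>x. real_of_ereal (P x)" pm pp cl ci pinf \<theta> L pu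
  for A :: "real^'n^'n" and \<Delta> :: "(real^'n) set" and r0 :: real and P :: "real^'n \<Rightarrow> ereal"
    and pm pp cl ci pinf \<theta> L pu :: real +
  assumes pu_eq: "p_under P = pu"
begin

abbreviation "pr x \<equiv> real_of_ereal (P x)"

definition msq :: "((real^'n) \<times> int \<Rightarrow> complex) \<Rightarrow> (real^'n) \<times> int \<Rightarrow> ennreal" where
  "msq G z = ennreal ((cmod (G z))\<^sup>2)"

lemma msq_slices:
  assumes "G \<in> borel_measurable RnZ"
  shows "slices_measurable (msq G)"
  unfolding slices_measurable_def msq_def
proof
  fix l
  note [measurable] = RnZ_slice_measurable[OF assms, of l]
  show "(\<lambda>y. ennreal ((cmod (G (y, l)))\<^sup>2)) \<in> borel_measurable lebesgue" by measurable
qed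

lemma area_eq: "area A \<Delta> G x = ennpowr (areasq (msq G) x) (1 / 2)"
proof -
  have "{y. (y, l) \<in> Gamma_cone A \<Delta> x} = dball x l" for l
    by (auto simp: Gamma_cone_def dball_def)
  then show ?thesis
    unfolding area_def areasq_def infsum_eq_nn_integral_int by (simp add: area_at_def msq_def)
qed

definition bnorm :: "real^'n \<Rightarrow> int \<Rightarrow> real" where
  "bnorm x k = enn2real (Lp_var_norm P (indicator (dball x k)))"

lemma ball_norm_finite: "Lp_var_norm P (indicator (dball x k)) < \<infinity>"
proof -
  define t where "t = max 1 ((dil A powi k) powr (1 / pm))"
  have t: "1 \<le> t" by (simp add: t_def)
  have "(1 / t) powr pm * dil A powi k \<le> 1"
  proof -
    have "dil A powi k = ((dil A powi k) powr (1 / pm)) powr pm"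
      using pm_pos by (simp add: powr_powr)
    also have "\<dots> \<le> t powr pm" unfolding t_def using pm_pos by (intro powr_mono2) auto
    finally show ?thesis using t by (simp add: powr_divide pos_divide_le_eq)
  qed
  have "(\<integral>\<^sup>+y. ennpowr (indicator (dball x k) y / ennreal t) (pr y) \<partial>lebesgue)
      \<le> (\<integral>\<^sup>+y. ennreal ((1 / t) powr pm) * indicator (dball x k) y \<partial>lebesgue)"
  proof (rule nn_integral_mono_AE)
    show "AE y in lebesgue. ennpowr (indicator (dball x k) y / ennreal t) (pr y)
        \<le> ennreal ((1 / t) powr pm) * indicator (dball x k) y"
      using p_bounds
    proof eventually_elim
      case (elim y)
      have "(1 / t) powr pr y \<le> (1 / t) powr pm" using elim t by (intro powr_mono') auto
      then show ?case using t
        by (cases "y \<in> dball x k") (auto simp: divide_ennreal_pos ennpowr_ennreal ennreal_leI)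
    qed
  qed
  also have "\<dots> = ennreal ((1 / t) powr pm) * emeasure lebesgue (dball x k)"
    by (rule nn_integral_cmult_indicator) simp
  also have "\<dots> = ennreal ((1 / t) powr pm * dil A powi k)"
    by (simp only: emeasure_dball) (simp add: ennreal_mult)
  also have "\<dots> \<le> 1" using \<open>(1 / t) powr pm * dil A powi k \<le> 1\<close> by simp
  finally have "Lp_var_norm P (indicator (dball x k)) \<le> ennreal t" using t by (intro Lp_var_norm_le) auto
  then show ?thesis by (rule le_less_trans) simp
qed

lemma ball_norm_pos: "0 < Lp_var_norm P (indicator (dball x k))"
proof -
  define t0 where "t0 = min 1 ((dil A powi k) powr (1 / pm))"
  have t0: "0 < t0" using dil_gt_1 by (simp add: t0_def)
  have "ennreal t0 \<le> Lp_var_norm P (indicator (dball x k))"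
  proof (rule ccontr)
    assume "\<not> ?thesis"
    then have "Lp_var_norm P (indicator (dball x k)) < ennreal t0" by (simp only: not_le)
    then obtain t where t: "0 < t" "ennreal t < ennreal t0"
      "(\<integral>\<^sup>+y. ennpowr (indicator (dball x k) y / ennreal t) (pr y) \<partial>lebesgue) \<le> 1"
      by (rule Lp_var_norm_lessE)
    have tt: "t < t0" "t < 1" using t(1,2) by (auto simp: ennreal_less_iff t0_def)
    have "ennreal ((1 / t) powr pm * dil A powi k) = ennreal ((1 / t) powr pm) * emeasure lebesgue (dball x k)"
      by (simp only: emeasure_dball) (simp add: ennreal_mult)
    also have "\<dots> = (\<integral>\<^sup>+y. ennreal ((1 / t) powr pm) * indicator (dball x k) y \<partial>lebesgue)"
      by (rule nn_integral_cmult_indicator[symmetric]) simp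
    also have "\<dots> \<le> (\<integral>\<^sup>+y. ennpowr (indicator (dball x k) y / ennreal t) (pr y) \<partial>lebesgue)"
    proof (rule nn_integral_mono_AE)
      show "AE y in lebesgue. ennreal ((1 / t) powr pm) * indicator (dball x k) y
          \<le> ennpowr (indicator (dball x k) y / ennreal t) (pr y)"
        using p_bounds
      proof eventually_elim
        case (elim y)
        have "(1 / t) powr pm \<le> (1 / t) powr pr y" using elim t(1) tt by (intro powr_mono) auto
        then show ?case using t(1)
          by (cases "y \<in> dball x k") (auto simp: divide_ennreal_pos ennpowr_ennreal ennreal_leI)
      qed
    qed
    also note t(3)
    finally have "(1 / t) powr pm * dil A powi k \<le> 1" by simp
    then have "dil A powi k \<le> t powr pm" using t(1) by (simp add: powr_divide pos_divide_le_eq)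
    then have "(dil A powi k) powr (1 / pm) \<le> (t powr pm) powr (1 / pm)"
      using pm_pos by (intro powr_mono2) auto
    also have "\<dots> = t" using t(1) pm_pos by (simp add: powr_powr)
    finally show False using tt(1) by (simp add: t0_def)
  qed
  then show ?thesis using t0 by (meson ennreal_less_zero_iff less_le_trans)
qed

lemma bnorm_eq: "Lp_var_norm P (indicator (dball x k)) = ennreal (bnorm x k)"
  using ball_norm_finite[of x k] by (simp add: bnorm_def)

lemma bnorm_pos: "0 < bnorm x k"
  using ball_norm_pos[of x k] unfolding bnorm_eq by simp

lemma dball_dballs: "dball x k \<in> dballs A \<Delta>"
  unfolding dballs_def dball_def by blast

lemma tent_dball: "(y, l) \<in> tent A \<Delta> S \<longleftrightarrow> dball y l \<subseteq> S"
  by (simp add: tent_def dball_def)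

text \<open>
  The area function of \<open>a\<close> is supported in the ball, because the tent condition puts the vertex of
  every cone that meets the support into it; the \<open>L\<^sup>q\<close> bound is then immediate for all \<open>q\<close>.
\<close>

lemma bounded_area_atom:
  assumes meas: "a \<in> borel_measurable RnZ" and supp: "\<And>y l. a (y, l) \<noteq> 0 \<Longrightarrow> dball y l \<subseteq> dball x k"
    and bound: "\<And>u. areasq (msq a) u \<le> ennreal ((1 / bnorm x k)\<^sup>2)"
  shows "atom_inf A \<Delta> P (dball x k) a"
  unfolding atom_inf_def
proof (intro allI impI)
  fix s :: real assume s: "1 < s"
  define \<beta> where "\<beta> = 1 / bnorm x k"
  have b0: "0 < \<beta>" using bnorm_pos by (simp add: \<beta>_def)
  have ar: "area A \<Delta> a u \<le> ennreal \<beta> * indicator (dball x k) u" for u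
  proof (cases "u \<in> dball x k")
    case True
    have "area A \<Delta> a u \<le> ennpowr (ennreal (\<beta>\<^sup>2)) (1 / 2)"
      unfolding area_eq using bound[of u] by (intro ennpowr_mono) (auto simp: \<beta>_def)
    also have "\<dots> = ennreal \<beta>" using b0 by (simp add: ennpowr_ennreal powr_half_sqrt)
    finally show ?thesis using True by simp
  next
    case False
    have "area_at (msq a) l u = 0" for l
    proof (rule area_at_eq_0)
      fix y assume y: "y \<in> dball u l"
      show "msq a (y, l) = 0"
      proof (rule ccontr)
        assume "msq a (y, l) \<noteq> 0"
        then have "a (y, l) \<noteq> 0" by (auto simp: msq_def)
        then have "dball y l \<subseteq> dball x k" by (rule supp)
        with y False show False using mem_dball_commute[of y u l] by blast
      qed
    qed
    then show ?thesis unfolding area_eq areasq_def by simp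
  qed
  have "(\<integral>\<^sup>+u. ennpowr (area A \<Delta> a u) s \<partial>lebesgue)
      \<le> (\<integral>\<^sup>+u. ennreal (\<beta> powr s) * indicator (dball x k) u \<partial>lebesgue)"
  proof (rule nn_integral_mono)
    fix u
    have "ennpowr (area A \<Delta> a u) s \<le> ennpowr (ennreal \<beta> * indicator (dball x k) u) s"
      using ar[of u] s by (intro ennpowr_mono) auto
    also have "\<dots> = ennreal (\<beta> powr s) * indicator (dball x k) u"
      using b0 by (cases "u \<in> dball x k") (auto simp: ennpowr_ennreal)
    finally show "ennpowr (area A \<Delta> a u) s \<le> ennreal (\<beta> powr s) * indicator (dball x k) u" .
  qed
  also have "\<dots> = ennreal (\<beta> powr s) * emeasure lebesgue (dball x k)"
    by (rule nn_integral_cmult_indicator) simp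
  finally have "Lq_norm s (area A \<Delta> a) \<le> ennpowr (ennreal (\<beta> powr s) * emeasure lebesgue (dball x k)) (1 / s)"
    unfolding Lq_norm_def using s by (intro ennpowr_mono) auto
  also have "\<dots> = ennreal ((\<beta> powr s) powr (1 / s)) * ennpowr (emeasure lebesgue (dball x k)) (1 / s)"
    using s by (intro ennpowr_mult) auto
  also have "(\<beta> powr s) powr (1 / s) = \<beta>" using s b0 by (simp add: powr_powr)
  also have "ennreal \<beta> * ennpowr (emeasure lebesgue (dball x k)) (1 / s)
      = ennpowr (emeasure lebesgue (dball x k)) (1 / s) / Lp_var_norm P (indicator (dball x k))"
    unfolding bnorm_eq divide_ennreal_pos[OF bnorm_pos] \<beta>_def ..
  finally show "atom A \<Delta> P s (dball x k) a"
    unfolding atom_def using meas dball_dballs supp by (auto simp: tent_dball simp del: emeasure_completion)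
qed

definition norm_const :: real where "norm_const = max 1 (modular_const powr (1 / pm))"

lemma modular_const_nonneg: "0 \<le> modular_const"
  unfolding modular_const_def using stop_const_nonneg by simp

lemma norm_const_absorbs: "(1 / norm_const) powr pm * modular_const \<le> 1"
proof -
  have C: "1 \<le> norm_const" by (simp add: norm_const_def)
  have "modular_const = (modular_const powr (1 / pm)) powr pm" using pm_pos modular_const_nonneg by (simp add: powr_powr)
  also have "\<dots> \<le> norm_const powr pm" unfolding norm_const_def using pm_pos by (intro powr_mono2) auto
  finally show ?thesis using C by (simp add: powr_divide pos_divide_le_eq)
qed

text \<open>
  All pieces are multiples of \<open>G\<close> restricted to disjoint sets, so at each point both series have
  at most one nonzero term.
\<close>

lemma atomic_decomposition:
  assumes G: "G \<in> borel_measurable RnZ" and t: "0 < t"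
    and mod: "(\<integral>\<^sup>+x. ennpowr (area A \<Delta> G x / ennreal t) (pr x) \<partial>lebesgue) \<le> 1"
  shows "\<exists>(lam :: nat \<Rightarrow> real) (Q :: nat \<Rightarrow> (real^'n) set) (a :: nat \<Rightarrow> (real^'n) \<times> int \<Rightarrow> complex).
        (\<forall>j. lam j \<ge> 0) \<and> (\<forall>j. Q j \<in> dballs A \<Delta>) \<and> (\<forall>j. atom_inf A \<Delta> P (Q j) (a j)) \<and>
        (AE z in RnZ. (\<lambda>j. complex_of_real (lam j) * a j z) sums G z \<and>
                      (\<lambda>j. lam j * cmod (a j z)) sums cmod (G z)) \<and>
        Lp_var_norm P (\<lambda>x. ennpowr
            (\<Sum>j. ennpowr (ennreal (lam j) / Lp_var_norm P (indicator (Q j))) pu * indicator (Q j) x)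
            (1 / pu)) \<le> ennreal (t * norm_const)"
proof -
  define h where "h z = ennreal ((1 / t)\<^sup>2) * msq G z" for z
  have ms: "slices_measurable (msq G)" by (rule msq_slices[OF G])
  have hs: "slices_measurable h"
    using ms unfolding slices_measurable_def h_def by (intro allI borel_measurable_times_ennreal) auto
  have h_area: "areasq h x = ennreal ((1 / t)\<^sup>2) * areasq (msq G) x" for x
    unfolding h_def[abs_def] by (rule areasq_cmult[OF ms])
  have "ennpowr (areasq h x) (pr x / 2) = ennpowr (area A \<Delta> G x / ennreal t) (pr x)" for x
  proof -
    have "area A \<Delta> G x / ennreal t = ennreal (((1 / t)\<^sup>2) powr (1 / 2)) * ennpowr (areasq (msq G) x) (1 / 2)"
      using t by (simp add: divide_ennreal_pos area_eq powr_half_sqrt)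
    also have "\<dots> = ennpowr (areasq h x) (1 / 2)"
      unfolding h_area using t by (intro ennpowr_mult[symmetric]) auto
    finally show ?thesis by (simp add: ennpowr_ennpowr)
  qed
  then have hm: "(\<integral>\<^sup>+x. ennpowr (areasq h x) (pr x / 2) \<partial>lebesgue) \<le> 1" using mod by simp
  interpret na: normalised_area "Bk A \<Delta>" "dil A" "int tau" cell ctr "nat (2 * spread + 1) ^ CARD('n)"
      "qnorm A \<Delta>" "\<lambda>x. real_of_ereal (P x)" pm pp cl ci pinf \<theta> L pu h
    using hs hm by unfold_locales
  define jb where "jb j = (case j of (i, m, k, z) \<Rightarrow> bnorm (ctr k z) (k + int tau))" for j :: "int \<times> nat \<times> int \<times> (int^'n)"
  have jb_pos: "0 < jb j" for j unfolding jb_def by (simp add: bnorm_pos split: prod.splits)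
  have index_ball: "na.index_ball (i, m, k, z) = dball (ctr k z) (k + int tau)" for i m k z
    by (simp add: na.index_ball_def whitney_ball_def)
  have jnorm: "Lp_var_norm P (indicator (na.index_ball j)) = ennreal (jb j)" for j
    by (cases j) (simp add: index_ball jb_def bnorm_eq)
  have coef_nonneg: "0 \<le> na.coef j" for j
    using na.piece_bound_pos by (auto simp: na.coef_def less_imp_le split: prod.splits)
  have coef_pos: "0 < na.coef j" if "q \<in> na.piece j" for q j
  proof -
    obtain i m k z where j: "j = (i, m, k, z)" by (cases j)
    have "(k, z) \<in> used (na.stopset_at i m)" using that unfolding j by (rule na.piece_used)
    then show ?thesis using na.piece_bound_pos by (simp add: na.coef_def j)
  qed
  define lam where "lam j = t * na.coef j * jb j" for j
  define a where "a j q = (if q \<in> na.piece j then G q / complex_of_real (lam j) else 0)" for j q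
  have lam_nonneg: "0 \<le> lam j" for j
    unfolding lam_def using t coef_nonneg jb_pos[of j] by (intro mult_nonneg_nonneg) (auto simp: less_imp_le)
  have lam_pos: "0 < lam j" if "q \<in> na.piece j" for q j
    unfolding lam_def using t coef_pos[OF that] jb_pos by simp
  have piece_sets: "na.piece j \<in> sets RnZ" for j
    by (rule RnZ_sets_slices) (rule na.piece_slice)
  have a_meas: "a j \<in> borel_measurable RnZ" for j
  proof -
    have "a j = (\<lambda>q. if q \<in> na.piece j then G q / complex_of_real (lam j) else 0)" by (auto simp: a_def)
    moreover have "(\<lambda>q. if q \<in> na.piece j then G q / complex_of_real (lam j) else 0) \<in> borel_measurable RnZ"
      using piece_sets[of j] G by measurable
    ultimately show ?thesis by simp
  qed
  have atom: "atom_inf A \<Delta> P (na.index_ball j) (a j)" for j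
  proof -
    obtain i m k z where j: "j = (i, m, k, z)" by (cases j)
    show ?thesis unfolding j index_ball
    proof (rule bounded_area_atom[OF a_meas])
      show "dball y l \<subseteq> dball (ctr k z) (k + int tau)" if "a (i, m, k, z) (y, l) \<noteq> 0" for y l
      proof -
        have "(y, l) \<in> na.piece (i, m, k, z)" using that by (auto simp: a_def split: if_splits)
        from na.piece_tent[OF this] show ?thesis by (simp add: whitney_ball_def)
      qed
      fix u
      define g where "g q = (if q \<in> na.piece (i, m, k, z) then h q else 0)" for q
      define c where "c = (1 / (na.coef j * jb j))\<^sup>2"
      have gs: "slices_measurable g"
        unfolding slices_measurable_def
      proof
        fix l
        have "(\<lambda>y. g (y, l)) = (\<lambda>y. h (y, l) * indicator {y. (y, l) \<in> na.piece (i, m, k, z)} y)"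
          by (auto simp: g_def fun_eq_iff)
        then show "(\<lambda>y. g (y, l)) \<in> borel_measurable lebesgue"
          using hs na.piece_slice[of l "(i, m, k, z)"]
          by (simp only: slices_measurable_def borel_measurable_times_ennreal borel_measurable_indicator)
      qed
      have "msq (a j) q = ennreal c * g q" for q
      proof (cases "q \<in> na.piece j")
        case True
        have "(cmod (G q) / lam j)\<^sup>2 = c * ((1 / t)\<^sup>2 * (cmod (G q))\<^sup>2)"
          unfolding c_def lam_def by (simp add: power_divide power_mult_distrib)
        then show ?thesis using True lam_nonneg[of j] unfolding msq_def a_def g_def h_def j[symmetric]
          by (simp add: norm_divide ennreal_mult c_def)
      qed (simp add: msq_def a_def g_def j)
      then have "areasq (msq (a j)) u = ennreal c * areasq g u"
        using areasq_cmult[OF gs, of c u] by (metis ext)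
      also have "\<dots> \<le> ennreal ((1 / jb j)\<^sup>2)"
      proof (cases "na.piece j = {}")
        case True
        then have "area_at g l u = 0" for l by (intro area_at_eq_0) (simp add: g_def j)
        then show ?thesis by (simp add: areasq_def)
      next
        case False
        then have cp: "0 < na.coef j" using coef_pos by blast
        then have cm: "na.coef j = na.piece_bound i m" by (auto simp: na.coef_def j split: if_splits)
        have "areasq g u \<le> ennreal ((na.piece_bound i m)\<^sup>2)"
          unfolding na.piece_bound_sq g_def[abs_def] by (rule na.piece_area)
        then have "ennreal c * areasq g u \<le> ennreal c * ennreal ((na.piece_bound i m)\<^sup>2)" by (rule mult_left_mono) simp
        also have "\<dots> = ennreal (c * (na.piece_bound i m)\<^sup>2)" by (rule ennreal_mult[symmetric]) (auto simp: c_def)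
        also have "c * (na.piece_bound i m)\<^sup>2 = (1 / jb j)\<^sup>2"
          using cp unfolding c_def cm by (simp add: power_divide power_mult_distrib)
        finally show ?thesis .
      qed
      finally show "areasq (msq (a (i, m, k, z))) u \<le> ennreal ((1 / bnorm (ctr k z) (k + int tau))\<^sup>2)"
        by (simp add: j jb_def)
    qed
  qed
  have inf: "infinite (UNIV :: (int \<times> nat \<times> int \<times> (int^'n)) set)"
    by (simp add: finite_prod infinite_UNIV_int)
  define \<phi> where "\<phi> = from_nat_into (UNIV :: (int \<times> nat \<times> int \<times> (int^'n)) set)"
  have bij: "bij_betw \<phi> UNIV UNIV"
    unfolding \<phi>_def using inf by (intro bij_betw_from_nat_into) auto
  have sums1: "(\<lambda>n. complex_of_real (lam (\<phi> n)) * a (\<phi> n) q) sums G q \<and>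
      (\<lambda>n. lam (\<phi> n) * cmod (a (\<phi> n) q)) sums cmod (G q)"
    if q: "G q \<noteq> 0 \<longrightarrow> (\<exists>j. q \<in> na.piece j)" for q
  proof (cases "\<exists>j. q \<in> na.piece j")
    case True
    then obtain j where j: "q \<in> na.piece j" by blast
    obtain n0 where n0: "\<phi> n0 = j" using bij by (metis bij_betw_def UNIV_I imageE)
    have other: "q \<notin> na.piece (\<phi> n)" if "n \<noteq> n0" for n
    proof
      assume "q \<in> na.piece (\<phi> n)"
      then have "\<phi> n = \<phi> n0" using na.piece_unique[OF _ j] n0 by simp
      then show False using that bij by (metis bij_betw_def injD)
    qed
    have "(\<lambda>n. complex_of_real (lam (\<phi> n)) * a (\<phi> n) q) = (\<lambda>n. if n = n0 then G q else 0)"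
      using other lam_pos[OF j] j by (auto simp: fun_eq_iff a_def n0)
    moreover have "(\<lambda>n. lam (\<phi> n) * cmod (a (\<phi> n) q)) = (\<lambda>n. if n = n0 then cmod (G q) else 0)"
      using other lam_pos[OF j] j by (auto simp: fun_eq_iff a_def n0 norm_divide)
    ultimately show ?thesis using sums_single[of n0 "\<lambda>_. G q"] sums_single[of n0 "\<lambda>_. cmod (G q)"] by simp
  next
    case False
    with q have "G q = 0" by blast
    moreover have "a (\<phi> n) q = 0" for n
    proof -
      have "q \<notin> na.piece (\<phi> n)" using False by blast
      then show ?thesis by (simp add: a_def)
    qed
    ultimately show ?thesis by simp
  qed
  have AEq: "AE q in RnZ. G q \<noteq> 0 \<longrightarrow> (\<exists>j. q \<in> na.piece j)"
  proof (rule AE_RnZ_slices)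
    have "{q. \<not> (G q \<noteq> 0 \<longrightarrow> (\<exists>j. q \<in> na.piece j))} = {q \<in> space RnZ. G q \<noteq> 0} - (\<Union>j. na.piece j)"
      by (auto simp: RnZ_def space_pair_measure)
    also have "\<dots> \<in> sets RnZ"
      using G piece_sets by (intro sets.Diff sets.countable_UN) auto
    finally show "{q. \<not> (G q \<noteq> 0 \<longrightarrow> (\<exists>j. q \<in> na.piece j))} \<in> sets RnZ" .
    show "AE y in lebesgue. G (y, l) \<noteq> 0 \<longrightarrow> (\<exists>j. (y, l) \<in> na.piece j)" for l
      using na.AE_piece[of l]
    proof eventually_elim
      case (elim y)
      show ?case
      proof
        assume "G (y, l) \<noteq> 0"
        then have "h (y, l) \<noteq> 0" using t by (simp add: h_def msq_def)
        with elim show "\<exists>j. (y, l) \<in> na.piece j" by blast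
      qed
    qed
  qed
  have sum_eq: "(\<Sum>n. ennpowr (ennreal (lam (\<phi> n)) / Lp_var_norm P (indicator (na.index_ball (\<phi> n)))) pu
        * indicator (na.index_ball (\<phi> n)) x) = ennreal (t powr pu) * na.coef_sum x" for x
  proof -
    have "ennpowr (ennreal (lam j) / Lp_var_norm P (indicator (na.index_ball j))) pu * indicator (na.index_ball j) x
        = ennreal (t powr pu) * (ennpowr (ennreal (na.coef j)) pu * indicator (na.index_ball j) x)" for j
    proof -
      have "ennreal (lam j) / ennreal (jb j) = ennreal (t * na.coef j)"
        using jb_pos[of j] lam_nonneg[of j] by (simp add: divide_ennreal lam_def)
      also have "\<dots> = ennreal t * ennreal (na.coef j)" using t coef_nonneg by (simp add: ennreal_mult)
      finally show ?thesis unfolding jnorm using t pu(1) by (simp add: ennpowr_mult mult.assoc)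
    qed
    then have "(\<Sum>n. ennpowr (ennreal (lam (\<phi> n)) / Lp_var_norm P (indicator (na.index_ball (\<phi> n)))) pu
        * indicator (na.index_ball (\<phi> n)) x)
        = (\<Sum>n. ennreal (t powr pu) * (ennpowr (ennreal (na.coef (\<phi> n))) pu * indicator (na.index_ball (\<phi> n)) x))"
      by simp
    also have "\<dots> = ennreal (t powr pu) * (\<Sum>n. ennpowr (ennreal (na.coef (\<phi> n))) pu * indicator (na.index_ball (\<phi> n)) x)"
      by simp
    also have "(\<Sum>n. ennpowr (ennreal (na.coef (\<phi> n))) pu * indicator (na.index_ball (\<phi> n)) x) = na.coef_sum x"
      unfolding na.coef_sum_def
      by (subst nn_integral_bij_count_space[OF bij, symmetric]) (rule nn_integral_count_space_nat[symmetric])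
    finally show ?thesis .
  qed
  have C: "1 \<le> norm_const" by (simp add: norm_const_def)
  have cs_meas [measurable]: "na.coef_sum \<in> borel_measurable lebesgue"
    unfolding na.coef_sum_def[abs_def]
  proof (rule nn_integral_countable_measurable)
    fix j
    have "na.index_ball j \<in> sets lebesgue" by (cases j) (simp add: index_ball)
    then show "(\<lambda>x. ennpowr (ennreal (na.coef j)) pu * indicator (na.index_ball j) x) \<in> borel_measurable lebesgue" by simp
  qed
  have "(\<integral>\<^sup>+x. ennpowr (ennpowr (ennreal (t powr pu) * na.coef_sum x) (1 / pu) / ennreal (t * norm_const)) (pr x) \<partial>lebesgue)
      \<le> (\<integral>\<^sup>+x. ennreal ((1 / norm_const) powr pm) * ennpowr (na.coef_sum x) (pr x / pu) \<partial>lebesgue)"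
  proof (rule nn_integral_mono_AE)
    show "AE x in lebesgue. ennpowr (ennpowr (ennreal (t powr pu) * na.coef_sum x) (1 / pu) / ennreal (t * norm_const)) (pr x)
      \<le> ennreal ((1 / norm_const) powr pm) * ennpowr (na.coef_sum x) (pr x / pu)"
      using p_bounds
    proof eventually_elim
      case (elim x)
      have p0: "0 < pr x" by (rule p_pos)
      have "ennpowr (ennreal (t powr pu) * na.coef_sum x) (1 / pu) / ennreal (t * norm_const)
          = ennreal (1 / (t * norm_const)) * (ennreal ((t powr pu) powr (1 / pu)) * ennpowr (na.coef_sum x) (1 / pu))"
        using t C pu by (subst divide_ennreal_pos) (auto simp: ennpowr_mult)
      also have "(t powr pu) powr (1 / pu) = t" using t pu by (simp add: powr_powr)
      also have "ennreal (1 / (t * norm_const)) * (ennreal t * ennpowr (na.coef_sum x) (1 / pu))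
          = ennreal (1 / norm_const) * ennpowr (na.coef_sum x) (1 / pu)"
        using t C by (simp add: mult.assoc[symmetric] ennreal_mult[symmetric])
      finally have "ennpowr (ennpowr (ennreal (t powr pu) * na.coef_sum x) (1 / pu) / ennreal (t * norm_const)) (pr x)
          = ennreal ((1 / norm_const) powr pr x) * ennpowr (na.coef_sum x) (pr x / pu)"
        using C p0 by (simp add: ennpowr_mult ennpowr_ennpowr)
      also have "\<dots> \<le> ennreal ((1 / norm_const) powr pm) * ennpowr (na.coef_sum x) (pr x / pu)"
        using C elim by (intro mult_right_mono ennreal_leI powr_mono') auto
      finally show ?case .
    qed
  qed
  also have "\<dots> = ennreal ((1 / norm_const) powr pm) * (\<integral>\<^sup>+x. ennpowr (na.coef_sum x) (pr x / pu) \<partial>lebesgue)"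
    by (rule nn_integral_cmult) measurable
  also have "\<dots> \<le> ennreal ((1 / norm_const) powr pm) * ennreal modular_const"
    by (intro mult_left_mono na.coef_sum_modular) simp
  also have "\<dots> = ennreal ((1 / norm_const) powr pm * modular_const)" using modular_const_nonneg by (simp add: ennreal_mult)
  also have "\<dots> \<le> 1" using norm_const_absorbs by simp
  finally have norm: "Lp_var_norm P (\<lambda>x. ennpowr (ennreal (t powr pu) * na.coef_sum x) (1 / pu)) \<le> ennreal (t * norm_const)"
    using t C by (intro Lp_var_norm_le) auto
  show ?thesis
  proof (intro exI[of _ "\<lambda>n. lam (\<phi> n)"] exI[of _ "\<lambda>n. na.index_ball (\<phi> n)"] exI[of _ "\<lambda>n. a (\<phi> n)"] conjI allI)
    show "na.index_ball (\<phi> n) \<in> dballs A \<Delta>" for n by (cases "\<phi> n") (simp add: index_ball dball_dballs)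
    show "AE q in RnZ. (\<lambda>n. complex_of_real (lam (\<phi> n)) * a (\<phi> n) q) sums G q \<and>
        (\<lambda>n. lam (\<phi> n) * cmod (a (\<phi> n) q)) sums cmod (G q)"
      using AEq by eventually_elim (rule sums1)
    show "Lp_var_norm P (\<lambda>x. ennpowr (\<Sum>n. ennpowr (ennreal (lam (\<phi> n)) / Lp_var_norm P (indicator (na.index_ball (\<phi> n)))) pu
        * indicator (na.index_ball (\<phi> n)) x) (1 / pu)) \<le> ennreal (t * norm_const)"
      unfolding sum_eq by (rule norm)
  qed (use lam_nonneg atom in auto)
qed

text \<open>
  The case excluded by normalisation: scaling by \<open>2\<^sup>i\<close> keeps the modular below one for all \<open>i\<close>, so
  \<open>\<A>(G) = 0\<close> almost everywhere, and Tonelli gives \<open>G = 0\<close>.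
\<close>

lemma zero_tent_norm:
  assumes G: "G \<in> borel_measurable RnZ" and zero: "tent_norm A \<Delta> P G = 0"
  shows "AE z in RnZ. G z = 0"
proof -
  have ms: "slices_measurable (msq G)" by (rule msq_slices[OF G])
  have am [measurable]: "areasq (msq G) \<in> borel_measurable lebesgue" by (rule areasq_measurable[OF ms])
  define I where "I = (\<integral>\<^sup>+x. ennpowr (area A \<Delta> G x) (pr x) \<partial>lebesgue)"
  have [measurable]: "(\<lambda>x. ennpowr (area A \<Delta> G x) (pr x)) \<in> borel_measurable lebesgue"
    unfolding area_eq by measurable
  have small: "ennreal ((2 ^ i) powr pm) * I \<le> 1" for i :: nat
  proof -
    have "Lp_var_norm P (area A \<Delta> G) < ennreal (1 / 2 ^ i)"
      using zero by (simp add: tent_norm_def)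
    then obtain t where t: "0 < t" "ennreal t < ennreal (1 / 2 ^ i)"
      "(\<integral>\<^sup>+x. ennpowr (area A \<Delta> G x / ennreal t) (pr x) \<partial>lebesgue) \<le> 1"
      by (rule Lp_var_norm_lessE)
    have t1: "2 ^ i \<le> 1 / t" using t(1,2) by (simp add: ennreal_less_iff field_simps)
    have "ennreal ((2 ^ i) powr pm) * I = (\<integral>\<^sup>+x. ennreal ((2 ^ i) powr pm) * ennpowr (area A \<Delta> G x) (pr x) \<partial>lebesgue)"
      unfolding I_def by (rule nn_integral_cmult[symmetric]) measurable
    also have "\<dots> \<le> (\<integral>\<^sup>+x. ennpowr (area A \<Delta> G x / ennreal t) (pr x) \<partial>lebesgue)"
    proof (rule nn_integral_mono_AE)
      show "AE x in lebesgue. ennreal ((2 ^ i) powr pm) * ennpowr (area A \<Delta> G x) (pr x)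
          \<le> ennpowr (area A \<Delta> G x / ennreal t) (pr x)"
        using p_bounds
      proof eventually_elim
        case (elim x)
        have "(2 ^ i) powr pm \<le> (2 ^ i) powr pr x" using elim by (intro powr_mono) auto
        also have "\<dots> \<le> (1 / t) powr pr x" using t1 p_pos[of x] by (intro powr_mono2) auto
        finally show ?case
          using t(1) p_pos[of x] by (simp add: divide_ennreal_pos ennpowr_mult mult_right_mono ennreal_leI)
      qed
    qed
    also note t(3)
    finally show ?thesis .
  qed
  have "I \<le> ennreal (((1 / 2) powr pm) ^ i)" for i :: nat
  proof -
    have "((1 / 2) powr pm) ^ i * (2 ^ i) powr pm = 1"
    proof -
      have "((1 / 2) powr pm) ^ i = (1 / 2 ^ i) powr pm"
      proof -
        have "((1 / 2) powr pm) ^ i = ((1 / 2) powr pm) powr real i" by (simp add: powr_realpow)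
        also have "\<dots> = ((1 / 2) powr real i) powr pm" by (simp only: powr_powr mult.commute)
        also have "(1 / 2 :: real) powr real i = 1 / 2 ^ i" by (simp add: powr_realpow power_one_over)
        finally show ?thesis .
      qed
      then show ?thesis by (simp add: powr_mult[symmetric])
    qed
    then have "I = ennreal (((1 / 2) powr pm) ^ i) * (ennreal ((2 ^ i) powr pm) * I)"
      by (simp add: mult.assoc[symmetric] ennreal_mult[symmetric])
    also have "\<dots> \<le> ennreal (((1 / 2) powr pm) ^ i) * 1" by (intro mult_left_mono small) simp
    finally show ?thesis by simp
  qed
  moreover have "(\<lambda>i. ennreal (((1 / 2) powr pm) ^ i)) \<longlonglongrightarrow> ennreal 0"
  proof (intro tendsto_ennrealI LIMSEQ_power_zero)
    have "(1 / 2 :: real) powr pm = 2 powr (- pm)" by (simp add: powr_minus powr_divide inverse_eq_divide)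
    then show "norm ((1 / 2 :: real) powr pm) < 1" using pm_pos by (simp add: powr_less_one)
  qed
  ultimately have "I \<le> ennreal 0" by (intro LIMSEQ_le_const) auto
  then have "I = 0" by simp
  then have "AE x in lebesgue. ennpowr (area A \<Delta> G x) (pr x) = 0"
    unfolding I_def by (subst (asm) nn_integral_0_iff_AE) auto
  then have "AE x in lebesgue. areasq (msq G) x = 0"
  proof eventually_elim
    case (elim x)
    then have "ennpowr (areasq (msq G) x) (1 / 2 * pr x) = 0" by (simp add: area_eq ennpowr_ennpowr)
    then show ?case by (cases "areasq (msq G) x") (auto simp: ennpowr_def split: if_splits)
  qed
  then have zero_area_at: "AE x in lebesgue. area_at (msq G) l x = 0" for l
  proof eventually_elim
    case (elim x)
    then show ?case using area_at_le_areasq[of "msq G" l x] by simp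
  qed
  show ?thesis
  proof (rule AE_RnZ_slices)
    have "{z. G z \<noteq> 0} = {z \<in> space RnZ. G z \<noteq> 0}" by (auto simp: RnZ_def space_pair_measure)
    also have "\<dots> \<in> sets RnZ" using G by measurable
    finally show "{z. G z \<noteq> 0} \<in> sets RnZ" .
    fix l
    have gm: "(\<lambda>y. msq G (y, l)) \<in> borel_measurable lebesgue"
      using ms by (simp add: slices_measurable_def)
    have "AE x in lebesgue. (\<integral>\<^sup>+y\<in>dball x l. msq G (y, l) \<partial>lebesgue) * indicator UNIV x = 0"
      using zero_area_at[of l]
      by eventually_elim (use ennreal_b_powi_ne_0[of "- l"] in \<open>simp add: area_at_def\<close>)
    then have "(\<integral>\<^sup>+x\<in>UNIV. (\<integral>\<^sup>+y\<in>dball x l. msq G (y, l) \<partial>lebesgue) \<partial>lebesgue) = (\<integral>\<^sup>+x. 0 \<partial>(lebesgue :: (real^'n) measure))"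
      by (rule nn_integral_cong_AE)
    then have "(\<integral>\<^sup>+y. msq G (y, l) * emeasure lebesgue (dball y l \<inter> UNIV) \<partial>lebesgue) = 0"
      by (subst (asm) swap_ball_integral[OF gm]) auto
    then have "AE y in lebesgue. msq G (y, l) * emeasure lebesgue (dball y l \<inter> UNIV) = 0"
      using gm by (subst (asm) nn_integral_0_iff_AE) (auto simp: emeasure_dball simp del: emeasure_completion)
    then show "AE y in lebesgue. G (y, l) = 0"
    proof eventually_elim
      case (elim y)
      then have "msq G (y, l) * ennreal (dil A powi l) = 0"
        by (simp add: emeasure_dball del: emeasure_completion)
      then have "msq G (y, l) = 0" using ennreal_b_powi_ne_0[of l] by simp
      then show ?case by (simp add: msq_def)
    qed
  qed
qed

end

theorem lemma4p9:
  fixes A :: "real^'n^'n" and \<Delta> :: "(real^'n) set" and r0 :: real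
    and p :: "real^'n \<Rightarrow> ereal"
  assumes "expansive A"
    and "open_ellipsoid0 \<Delta>" and "emeasure lebesgue \<Delta> = 1"
    and "r0 > 1"
    and "\<Delta> \<subseteq> (\<lambda>x. r0 *\<^sub>R x) ` \<Delta>"
    and "(\<lambda>x. r0 *\<^sub>R x) ` \<Delta> \<subseteq> (\<lambda>x. A *v x) ` \<Delta>"
    and "p \<in> C_log A \<Delta>"
  shows "\<exists>C::real. C > 0 \<and>
    (\<forall>G \<in> tent_space A \<Delta> p.
      \<exists>(lam :: nat \<Rightarrow> real) (B :: nat \<Rightarrow> (real^'n) set) (a :: nat \<Rightarrow> (real^'n) \<times> int \<Rightarrow> complex).
        (\<forall>j. lam j \<ge> 0) \<and>
        (\<forall>j. B j \<in> dballs A \<Delta>) \<and>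
        (\<forall>j. atom_inf A \<Delta> p (B j) (a j)) \<and>
        (AE z in RnZ. (\<lambda>j. complex_of_real (lam j) * a j z) sums G z \<and>
                      (\<lambda>j. lam j * cmod (a j z)) sums cmod (G z)) \<and>
        Lp_var_norm p (\<lambda>x. ennpowr
            (\<Sum>j. ennpowr (ennreal (lam j) / Lp_var_norm p (indicator (B j))) (p_under p) * indicator (B j) x)
            (1 / p_under p))
          \<le> ennreal C * tent_norm A \<Delta> p G)"
proof -
  interpret ed: ellipsoid_dilation A \<Delta> r0
    using assms by unfold_locales auto
  define pm where "pm = real_of_ereal (essinf lebesgue p)"
  define pp where "pp = real_of_ereal (esssup lebesgue p)"
  obtain cl ci pinf where "log_holder_exponent (Bk A \<Delta>) (dil A) (int ed.tau) (qnorm A \<Delta>)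
      (\<lambda>x. real_of_ereal (p x)) pm pp cl ci pinf"
    using ed.C_log_real[OF assms(7)] unfolding pm_def pp_def by blast
  then interpret lh: log_holder_exponent "Bk A \<Delta>" "dil A" "int ed.tau" "qnorm A \<Delta>"
      "\<lambda>x. real_of_ereal (p x)" pm pp cl ci pinf .
  define pu where "pu = p_under p"
  have pu: "0 < pu" "pu \<le> 1" "pu \<le> pm"
    using lh.pm_pos by (auto simp: pu_def p_under_def pm_def)
  \<comment> \<open>\<open>\<theta>\<close> solves \<open>q_small\<close>, and \<open>L\<close> is the largest of the three lower bounds\<close>
  define R where "R = (4::real) powr (pp / pu)"
  define \<delta> where "\<delta> = pm / (4 * pp)"
  define \<theta> where "\<theta> = (1 / (2 * R)) powr (1 / \<delta>)"
  have d0: "0 < \<delta>" using lh.pm_pos lh.pm_le_pp by (simp add: \<delta>_def)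
  have R1: "1 \<le> R" unfolding R_def using pu lh.pm_pos lh.pm_le_pp by (intro ge_one_powr_ge_zero) auto
  have th: "0 < \<theta>" "\<theta> \<le> 1" "\<theta> powr \<delta> * R = 1 / 2"
    using R1 d0 by (auto simp: \<theta>_def powr_powr intro!: powr_le1)
  define L where "L = max (max (real_of_int (6 * int ed.tau + 1) * (2 * dil A powi (4 * int ed.tau)))
      (4 * dil A powi (14 * int ed.tau))) (2 * dil A powi (14 * int ed.tau) * lh.local_const / \<theta>)"
  have "2 * dil A powi (14 * int ed.tau) * lh.local_const \<le> \<theta> * L"
  proof -
    have "2 * dil A powi (14 * int ed.tau) * lh.local_const / \<theta> \<le> L" by (simp add: L_def)
    then show ?thesis using th(1) by (simp add: pos_divide_le_eq mult.commute)
  qed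
  then interpret ts: tent_setting A \<Delta> r0 p pm pp cl ci pinf \<theta> L pu
    using th pu by unfold_locales (auto simp: L_def R_def \<delta>_def pu_def)
  show ?thesis
  proof (intro exI[of _ "2 * ts.norm_const"] conjI ballI)
    have C1: "1 \<le> ts.norm_const" by (simp add: ts.norm_const_def)
    then show "0 < 2 * ts.norm_const" by simp
    fix G assume "G \<in> tent_space A \<Delta> p"
    then have G: "G \<in> borel_measurable RnZ" "tent_norm A \<Delta> p G < \<infinity>" by (auto simp: tent_space_def)
    let ?goal = "\<exists>(lam :: nat \<Rightarrow> real) (B :: nat \<Rightarrow> (real^'n) set) (a :: nat \<Rightarrow> (real^'n) \<times> int \<Rightarrow> complex).
        (\<forall>j. lam j \<ge> 0) \<and> (\<forall>j. B j \<in> dballs A \<Delta>) \<and> (\<forall>j. atom_inf A \<Delta> p (B j) (a j)) \<and>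
        (AE z in RnZ. (\<lambda>j. complex_of_real (lam j) * a j z) sums G z \<and>
                      (\<lambda>j. lam j * cmod (a j z)) sums cmod (G z)) \<and>
        Lp_var_norm p (\<lambda>x. ennpowr
            (\<Sum>j. ennpowr (ennreal (lam j) / Lp_var_norm p (indicator (B j))) (p_under p) * indicator (B j) x)
            (1 / p_under p)) \<le> ennreal (2 * ts.norm_const) * tent_norm A \<Delta> p G"
    show ?goal
    proof (cases "tent_norm A \<Delta> p G = 0")
      case False
      \<comment> \<open>the modular condition holds for some \<open>t\<close> below twice the norm; this is the factor 2 in the constant\<close>
      obtain \<nu> where \<nu>: "tent_norm A \<Delta> p G = ennreal \<nu>" "0 < \<nu>"
        using G(2) False by (cases "tent_norm A \<Delta> p G") auto
      have "Lp_var_norm p (area A \<Delta> G) < ennreal (2 * \<nu>)"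
        using \<nu> by (simp add: tent_norm_def[symmetric] ennreal_less_iff)
      then obtain t where t: "0 < t" "ennreal t < ennreal (2 * \<nu>)"
        "(\<integral>\<^sup>+x. ennpowr (area A \<Delta> G x / ennreal t) (real_of_ereal (p x)) \<partial>lebesgue) \<le> 1"
        by (rule Lp_var_norm_lessE)
      have "ennreal (t * ts.norm_const) \<le> ennreal (2 * ts.norm_const * \<nu>)"
        using t C1 \<nu>(2) by (intro ennreal_leI) (simp add: ennreal_less_iff mult_right_mono)
      also have "\<dots> = ennreal (2 * ts.norm_const) * tent_norm A \<Delta> p G"
        unfolding \<nu>(1) using C1 \<nu>(2) by (intro ennreal_mult) auto
      finally have le: "ennreal (t * ts.norm_const) \<le> ennreal (2 * ts.norm_const) * tent_norm A \<Delta> p G" .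
      show ?thesis
        using ts.atomic_decomposition[OF G(1) t(1,3)] unfolding ts.pu_eq
        by (elim ex_forward conj_forward) (auto intro: order_trans[OF _ le])
    next
      case True
      have atom0: "atom_inf A \<Delta> p (ed.dball 0 0) (\<lambda>_. 0)"
        by (rule ts.bounded_area_atom) (auto simp: ts.msq_def[abs_def] ed.areasq_def ed.area_at_def)
      have norm0: "Lp_var_norm p (\<lambda>x. ennpowr
            (\<Sum>j::nat. ennpowr (ennreal 0 / Lp_var_norm p (indicator (ed.dball 0 0))) (p_under p) * indicator (ed.dball 0 0) x)
            (1 / p_under p)) = 0"
      proof -
        have "Lp_var_norm p (\<lambda>x. 0) \<le> ennreal e" if "0 < e" for e
          using that by (intro Lp_var_norm_le) auto
        then have "Lp_var_norm p (\<lambda>x. 0) \<le> 0"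
          by - (rule ennreal_le_epsilon, simp)
        then show ?thesis by simp
      qed
      show ?thesis
      proof (intro exI[of _ "\<lambda>_. 0 :: real"] exI[of _ "\<lambda>_. ed.dball 0 0"]
          exI[of _ "\<lambda>_ _. 0 :: complex"] conjI allI)
        show "AE z in RnZ. (\<lambda>j::nat. complex_of_real 0 * 0) sums G z \<and> (\<lambda>j::nat. 0 * cmod 0) sums cmod (G z)"
          using ts.zero_tent_norm[OF G(1) True] by eventually_elim simp
      qed (use atom0 norm0 ts.dball_dballs in auto)
    qed
  qed
qed

end
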